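(* Let $Q$ be a smooth $n$-dimensional manifold, let $L\in C^\infty(TQ)$ be a hyper-regular Lagrangian with Legendre map $\mathcal{F}L\colon TQ\to T^*Q$, and let $H=E_L\circ(\mathcal{F}L)^{-1}\in C^\infty(T^*Q)$ be the associated Hamiltonian. Then the map $X\mapsto\alpha=\mathcal{F}L\circ X$ is a bijection from the set of solutions of the generalized Lagrangian Hamilton--Jacobi problem for $L$ onto the set of solutions of the generalized Hamiltonian Hamilton--Jacobi problem for $Z_H$; and the same map is a bijection from the set of solutions of the Lagrangian Hamilton--Jacobi problem for $L$ onto the set of solutions of the Hamiltonian Hamilton--Jacobi problem for $Z_H$.
   Context: Lagrangian side: $\tau_Q\colon TQ\to Q$ has natural coordinates $(q^i,v^i)$. For $L\in C^\infty(TQ)$: $\theta_L=\frac{\partial L}{\partial v^i}dq^i$, $\omega_L=-d\theta_L$, $E_L=\Delta(L)-L$ with $\Delta=v^i\frac{\partial}{\partial v^i}$. The Legendre map $\mathcal{F}L\colon TQ\to T^*Q$ is the fibre derivative of $L$, $\mathcal{F}L(q,v)=(q^i,\partial L/\partial v^i)$; $L$ is hyper-regular if $\mathcal{F}L$ is a global diffeomorphism. Then $\omega_L$ is symplectic and $\Gamma_L$ is the unique vector field on $TQ$ with $i(\Gamma_L)\omega_L=dE_L$. A vector field on $Q$ is regarded as a section $X\colon Q\to TQ$. $X$ is a solution of the generalized Lagrangian Hamilton--Jacobi problem if for every integral curve $\gamma$ of $X$ (on an open interval), $\dot\gamma=X\circ\gamma$ is an integral curve of $\Gamma_L$. It is a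 solution of the Lagrangian Hamilton--Jacobi problem if moreover $X^*\omega_L=0$. Hamiltonian side: $\pi_Q\colon T^*Q\to Q$, $\omega=-d\theta$ is the canonical symplectic form of $T^*Q$ ($\theta=p_i\,dq^i$), and $Z_H$ is defined by $i(Z_H)\omega=dH$. A 1-form $\alpha\colon Q\to T^*Q$ is a solution of the generalized Hamiltonian Hamilton--Jacobi problem if, for every integral curve $\gamma$ (on an open interval) of $X=T\pi_Q\circ Z_H\circ\alpha$, the curve $\alpha\circ\gamma$ is an integral curve of $Z_H$. It is a solution of the Hamiltonian Hamilton--Jacobi problem if moreover $d\alpha=0$. *)

theory Defs
  imports "HOL-Analysis.Analysis"
begin

section \<open>Smooth functions between Euclidean spaces\<close>

text \<open>Intended for open sets \<open>S\<close>, where the Frechet derivative is unique.\<close>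

primrec Ck_on :: "nat \<Rightarrow> ('e::euclidean_space \<Rightarrow> 'f::real_normed_vector) \<Rightarrow> 'e set \<Rightarrow> bool" where
  "Ck_on 0 f S \<longleftrightarrow> continuous_on S f"
| "Ck_on (Suc k) f S \<longleftrightarrow>
     (\<forall>x\<in>S. f differentiable (at x)) \<and>
     (\<forall>v. Ck_on k (\<lambda>x. frechet_derivative f (at x) v) S)"

definition smooth_on :: "('e::euclidean_space \<Rightarrow> 'f::real_normed_vector) \<Rightarrow> 'e set \<Rightarrow> bool" where
  "smooth_on f S \<longleftrightarrow> (\<forall>k. Ck_on k f S)"

section \<open>Smooth manifolds\<close>

text \<open>
  A manifold is given by an atlas, its topology being the one induced by the charts. The model
  space is a Euclidean space \<open>'e\<close>; the dimension of the manifold is \<open>DIM('e)\<close>. A chart is a pair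
  of a domain and a coordinate map, whose values outside the domain are irrelevant. The atlas need
  not be maximal: none of the notions below depends on which atlas of a smooth structure is used.
\<close>

type_synonym ('a, 'e) chart = "'a set \<times> ('a \<Rightarrow> 'e)"

abbreviation cdom :: "('a, 'e) chart \<Rightarrow> 'a set" where "cdom \<equiv> fst"

abbreviation cmap :: "('a, 'e) chart \<Rightarrow> 'a \<Rightarrow> 'e" where "cmap \<equiv> snd"

abbreviation cinv :: "('a, 'e) chart \<Rightarrow> 'e \<Rightarrow> 'a" where
  "cinv c \<equiv> inv_into (cdom c) (cmap c)"

definition points :: "('a, 'e) chart set \<Rightarrow> 'a set" where
  "points A = (\<Union>c\<in>A. cdom c)"

definition smooth_atlas :: "('a, 'e::euclidean_space) chart set \<Rightarrow> bool" where
  "smooth_atlas A \<longleftrightarrow>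
     (\<forall>c\<in>A. inj_on (cmap c) (cdom c) \<and> open (cmap c ` cdom c)) \<and>
     (\<forall>c\<in>A. \<forall>d\<in>A. open (cmap c ` (cdom c \<inter> cdom d)) \<and>
        smooth_on (cmap d \<circ> cinv c) (cmap c ` (cdom c \<inter> cdom d)))"

definition atlas_topology :: "('a, 'e::euclidean_space) chart set \<Rightarrow> 'a topology" where
  "atlas_topology A = topology_generated_by {{p \<in> cdom c. cmap c p \<in> W} | c W. c \<in> A \<and> open W}"

definition smooth_manifold :: "('a, 'e::euclidean_space) chart set \<Rightarrow> bool" where
  "smooth_manifold A \<longleftrightarrow>
     smooth_atlas A \<and> Hausdorff_space (atlas_topology A) \<and> second_countable (atlas_topology A)"

text \<open>An arbitrary chart around \<open>p\<close>, for definitions that do not depend on the choice.\<close>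

definition chart_at :: "('a, 'e) chart set \<Rightarrow> 'a \<Rightarrow> ('a, 'e) chart" where
  "chart_at A p = (SOME c. c \<in> A \<and> p \<in> cdom c)"

definition smooth_function :: "('a, 'e::euclidean_space) chart set \<Rightarrow> ('a \<Rightarrow> real) \<Rightarrow> bool" where
  "smooth_function A f \<longleftrightarrow> (\<forall>c\<in>A. smooth_on (f \<circ> cinv c) (cmap c ` cdom c))"

text \<open>The openness requirement amounts to continuity of \<open>F\<close>.\<close>

definition smooth_map ::
  "('a, 'e::euclidean_space) chart set \<Rightarrow> ('b, 'f::euclidean_space) chart set \<Rightarrow> ('a \<Rightarrow> 'b) \<Rightarrow> bool" where
  "smooth_map A B F \<longleftrightarrow>
     F ` points A \<subseteq> points B \<and>
     (\<forall>c\<in>A. \<forall>d\<in>B. open (cmap c ` {p \<in> cdom c. F p \<in> cdom d}) \<and>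
        smooth_on (cmap d \<circ> F \<circ> cinv c) (cmap c ` {p \<in> cdom c. F p \<in> cdom d}))"

definition diffeomorphism ::
  "('a, 'e::euclidean_space) chart set \<Rightarrow> ('b, 'f::euclidean_space) chart set \<Rightarrow> ('a \<Rightarrow> 'b) \<Rightarrow> bool" where
  "diffeomorphism A B F \<longleftrightarrow>
     bij_betw F (points A) (points B) \<and> smooth_map A B F \<and>
     smooth_map B A (inv_into (points A) F)"

section \<open>Tangent and cotangent bundles\<close>

text \<open>
  A tangent vector at \<open>p\<close> is the family of its coordinate representations in all charts around
  \<open>p\<close>, related by the derivatives of the transition maps, and padded with \<open>0\<close> for all other
  arguments. The vector space operations are pointwise.
\<close>

type_synonym ('a, 'e) tvec = "('a, 'e) chart \<Rightarrow> 'e"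

definition tangent_space :: "('a, 'e::euclidean_space) chart set \<Rightarrow> 'a \<Rightarrow> ('a, 'e) tvec set" where
  "tangent_space A p =
     {v. (\<forall>c. c \<notin> A \<or> p \<notin> cdom c \<longrightarrow> v c = 0) \<and>
         (\<forall>c\<in>A. \<forall>d\<in>A. p \<in> cdom c \<and> p \<in> cdom d \<longrightarrow>
            v d = frechet_derivative (cmap d \<circ> cinv c) (at (cmap c p)) (v c))}"

text \<open>The tangent vector at \<open>p\<close> whose representation in the chart \<open>c\<close> is \<open>e\<close>; for basis vectors
  \<open>e\<close> these are the coordinate vectors of \<open>c\<close>.\<close>

definition coord_vec ::
  "('a, 'e::euclidean_space) chart set \<Rightarrow> ('a, 'e) chart \<Rightarrow> 'a \<Rightarrow> 'e \<Rightarrow> ('a, 'e) tvec" where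
  "coord_vec A c p e = (\<lambda>d. if d \<in> A \<and> p \<in> cdom d
     then frechet_derivative (cmap d \<circ> cinv c) (at (cmap c p)) e else 0)"

definition tangent_chart ::
  "('a, 'e::euclidean_space) chart set \<Rightarrow> ('a, 'e) chart \<Rightarrow> ('a \<times> ('a, 'e) tvec, 'e \<times> 'e) chart" where
  "tangent_chart A c = (Sigma (cdom c) (tangent_space A), \<lambda>(p, v). (cmap c p, v c))"

definition tangent_atlas ::
  "('a, 'e::euclidean_space) chart set \<Rightarrow> ('a \<times> ('a, 'e) tvec, 'e \<times> 'e) chart set" where
  "tangent_atlas A = tangent_chart A ` A"

definition tangent_map ::
  "('a, 'e::euclidean_space) chart set \<Rightarrow> ('b, 'f::euclidean_space) chart set \<Rightarrow> ('a \<Rightarrow> 'b) \<Rightarrow>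
   'a \<times> ('a, 'e) tvec \<Rightarrow> 'b \<times> ('b, 'f) tvec" where
  "tangent_map A B F = (\<lambda>(p, v). (F p, \<lambda>d. if d \<in> B \<and> F p \<in> cdom d
     then let c = chart_at A p
          in frechet_derivative (cmap d \<circ> F \<circ> cinv c) (at (cmap c p)) (v c)
     else 0))"

type_synonym ('a, 'e) covec = "('a, 'e) tvec \<Rightarrow> real"

definition cotangent_space :: "('a, 'e::euclidean_space) chart set \<Rightarrow> 'a \<Rightarrow> ('a, 'e) covec set" where
  "cotangent_space A p =
     {\<alpha> \<in> extensional (tangent_space A p).
        \<forall>v\<in>tangent_space A p. \<forall>w\<in>tangent_space A p. \<forall>a b.
          \<alpha> (\<lambda>c. a *\<^sub>R v c + b *\<^sub>R w c) = a * \<alpha> v + b * \<alpha> w}"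

text \<open>The components of a covector with respect to the coordinate differentials of \<open>c\<close>.\<close>

definition covec_coords ::
  "('a, 'e::euclidean_space) chart set \<Rightarrow> ('a, 'e) chart \<Rightarrow> 'a \<Rightarrow> ('a, 'e) covec \<Rightarrow> 'e" where
  "covec_coords A c p \<alpha> = (\<Sum>i\<in>Basis. \<alpha> (coord_vec A c p i) *\<^sub>R i)"

definition cotangent_chart ::
  "('a, 'e::euclidean_space) chart set \<Rightarrow> ('a, 'e) chart \<Rightarrow> ('a \<times> ('a, 'e) covec, 'e \<times> 'e) chart" where
  "cotangent_chart A c =
     (Sigma (cdom c) (cotangent_space A), \<lambda>(p, \<alpha>). (cmap c p, covec_coords A c p \<alpha>))"

definition cotangent_atlas ::
  "('a, 'e::euclidean_space) chart set \<Rightarrow> ('a \<times> ('a, 'e) covec, 'e \<times> 'e) chart set" where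
  "cotangent_atlas A = cotangent_chart A ` A"

section \<open>Vector fields, integral curves and differential forms\<close>

text \<open>Sections are maps into the total space. They are extensional, so that equality of sections
  is equality of functions.\<close>

definition vector_field ::
  "('a, 'e::euclidean_space) chart set \<Rightarrow> ('a \<Rightarrow> 'a \<times> ('a, 'e) tvec) \<Rightarrow> bool" where
  "vector_field A X \<longleftrightarrow>
     X \<in> extensional (points A) \<and> (\<forall>p\<in>points A. fst (X p) = p) \<and> smooth_map A (tangent_atlas A) X"

definition one_form ::
  "('a, 'e::euclidean_space) chart set \<Rightarrow> ('a \<Rightarrow> 'a \<times> ('a, 'e) covec) \<Rightarrow> bool" where
  "one_form A \<alpha> \<longleftrightarrow>
     \<alpha> \<in> extensional (points A) \<and> (\<forall>p\<in>points A. fst (\<alpha> p) = p) \<and> smooth_map A (cotangent_atlas A) \<alpha>"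

definition velocity ::
  "('a, 'e::euclidean_space) chart set \<Rightarrow> (real \<Rightarrow> 'a) \<Rightarrow> real \<Rightarrow> 'a \<times> ('a, 'e) tvec" where
  "velocity A \<gamma> t = (\<gamma> t, \<lambda>c. if c \<in> A \<and> \<gamma> t \<in> cdom c
     then vector_derivative (cmap c \<circ> \<gamma>) (at t) else 0)"

text \<open>The open interval \<open>I\<close> is regarded as a manifold with a single chart.\<close>

definition integral_curve ::
  "('a, 'e::euclidean_space) chart set \<Rightarrow> ('a \<Rightarrow> 'a \<times> ('a, 'e) tvec) \<Rightarrow> real set \<Rightarrow> (real \<Rightarrow> 'a) \<Rightarrow> bool" where
  "integral_curve A X I \<gamma> \<longleftrightarrow>
     open I \<and> is_interval I \<and> smooth_map {(I, \<lambda>t. t)} A \<gamma> \<and> (\<forall>t\<in>I. velocity A \<gamma> t = X (\<gamma> t))"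

text \<open>Below, 1-forms and 2-forms are also given by their values \<open>\<beta> p v\<close> and \<open>\<omega> p v w\<close> on
  tangent vectors at \<open>p\<close>.\<close>

definition differential ::
  "('a, 'e::euclidean_space) chart set \<Rightarrow> ('a \<Rightarrow> real) \<Rightarrow> 'a \<Rightarrow> ('a, 'e) tvec \<Rightarrow> real" where
  "differential A f p v =
     (let c = chart_at A p in frechet_derivative (f \<circ> cinv c) (at (cmap c p)) (v c))"

text \<open>In coordinates \<open>x\<^sup>i\<close>, the exterior derivative of \<open>\<Sum>\<^sub>i \<beta>\<^sub>i dx\<^sup>i\<close> is
  \<open>\<Sum>\<^sub>i \<Sum>\<^sub>j (\<partial>\<beta>\<^sub>i/\<partial>x\<^sup>j) dx\<^sup>j \<and> dx\<^sup>i\<close>, with \<open>(dx\<^sup>j \<and> dx\<^sup>i)(v, w) = v\<^sup>j w\<^sup>i - w\<^sup>j v\<^sup>i\<close>.\<close>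

definition exterior_derivative ::
  "('a, 'e::euclidean_space) chart set \<Rightarrow> ('a \<Rightarrow> ('a, 'e) tvec \<Rightarrow> real) \<Rightarrow>
   'a \<Rightarrow> ('a, 'e) tvec \<Rightarrow> ('a, 'e) tvec \<Rightarrow> real" where
  "exterior_derivative A \<beta> p v w =
     (let c = chart_at A p;
          D = frechet_derivative (\<lambda>x. covec_coords A c (cinv c x) (\<beta> (cinv c x))) (at (cmap c p))
      in D (v c) \<bullet> w c - D (w c) \<bullet> v c)"

definition closed_one_form ::
  "('a, 'e::euclidean_space) chart set \<Rightarrow> ('a \<Rightarrow> 'a \<times> ('a, 'e) covec) \<Rightarrow> bool" where
  "closed_one_form A \<alpha> \<longleftrightarrow>
     (\<forall>p\<in>points A. \<forall>v\<in>tangent_space A p. \<forall>w\<in>tangent_space A p.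
        exterior_derivative A (\<lambda>q. snd (\<alpha> q)) p v w = 0)"

definition pullback2 ::
  "('a, 'e::euclidean_space) chart set \<Rightarrow> ('b, 'f::euclidean_space) chart set \<Rightarrow> ('a \<Rightarrow> 'b) \<Rightarrow>
   ('b \<Rightarrow> ('b, 'f) tvec \<Rightarrow> ('b, 'f) tvec \<Rightarrow> real) \<Rightarrow>
   'a \<Rightarrow> ('a, 'e) tvec \<Rightarrow> ('a, 'e) tvec \<Rightarrow> real" where
  "pullback2 A B F \<omega> p v w = \<omega> (F p) (snd (tangent_map A B F (p, v))) (snd (tangent_map A B F (p, w)))"

text \<open>The unique vector field \<open>Z\<close> with \<open>i(Z)\<omega> = df\<close>, meaningful for symplectic \<open>\<omega>\<close>.\<close>

definition hamiltonian_vector_field ::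
  "('a, 'e::euclidean_space) chart set \<Rightarrow> ('a \<Rightarrow> ('a, 'e) tvec \<Rightarrow> ('a, 'e) tvec \<Rightarrow> real) \<Rightarrow>
   ('a \<Rightarrow> real) \<Rightarrow> 'a \<Rightarrow> 'a \<times> ('a, 'e) tvec" where
  "hamiltonian_vector_field A \<omega> f =
     (THE Z. vector_field A Z \<and>
        (\<forall>p\<in>points A. \<forall>w\<in>tangent_space A p. \<omega> p (snd (Z p)) w = differential A f p w))"

section \<open>Lagrangian side\<close>

text \<open>\<open>\<theta>\<^sub>L = \<Sum>\<^sub>i (\<partial>L/\<partial>v\<^sup>i) dq\<^sup>i\<close> in the natural coordinates \<open>(q, v)\<close> of \<open>TQ\<close>.\<close>

definition lagrange_one_form ::
  "('a, 'e::euclidean_space) chart set \<Rightarrow> ('a \<times> ('a, 'e) tvec \<Rightarrow> real) \<Rightarrow>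
   'a \<times> ('a, 'e) tvec \<Rightarrow> ('a \<times> ('a, 'e) tvec, 'e \<times> 'e) tvec \<Rightarrow> real" where
  "lagrange_one_form A L w \<xi> =
     (let c = tangent_chart A (chart_at A (fst w)); (q, v) = cmap c w
      in \<Sum>i\<in>Basis. frechet_derivative (\<lambda>u. L (cinv c (q, u))) (at v) i * (fst (\<xi> c) \<bullet> i))"

definition lagrange_two_form ::
  "('a, 'e::euclidean_space) chart set \<Rightarrow> ('a \<times> ('a, 'e) tvec \<Rightarrow> real) \<Rightarrow>
   'a \<times> ('a, 'e) tvec \<Rightarrow> ('a \<times> ('a, 'e) tvec, 'e \<times> 'e) tvec \<Rightarrow>
   ('a \<times> ('a, 'e) tvec, 'e \<times> 'e) tvec \<Rightarrow> real" where
  "lagrange_two_form A L w \<xi> \<eta> = - exterior_derivative (tangent_atlas A) (lagrange_one_form A L) w \<xi> \<eta>"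

text \<open>The Liouville vector field \<open>\<Delta> = \<Sum>\<^sub>i v\<^sup>i \<partial>/\<partial>v\<^sup>i\<close>.\<close>

definition liouville_field ::
  "('a, 'e::euclidean_space) chart set \<Rightarrow> 'a \<times> ('a, 'e) tvec \<Rightarrow>
   ('a \<times> ('a, 'e) tvec) \<times> ('a \<times> ('a, 'e) tvec, 'e \<times> 'e) tvec" where
  "liouville_field A w =
     (let c = tangent_chart A (chart_at A (fst w)); (q, v) = cmap c w
      in (w, coord_vec (tangent_atlas A) c w (0, v)))"

definition energy ::
  "('a, 'e::euclidean_space) chart set \<Rightarrow> ('a \<times> ('a, 'e) tvec \<Rightarrow> real) \<Rightarrow> 'a \<times> ('a, 'e) tvec \<Rightarrow> real" where
  "energy A L w = differential (tangent_atlas A) L w (snd (liouville_field A w)) - L w"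

definition lagrangian_vector_field ::
  "('a, 'e::euclidean_space) chart set \<Rightarrow> ('a \<times> ('a, 'e) tvec \<Rightarrow> real) \<Rightarrow>
   'a \<times> ('a, 'e) tvec \<Rightarrow> ('a \<times> ('a, 'e) tvec) \<times> ('a \<times> ('a, 'e) tvec, 'e \<times> 'e) tvec" where
  "lagrangian_vector_field A L =
     hamiltonian_vector_field (tangent_atlas A) (lagrange_two_form A L) (energy A L)"

text \<open>The fibre derivative: \<open>\<F>L(v)(u)\<close> is the derivative of \<open>t \<mapsto> L(v + t u)\<close> at \<open>0\<close>.\<close>

definition legendre_map ::
  "('a, 'e::euclidean_space) chart set \<Rightarrow> ('a \<times> ('a, 'e) tvec \<Rightarrow> real) \<Rightarrow>
   'a \<times> ('a, 'e) tvec \<Rightarrow> 'a \<times> ('a, 'e) covec" where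
  "legendre_map A L = (\<lambda>(p, v). (p, \<lambda>u\<in>tangent_space A p.
     deriv (\<lambda>t::real. L (p, \<lambda>c. v c + t *\<^sub>R u c)) 0))"

definition hyper_regular ::
  "('a, 'e::euclidean_space) chart set \<Rightarrow> ('a \<times> ('a, 'e) tvec \<Rightarrow> real) \<Rightarrow> bool" where
  "hyper_regular A L \<longleftrightarrow> diffeomorphism (tangent_atlas A) (cotangent_atlas A) (legendre_map A L)"

definition generalized_lagrangian_HJ ::
  "('a, 'e::euclidean_space) chart set \<Rightarrow> ('a \<times> ('a, 'e) tvec \<Rightarrow> real) \<Rightarrow>
   ('a \<Rightarrow> 'a \<times> ('a, 'e) tvec) \<Rightarrow> bool" where
  "generalized_lagrangian_HJ A L X \<longleftrightarrow>
     vector_field A X \<and>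
     (\<forall>I \<gamma>. integral_curve A X I \<gamma> \<longrightarrow>
        integral_curve (tangent_atlas A) (lagrangian_vector_field A L) I (X \<circ> \<gamma>))"

definition lagrangian_HJ ::
  "('a, 'e::euclidean_space) chart set \<Rightarrow> ('a \<times> ('a, 'e) tvec \<Rightarrow> real) \<Rightarrow>
   ('a \<Rightarrow> 'a \<times> ('a, 'e) tvec) \<Rightarrow> bool" where
  "lagrangian_HJ A L X \<longleftrightarrow>
     generalized_lagrangian_HJ A L X \<and>
     (\<forall>p\<in>points A. \<forall>v\<in>tangent_space A p. \<forall>w\<in>tangent_space A p.
        pullback2 A (tangent_atlas A) X (lagrange_two_form A L) p v w = 0)"

section \<open>Hamiltonian side\<close>

text \<open>\<open>\<theta> = \<Sum>\<^sub>i p\<^sub>i dq\<^sup>i\<close> in the natural coordinates \<open>(q, p)\<close> of \<open>T\<^sup>*Q\<close>.\<close>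

definition canonical_one_form ::
  "('a, 'e::euclidean_space) chart set \<Rightarrow>
   'a \<times> ('a, 'e) covec \<Rightarrow> ('a \<times> ('a, 'e) covec, 'e \<times> 'e) tvec \<Rightarrow> real" where
  "canonical_one_form A z \<xi> =
     (let c = cotangent_chart A (chart_at A (fst z)); (q, p) = cmap c z
      in \<Sum>i\<in>Basis. (p \<bullet> i) * (fst (\<xi> c) \<bullet> i))"

definition canonical_two_form ::
  "('a, 'e::euclidean_space) chart set \<Rightarrow>
   'a \<times> ('a, 'e) covec \<Rightarrow> ('a \<times> ('a, 'e) covec, 'e \<times> 'e) tvec \<Rightarrow>
   ('a \<times> ('a, 'e) covec, 'e \<times> 'e) tvec \<Rightarrow> real" where
  "canonical_two_form A z \<xi> \<eta> = - exterior_derivative (cotangent_atlas A) (canonical_one_form A) z \<xi> \<eta>"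

definition canonical_vector_field ::
  "('a, 'e::euclidean_space) chart set \<Rightarrow> ('a \<times> ('a, 'e) covec \<Rightarrow> real) \<Rightarrow>
   'a \<times> ('a, 'e) covec \<Rightarrow> ('a \<times> ('a, 'e) covec) \<times> ('a \<times> ('a, 'e) covec, 'e \<times> 'e) tvec" where
  "canonical_vector_field A H =
     hamiltonian_vector_field (cotangent_atlas A) (canonical_two_form A) H"

definition hamiltonian ::
  "('a, 'e::euclidean_space) chart set \<Rightarrow> ('a \<times> ('a, 'e) tvec \<Rightarrow> real) \<Rightarrow> 'a \<times> ('a, 'e) covec \<Rightarrow> real" where
  "hamiltonian A L = energy A L \<circ> inv_into (points (tangent_atlas A)) (legendre_map A L)"

definition generalized_hamiltonian_HJ ::
  "('a, 'e::euclidean_space) chart set \<Rightarrow> ('a \<times> ('a, 'e) covec \<Rightarrow> real) \<Rightarrow>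
   ('a \<Rightarrow> 'a \<times> ('a, 'e) covec) \<Rightarrow> bool" where
  "generalized_hamiltonian_HJ A H \<alpha> \<longleftrightarrow>
     one_form A \<alpha> \<and>
     (\<forall>I \<gamma>. integral_curve A
          (tangent_map (cotangent_atlas A) A fst \<circ> canonical_vector_field A H \<circ> \<alpha>) I \<gamma> \<longrightarrow>
        integral_curve (cotangent_atlas A) (canonical_vector_field A H) I (\<alpha> \<circ> \<gamma>))"

definition hamiltonian_HJ ::
  "('a, 'e::euclidean_space) chart set \<Rightarrow> ('a \<times> ('a, 'e) covec \<Rightarrow> real) \<Rightarrow>
   ('a \<Rightarrow> 'a \<times> ('a, 'e) covec) \<Rightarrow> bool" where
  "hamiltonian_HJ A H \<alpha> \<longleftrightarrow> generalized_hamiltonian_HJ A H \<alpha> \<and> closed_one_form A \<alpha>"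

end

theory Submission
  imports Defs
begin

text \<open>
  Since \<open>FL\<close> preserves fibres, \<open>\<theta>\<^sub>L = FL\<^sup>* \<theta>\<close>, hence \<open>\<omega>\<^sub>L = FL\<^sup>* \<omega>\<close>. As \<open>E\<^sub>L = H \<circ> FL\<close> and \<open>FL\<close> is a
  diffeomorphism, \<open>\<Gamma>\<^sub>L\<close> and \<open>Z\<^sub>H\<close> are \<open>FL\<close>-related, so \<open>FL\<close> and its inverse exchange their integral
  curves. Moreover \<open>T\<pi> \<circ> Z\<^sub>H \<circ> FL\<close> is the identity of \<open>TQ\<close>, so that for \<open>\<alpha> = FL \<circ> X\<close> the base field
  \<open>T\<pi> \<circ> Z\<^sub>H \<circ> \<alpha>\<close> is \<open>X\<close> itself: the two generalized conditions quantify over the same curves \<open>\<gamma>\<close>,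
  and each instance for \<open>X \<circ> \<gamma>\<close> is equivalent to the one for \<open>\<alpha> \<circ> \<gamma>\<close>. Finally \<open>\<alpha>\<^sup>* \<theta> = \<alpha>\<close> gives
  \<open>X\<^sup>* \<omega>\<^sub>L = \<alpha>\<^sup>* \<omega> = - d\<alpha>\<close>.
\<close>

section \<open>Calculus of smooth functions\<close>

text \<open>The notions involved are defined through choices: a chart picked at each point by
  \<open>chart_at\<close>, and vector fields picked by \<open>THE\<close>. Before any of them can be
  moved along a map, each needs a formula valid in every chart, and each \<open>THE\<close> needs
  existence and uniqueness. For the exterior derivative, chart independence and naturality come out
  of a single computation whose second-order terms must cancel; this is why symmetry of second
  derivatives is established. For \<open>THE\<close>, only the canonical form is inverted by hand:
  in natural coordinates it is constant, and Hamilton's equations give the unique solution. The same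
  statement for \<omega>_L is transported along FL instead of being derived from the Hessian of L. A
  further point shapes many statements: sections are extensional, while curves and inverse maps are
  arbitrary outside their domains. Composites therefore agree only on the manifold or on the
  interval, which is bridged by congruence lemmas and explains why the map on sections is
  \<open>compose (points A) (legendre_map A L)\<close>.\<close>

abbreviation FD :: "('e::real_normed_vector \<Rightarrow> 'f::real_normed_vector) \<Rightarrow> 'e \<Rightarrow> 'e \<Rightarrow> 'f" where
  "FD f x \<equiv> frechet_derivative f (at x)"

section \<open>Closure properties of functions of class C^k\<close>

lemma Ck_on_SucD: "Ck_on (Suc k) f S \<Longrightarrow> Ck_on k f S"
proof (induction k arbitrary: f)
  case 0
  then show ?case
    by (auto intro!: continuous_at_imp_continuous_on differentiable_imp_continuous_within)
next
  case (Suc k)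
  then show ?case by auto
qed

lemma Ck_on_subset: "Ck_on k f S \<Longrightarrow> T \<subseteq> S \<Longrightarrow> Ck_on k f T"
  by (induction k arbitrary: f) (auto intro: continuous_on_subset)

text \<open>\<open>frechet_derivative\<close> is a Hilbert choice among the derivatives, and
  functions that agree near \<open>x\<close> have the same ones. The choices coincide even where no
  derivative exists, so differentiability need not be checked before rewriting.\<close>

lemma FD_cong:
  assumes "open S" "x \<in> S" "\<And>y. y \<in> S \<Longrightarrow> f y = g y"
  shows "FD f x = FD g x"
proof -
  have "(f has_derivative d) (at x) \<longleftrightarrow> (g has_derivative d) (at x)" for d
    using has_derivative_transform_within_open[OF _ assms(1,2)] assms(3) by metis
  then show ?thesis by (simp add: frechet_derivative_def)
qed

lemma differentiable_cong:
  assumes "open S" "x \<in> S" "\<And>y. y \<in> S \<Longrightarrow> f y = g y" "f differentiable at x"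
  shows "g differentiable at x"
  using assms has_derivative_transform_within_open unfolding differentiable_def by metis

lemma Ck_on_cong:
  assumes "open S" "\<And>y. y \<in> S \<Longrightarrow> f y = g y" "Ck_on k f S"
  shows "Ck_on k g S"
  using assms(2,3)
proof (induction k arbitrary: f g)
  case 0
  then show ?case using continuous_on_eq[of S f g] by auto
next
  case (Suc k)
  have "Ck_on k (\<lambda>x. FD g x v) S" for v
    using Suc.prems by - (rule Suc.IH[of "\<lambda>x. FD f x v"], auto simp: FD_cong[OF assms(1), of _ f g])
  then show ?case
    using Suc.prems by (auto intro!: differentiable_cong[OF assms(1), of _ f g])
qed

text \<open>On open sets every clause of \<open>Ck_on\<close> is a condition at single points,
  continuity included. Smoothness of a chart representation can thus be proved after shrinking the
  domain around each point.\<close>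

lemma Ck_on_local:
  assumes "\<And>x. x \<in> S \<Longrightarrow> \<exists>U. open U \<and> x \<in> U \<and> Ck_on k f U"
  shows "Ck_on k f S"
  using assms
proof (induction k arbitrary: f)
  case 0
  then show ?case
    by (metis Ck_on.simps(1) continuous_at_imp_continuous_on continuous_on_eq_continuous_at)
next
  case (Suc k)
  have "Ck_on k (\<lambda>x. FD f x v) S" for v
    by (rule Suc.IH) (use Suc.prems in \<open>metis Ck_on.simps(2)\<close>)
  then show ?case using Suc.prems by (metis Ck_on.simps(2))
qed

lemma Ck_on_const: "Ck_on k (\<lambda>x. c) S"
  by (induction k arbitrary: c) auto

lemma Ck_on_linear:
  assumes "bounded_linear f"
  shows "Ck_on k f S"
proof (cases k)
  case 0
  then show ?thesis by (simp add: bounded_linear.continuous_on[OF assms continuous_on_id])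
next
  case (Suc m)
  have hd: "(f has_derivative f) (at x)" for x
    using assms by (rule bounded_linear_imp_has_derivative)
  have "FD f x = f" for x
    using frechet_derivative_at[OF hd] by simp
  then show ?thesis
    using hd by (auto simp: Suc Ck_on_const intro: differentiableI)
qed

lemma FD_has_derivative: "f differentiable at x \<Longrightarrow> (f has_derivative FD f x) (at x)"
  by (simp add: frechet_derivative_works)

lemma FD_eqI: "(f has_derivative f') (at x) \<Longrightarrow> FD f x = f'"
  by (metis frechet_derivative_at)

lemma Ck_on_add:
  assumes "open S" "Ck_on k f S" "Ck_on k g S"
  shows "Ck_on k (\<lambda>x. f x + g x) S"
  using assms(2,3)
proof (induction k arbitrary: f g)
  case 0
  then show ?case by (auto intro: continuous_intros)
next
  case (Suc k)
  have hd: "((\<lambda>x. f x + g x) has_derivative (\<lambda>v. FD f x v + FD g x v)) (at x)" if "x \<in> S" for x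
    using Suc.prems that by (auto intro!: has_derivative_add FD_has_derivative)
  have "Ck_on k (\<lambda>x. FD (\<lambda>x. f x + g x) x v) S" for v
  proof (rule Ck_on_cong[OF assms(1)])
    show "Ck_on k (\<lambda>x. FD f x v + FD g x v) S"
      using Suc.prems by - (rule Suc.IH; auto)
  qed (simp add: FD_eqI[OF hd])
  then show ?case
    using hd by (auto intro: differentiableI)
qed

text \<open>Leibniz rule. The derivative contains \<open>f\<close> and \<open>g\<close> themselves
  besides their derivatives, so the induction hypothesis is applied to mixed pairs, one member of
  which is lowered in class by \<open>Ck_on_SucD\<close>.\<close>

lemma Ck_on_bilinear:
  assumes "bounded_bilinear B" "open S" "Ck_on k f S" "Ck_on k g S"
  shows "Ck_on k (\<lambda>x. B (f x) (g x)) S"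
  using assms(3,4)
proof (induction k arbitrary: f g)
  case 0
  then show ?case by (auto intro: bounded_bilinear.continuous_on[OF assms(1)])
next
  case (Suc k)
  have hd: "((\<lambda>x. B (f x) (g x)) has_derivative (\<lambda>v. B (f x) (FD g x v) + B (FD f x v) (g x))) (at x)"
    if "x \<in> S" for x
    using Suc.prems that by (auto intro!: bounded_bilinear.FDERIV[OF assms(1)] FD_has_derivative)
  have "Ck_on k (\<lambda>x. FD (\<lambda>x. B (f x) (g x)) x v) S" for v
  proof (rule Ck_on_cong[OF assms(2)])
    show "Ck_on k (\<lambda>x. B (f x) (FD g x v) + B (FD f x v) (g x)) S"
      using Suc.prems Ck_on_SucD[OF Suc.prems(1)] Ck_on_SucD[OF Suc.prems(2)]
      by - (rule Ck_on_add[OF assms(2)]; rule Suc.IH; auto)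
  qed (simp add: FD_eqI[OF hd])
  then show ?case
    using hd by (auto intro: differentiableI)
qed

lemma Ck_on_sum:
  assumes "open S" "\<And>i. i \<in> I \<Longrightarrow> Ck_on k (f i) S"
  shows "Ck_on k (\<lambda>x. \<Sum>i\<in>I. f i x) S"
  using assms(2)
  by (induction I rule: infinite_finite_induct) (auto intro!: Ck_on_const Ck_on_add[OF assms(1)])

lemma linear_eq_sum_Basis:
  fixes x :: "'e::euclidean_space"
  assumes "linear f"
  shows "f x = (\<Sum>i\<in>Basis. (x \<bullet> i) *\<^sub>R f i)"
  by (metis (no_types, lifting) assms euclidean_representation linear_scale linear_sum sum.cong)

text \<open>\<open>Ck_on\<close> speaks of derivatives in a fixed direction, whereas the chain rule
  produces the derivative of \<open>g\<close> in the direction \<open>FD f x v\<close>, which varies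
  with \<open>x\<close>. Expanding that direction in the basis leaves fixed directions with
  coefficients of class C^k.\<close>

lemma Ck_on_compose:
  fixes f :: "'e::euclidean_space \<Rightarrow> 'f::euclidean_space"
  assumes "open S" "Ck_on k g T" "Ck_on k f S" "f ` S \<subseteq> T"
  shows "Ck_on k (\<lambda>x. g (f x)) S"
  using assms(2-)
proof (induction k arbitrary: f g)
  case 0
  then show ?case
    by (metis Ck_on.simps(1) continuous_on_compose2)
next
  case (Suc k)
  have d: "f differentiable at x" "g differentiable at (f x)" if "x \<in> S" for x
    using Suc.prems that by auto
  have hd: "((\<lambda>x. g (f x)) has_derivative (\<lambda>v. FD g (f x) (FD f x v))) (at x)" if "x \<in> S" for x
    by (intro has_derivative_compose[OF FD_has_derivative FD_has_derivative] d that)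
  have "Ck_on k (\<lambda>x. FD (\<lambda>x. g (f x)) x v) S" for v
  proof (rule Ck_on_cong[OF assms(1)])
    have fk: "Ck_on k f S" using Suc.prems(2) Ck_on_SucD by blast
    show "Ck_on k (\<lambda>x. \<Sum>i\<in>Basis. (FD f x v \<bullet> i) *\<^sub>R FD g (f x) i) S"
    proof (intro Ck_on_sum[OF assms(1)] Ck_on_bilinear[OF bounded_bilinear_scaleR assms(1)]
        Ck_on_bilinear[OF bounded_bilinear_inner assms(1)] Ck_on_const)
      fix i :: 'f
      show "Ck_on k (\<lambda>x. FD g (f x) i) S"
        using Suc.prems by - (rule Suc.IH[OF _ fk], auto)
    qed (use Suc.prems in auto)
    fix x assume "x \<in> S"
    then show "(\<Sum>i\<in>Basis. (FD f x v \<bullet> i) *\<^sub>R FD g (f x) i) = FD (\<lambda>x. g (f x)) x v"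
      using linear_eq_sum_Basis[OF linear_frechet_derivative[OF d(2)]]
      by (simp add: FD_eqI[OF hd])
  qed
  then show ?case
    using hd by (auto intro: differentiableI)
qed

lemma Ck_on_linear_compose:
  assumes "bounded_linear h" "open S" "Ck_on k f S"
  shows "Ck_on k (\<lambda>x. h (f x)) S"
  using assms(3)
proof (induction k arbitrary: f)
  case 0
  then show ?case by (auto intro: bounded_linear.continuous_on[OF assms(1)])
next
  case (Suc k)
  have hd: "((\<lambda>x. h (f x)) has_derivative (\<lambda>v. h (FD f x v))) (at x)" if "x \<in> S" for x
    using Suc.prems that by (auto intro!: bounded_linear.has_derivative[OF assms(1)] FD_has_derivative)
  have "Ck_on k (\<lambda>x. FD (\<lambda>x. h (f x)) x v) S" for v
    by (rule Ck_on_cong[OF assms(2) _ Suc.IH]) (use Suc.prems FD_eqI[OF hd] in auto)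
  then show ?case
    using hd by (auto intro: differentiableI)
qed

lemma smooth_on_subset: "smooth_on f S \<Longrightarrow> T \<subseteq> S \<Longrightarrow> smooth_on f T"
  by (auto simp: smooth_on_def intro: Ck_on_subset)

lemma smooth_on_cong:
  "open S \<Longrightarrow> (\<And>y. y \<in> S \<Longrightarrow> f y = g y) \<Longrightarrow> smooth_on f S \<Longrightarrow> smooth_on g S"
  unfolding smooth_on_def using Ck_on_cong by blast

lemma smooth_on_local:
  "(\<And>x. x \<in> S \<Longrightarrow> \<exists>U. open U \<and> x \<in> U \<and> smooth_on f U) \<Longrightarrow> smooth_on f S"
  unfolding smooth_on_def by (metis Ck_on_local)

lemma smooth_on_differentiable: "smooth_on f S \<Longrightarrow> x \<in> S \<Longrightarrow> f differentiable at x"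
  unfolding smooth_on_def by (metis Ck_on.simps(2))

lemma smooth_on_FD: "smooth_on f S \<Longrightarrow> smooth_on (\<lambda>x. FD f x v) S"
  unfolding smooth_on_def by (metis Ck_on.simps(2))

lemma smooth_on_continuous: "smooth_on f S \<Longrightarrow> continuous_on S f"
  unfolding smooth_on_def by (metis Ck_on.simps(1))

lemma smooth_on_const: "smooth_on (\<lambda>x. c) S"
  by (simp add: smooth_on_def Ck_on_const)

lemma smooth_on_linear: "bounded_linear f \<Longrightarrow> smooth_on f S"
  by (simp add: smooth_on_def Ck_on_linear)

lemma smooth_on_linear_compose:
  "bounded_linear h \<Longrightarrow> open S \<Longrightarrow> smooth_on f S \<Longrightarrow> smooth_on (\<lambda>x. h (f x)) S"
  by (simp add: smooth_on_def Ck_on_linear_compose)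

lemma smooth_on_add:
  "open S \<Longrightarrow> smooth_on f S \<Longrightarrow> smooth_on g S \<Longrightarrow> smooth_on (\<lambda>x. f x + g x) S"
  by (simp add: smooth_on_def Ck_on_add)

lemma smooth_on_bilinear:
  "bounded_bilinear B \<Longrightarrow> open S \<Longrightarrow> smooth_on f S \<Longrightarrow> smooth_on g S \<Longrightarrow>
    smooth_on (\<lambda>x. B (f x) (g x)) S"
  by (simp add: smooth_on_def Ck_on_bilinear)

lemmas smooth_on_scaleR = smooth_on_bilinear[OF bounded_bilinear_scaleR]
lemmas smooth_on_inner = smooth_on_bilinear[OF bounded_bilinear_inner]

lemma smooth_on_sum:
  "open S \<Longrightarrow> (\<And>i. i \<in> I \<Longrightarrow> smooth_on (f i) S) \<Longrightarrow> smooth_on (\<lambda>x. \<Sum>i\<in>I. f i x) S"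
  by (simp add: smooth_on_def Ck_on_sum)

lemma smooth_on_compose:
  fixes f :: "'e::euclidean_space \<Rightarrow> 'f::euclidean_space"
  shows "open S \<Longrightarrow> smooth_on g T \<Longrightarrow> smooth_on f S \<Longrightarrow> f ` S \<subseteq> T \<Longrightarrow> smooth_on (\<lambda>x. g (f x)) S"
  unfolding smooth_on_def using Ck_on_compose by blast

lemma smooth_on_snd: "open S \<Longrightarrow> smooth_on f S \<Longrightarrow> smooth_on (\<lambda>x. snd (f x)) S"
  by (rule smooth_on_linear_compose[OF bounded_linear_snd])

lemma smooth_on_Pair:
  assumes "open S" "smooth_on f S" "smooth_on g S"
  shows "smooth_on (\<lambda>x. (f x, g x)) S"
proof -
  have "smooth_on (\<lambda>x. (f x, 0) + (0, g x)) S"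
    using assms
    by (intro smooth_on_add smooth_on_linear_compose[of "\<lambda>y. (y, 0)"] smooth_on_linear_compose[of "\<lambda>y. (0, y)"])
       (auto intro!: bounded_linear_Pair bounded_linear_ident bounded_linear_zero)
  then show ?thesis by simp
qed

text \<open>Both the base point and the direction may vary; the direction is again expanded in the
  basis. This covers the fibre components of tangent maps.\<close>

lemma smooth_on_FD_apply:
  fixes f :: "'e::euclidean_space \<Rightarrow> 'f::euclidean_space" and a h :: "'d::euclidean_space \<Rightarrow> 'e"
  assumes "open S" "smooth_on f T" "smooth_on a S" "smooth_on h S" "a ` S \<subseteq> T"
  shows "smooth_on (\<lambda>x. FD f (a x) (h x)) S"
proof (rule smooth_on_cong[OF assms(1)])
  show "smooth_on (\<lambda>x. \<Sum>i\<in>Basis. (h x \<bullet> i) *\<^sub>R FD f (a x) i) S"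
    by (intro smooth_on_sum smooth_on_scaleR smooth_on_inner smooth_on_const
        smooth_on_compose[OF _ smooth_on_FD[OF assms(2)]] assms)
  show "(\<Sum>i\<in>Basis. (h x \<bullet> i) *\<^sub>R FD f (a x) i) = FD f (a x) (h x)" if "x \<in> S" for x
    using assms that
    by (subst (2) linear_eq_sum_Basis) (auto intro!: linear_frechet_derivative smooth_on_differentiable)
qed

section \<open>Derivatives along lines and symmetry of second derivatives\<close>

lemma FD_compose:
  assumes "f differentiable at x" "g differentiable at (f x)"
  shows "FD (\<lambda>x. g (f x)) x v = FD g (f x) (FD f x v)"
  using assms by (metis FD_eqI FD_has_derivative has_derivative_compose)

lemma FD_line:
  fixes f :: "'e::real_normed_vector \<Rightarrow> real"
  assumes "f differentiable at (a + s *\<^sub>R v)"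
  shows "((\<lambda>t. f (a + t *\<^sub>R v)) has_real_derivative FD f (a + s *\<^sub>R v) v) (at s)"
proof -
  have "((\<lambda>t. f (a + t *\<^sub>R v)) has_derivative (\<lambda>t. FD f (a + s *\<^sub>R v) (t *\<^sub>R v))) (at s)"
    by (rule has_derivative_compose[of _ _ _ _ f]) (auto intro!: derivative_eq_intros FD_has_derivative assms)
  then show ?thesis
    using linear_frechet_derivative[OF assms]
    by (auto simp: has_field_derivative_def linear_scale mult_commute_abs)
qed

text \<open>Two applications of the mean value theorem, one along \<open>v\<close> and one along
  \<open>w\<close>. The second difference is symmetric in \<open>v\<close> and \<open>w\<close>, so
  this lemma and its version with \<open>v\<close> and \<open>w\<close> exchanged evaluate the same
  number by the two mixed derivatives.\<close>

lemma second_difference_mean_value: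
  fixes f :: "'e::euclidean_space \<Rightarrow> real"
  assumes "h > 0" "convex S" "Ck_on 2 f S"
    and "x \<in> S" "x + h *\<^sub>R v \<in> S" "x + h *\<^sub>R w \<in> S" "x + h *\<^sub>R v + h *\<^sub>R w \<in> S"
  shows "\<exists>s t. 0 < s \<and> s < h \<and> 0 < t \<and> t < h \<and>
    f (x + h *\<^sub>R v + h *\<^sub>R w) - f (x + h *\<^sub>R v) - f (x + h *\<^sub>R w) + f x
      = h * h * FD (\<lambda>y. FD f y v) (x + s *\<^sub>R v + t *\<^sub>R w) w"
proof -
  have seg: "a + t *\<^sub>R u \<in> S" if "a \<in> S" "a + h *\<^sub>R u \<in> S" "0 \<le> t" "t \<le> h" for a u and t :: real
  proof -
    have "(1 - t/h) *\<^sub>R a + (t/h) *\<^sub>R (a + h *\<^sub>R u) \<in> S"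
      using assms(1,2) that unfolding convex_alt by auto
    moreover have "(1 - t/h) *\<^sub>R a + (t/h) *\<^sub>R (a + h *\<^sub>R u) = a + t *\<^sub>R u"
      using assms(1) by (simp add: algebra_simps)
    ultimately show ?thesis by simp
  qed
  have d1: "f differentiable at y" and d2: "(\<lambda>y. FD f y v) differentiable at y" if "y \<in> S" for y
    using assms(3) that by (auto simp: numeral_2_eq_2)
  have in1: "x + t *\<^sub>R v \<in> S" "x + h *\<^sub>R w + t *\<^sub>R v \<in> S" if "0 \<le> t" "t \<le> h" for t
    using seg[of x v t] seg[of "x + h *\<^sub>R w" v t] that assms by (auto simp: add_ac)
  \<comment> \<open>\<open>g t\<close> is the increment of \<open>f\<close> along
    \<open>h *\<^sub>R w\<close> at \<open>x + t *\<^sub>R v\<close>; the second difference is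
    \<open>g h - g 0\<close>.\<close>
  define g where "g t = f (x + h *\<^sub>R w + t *\<^sub>R v) - f (x + t *\<^sub>R v)" for t
  have "DERIV g t :> FD f (x + h *\<^sub>R w + t *\<^sub>R v) v - FD f (x + t *\<^sub>R v) v" if "0 \<le> t" "t \<le> h" for t
    unfolding g_def using that by (intro DERIV_diff FD_line d1 in1)
  from MVT2[OF assms(1), OF this] obtain s where s: "0 < s" "s < h"
    "g h - g 0 = h * (FD f (x + h *\<^sub>R w + s *\<^sub>R v) v - FD f (x + s *\<^sub>R v) v)"
    by auto
  have "x + s *\<^sub>R v \<in> S" "x + s *\<^sub>R v + h *\<^sub>R w \<in> S"
    using in1[of s] s by (auto simp: add_ac)
  then have in2: "x + s *\<^sub>R v + t *\<^sub>R w \<in> S" if "0 \<le> t" "t \<le> h" for t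
    using seg that by blast
  have "DERIV (\<lambda>t. FD f (x + s *\<^sub>R v + t *\<^sub>R w) v) t :> FD (\<lambda>y. FD f y v) (x + s *\<^sub>R v + t *\<^sub>R w) w"
    if "0 \<le> t" "t \<le> h" for t
    by (rule FD_line[of "\<lambda>y. FD f y v"]) (rule d2[OF in2[OF that]])
  from MVT2[OF assms(1), OF this] obtain t where t: "0 < t" "t < h"
    "FD f (x + s *\<^sub>R v + h *\<^sub>R w) v - FD f (x + s *\<^sub>R v) v
      = h * FD (\<lambda>y. FD f y v) (x + s *\<^sub>R v + t *\<^sub>R w) w"
    by auto
  have "g h - g 0 = h * h * FD (\<lambda>y. FD f y v) (x + s *\<^sub>R v + t *\<^sub>R w) w"
    using s(3) t(3) by (simp add: add_ac)
  then show ?thesis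
    using s t unfolding g_def by (intro exI[of _ s] exI[of _ t]) (simp add: add_ac)
qed

text \<open>Schwarz's theorem: after division by \<open>h * h\<close> the second difference tends to
  either mixed derivative at \<open>x\<close> as \<open>h\<close> tends to 0, by continuity of the
  second derivatives.\<close>

lemma FD_FD_symmetric_real:
  fixes f :: "'e::euclidean_space \<Rightarrow> real"
  assumes "open S" "Ck_on 2 f S" "x \<in> S"
  shows "FD (\<lambda>y. FD f y v) x w = FD (\<lambda>y. FD f y w) x v"
proof -
  obtain r where r: "r > 0" "ball x r \<subseteq> S"
    using assms openE by blast
  \<comment> \<open>\<open>M\<close> exceeds \<open>norm v + norm w\<close>, and the summand 1 keeps
    it positive when both vanish. With the factor \<open>r / (2 * M)\<close> in \<open>h\<close>,
    the parallelogram spanned at \<open>x\<close> by \<open>h n *\<^sub>R v\<close> and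
    \<open>h n *\<^sub>R w\<close> stays in the ball of radius \<open>r\<close>.\<close>
  define M where "M = norm v + norm w + 1"
  have M: "M > 0" "norm v \<le> M" "norm w \<le> M" by (auto simp: M_def add_nonneg_pos)
  define h where "h n = r / (2 * M) * inverse (real (Suc n))" for n
  have h0: "h n > 0" for n using r M by (simp add: h_def)
  have hb: "h n * norm v + h n * norm w < r" for n
  proof -
    have "h n * norm v + h n * norm w < h n * M"
      using h0[of n] by (simp add: M_def distrib_left)
    also have "\<dots> = r / 2 * inverse (real (Suc n))" using M by (simp add: h_def)
    also have "\<dots> \<le> r / 2 * 1"
      using r by (intro mult_left_mono) (auto simp: inverse_eq_divide field_simps)
    also have "\<dots> \<le> r" using r by simp
    finally show ?thesis .
  qed
  have nb: "norm (s *\<^sub>R v + t *\<^sub>R w) \<le> h n * norm v + h n * norm w"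
    if "0 \<le> s" "s \<le> h n" "0 \<le> t" "t \<le> h n" for s t n
    using that by (intro norm_triangle_le add_mono) (auto intro!: mult_right_mono)
  have inb: "x + s *\<^sub>R v + t *\<^sub>R w \<in> ball x r" if "0 \<le> s" "s \<le> h n" "0 \<le> t" "t \<le> h n" for s t n
  proof -
    have "dist x (x + s *\<^sub>R v + t *\<^sub>R w) = norm (s *\<^sub>R v + t *\<^sub>R w)"
      by (metis add.assoc add_diff_cancel_left' dist_commute dist_norm)
    then show ?thesis using nb[OF that] hb[of n] by simp
  qed
  have corners: "x \<in> ball x r" "x + h n *\<^sub>R v \<in> ball x r" "x + h n *\<^sub>R w \<in> ball x r"
      "x + h n *\<^sub>R v + h n *\<^sub>R w \<in> ball x r" "x + h n *\<^sub>R w + h n *\<^sub>R v \<in> ball x r" for n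
    using inb[of 0 n 0] inb[of "h n" n 0] inb[of 0 n "h n"] inb[of "h n" n "h n"] less_imp_le[OF h0[of n]]
    by (auto simp: add_ac)
  have C2: "Ck_on 2 f (ball x r)" using assms(2) r Ck_on_subset by blast
  obtain s t where st: "\<And>n. 0 < s n \<and> s n < h n \<and> 0 < t n \<and> t n < h n \<and>
      f (x + h n *\<^sub>R v + h n *\<^sub>R w) - f (x + h n *\<^sub>R v) - f (x + h n *\<^sub>R w) + f x
      = h n * h n * FD (\<lambda>y. FD f y v) (x + s n *\<^sub>R v + t n *\<^sub>R w) w"
    using second_difference_mean_value[OF h0 convex_ball C2 corners(1-4)] by metis
  obtain s' t' where st': "\<And>n. 0 < s' n \<and> s' n < h n \<and> 0 < t' n \<and> t' n < h n \<and>
      f (x + h n *\<^sub>R w + h n *\<^sub>R v) - f (x + h n *\<^sub>R w) - f (x + h n *\<^sub>R v) + f x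
      = h n * h n * FD (\<lambda>y. FD f y w) (x + s' n *\<^sub>R w + t' n *\<^sub>R v) v"
    using second_difference_mean_value[OF h0 convex_ball C2 corners(1,3,2,5)] by metis
  have eq: "FD (\<lambda>y. FD f y v) (x + s n *\<^sub>R v + t n *\<^sub>R w) w
      = FD (\<lambda>y. FD f y w) (x + s' n *\<^sub>R w + t' n *\<^sub>R v) v" for n
  proof -
    have "h n * h n * FD (\<lambda>y. FD f y v) (x + s n *\<^sub>R v + t n *\<^sub>R w) w
      = h n * h n * FD (\<lambda>y. FD f y w) (x + s' n *\<^sub>R w + t' n *\<^sub>R v) v"
    proof -
      have "f (x + h n *\<^sub>R w + h n *\<^sub>R v) = f (x + h n *\<^sub>R v + h n *\<^sub>R w)"
        by (simp add: add_ac)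
      then show ?thesis using st[of n] st'[of n] by linarith
    qed
    then show ?thesis using h0[of n] by simp
  qed
  have hlim: "h \<longlonglongrightarrow> 0"
    unfolding h_def by (rule tendsto_mult_right_zero[OF LIMSEQ_inverse_real_of_nat])
  have lims: "s \<longlonglongrightarrow> 0" "t \<longlonglongrightarrow> 0" "s' \<longlonglongrightarrow> 0" "t' \<longlonglongrightarrow> 0"
    using st st' by (auto intro!: tendsto_sandwich[OF _ _ tendsto_const hlim] eventuallyI less_imp_le)
  have cont: "isCont (\<lambda>y. FD (\<lambda>y. FD f y a) y b) x" for a b
  proof -
    have "continuous_on S (\<lambda>y. FD (\<lambda>y. FD f y a) y b)"
      using assms(2) by (auto simp: numeral_2_eq_2)
    then show ?thesis using assms continuous_on_eq_continuous_at by blast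
  qed
  have "(\<lambda>n. x + s n *\<^sub>R v + t n *\<^sub>R w) \<longlonglongrightarrow> x + 0 *\<^sub>R v + 0 *\<^sub>R w"
    by (intro tendsto_intros lims)
  then have 1: "(\<lambda>n. FD (\<lambda>y. FD f y v) (x + s n *\<^sub>R v + t n *\<^sub>R w) w) \<longlonglongrightarrow> FD (\<lambda>y. FD f y v) x w"
    using isCont_tendsto_compose[OF cont] by fastforce
  have "(\<lambda>n. x + s' n *\<^sub>R w + t' n *\<^sub>R v) \<longlonglongrightarrow> x + 0 *\<^sub>R w + 0 *\<^sub>R v"
    by (intro tendsto_intros lims)
  then have 2: "(\<lambda>n. FD (\<lambda>y. FD f y w) (x + s' n *\<^sub>R w + t' n *\<^sub>R v) v) \<longlonglongrightarrow> FD (\<lambda>y. FD f y w) x v"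
    using isCont_tendsto_compose[OF cont] by fastforce
  show ?thesis using LIMSEQ_unique 1 2 eq by simp
qed

text \<open>Reduction to real-valued functions: the inner product with a fixed vector commutes with
  both differentiations.\<close>

lemma FD_FD_symmetric:
  fixes f :: "'e::euclidean_space \<Rightarrow> 'f::euclidean_space"
  assumes "open S" "smooth_on f S" "x \<in> S"
  shows "FD (\<lambda>y. FD f y v) x w = FD (\<lambda>y. FD f y w) x v"
proof (rule euclidean_eqI)
  fix u :: 'f
  have inner: "FD (\<lambda>y. g y \<bullet> u) y a = FD g y a \<bullet> u" if "g differentiable at y"
    for g :: "'e \<Rightarrow> 'f" and y a
    by (subst FD_eqI[OF has_derivative_inner_left[OF FD_has_derivative[OF that]]]) simp
  have iter: "FD (\<lambda>y. FD (\<lambda>y. f y \<bullet> u) y a) x b = FD (\<lambda>y. FD f y a) x b \<bullet> u" for a b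
  proof -
    have "FD (\<lambda>y. FD (\<lambda>y. f y \<bullet> u) y a) x b = FD (\<lambda>y. FD f y a \<bullet> u) x b"
      using smooth_on_differentiable[OF assms(2)]
      by (subst FD_cong[OF assms(1,3)]) (auto simp: inner)
    then show ?thesis
      using smooth_on_differentiable[OF smooth_on_FD[OF assms(2)] assms(3)] by (simp add: inner)
  qed
  have "smooth_on (\<lambda>y. f y \<bullet> u) S"
    by (intro smooth_on_inner smooth_on_const assms)
  then have "Ck_on 2 (\<lambda>y. f y \<bullet> u) S" by (simp add: smooth_on_def)
  from FD_FD_symmetric_real[OF assms(1) this assms(3), of v w]
  show "FD (\<lambda>y. FD f y v) x w \<bullet> u = FD (\<lambda>y. FD f y w) x v \<bullet> u"
    by (simp add: iter)
qed

section \<open>Smooth maps between manifolds\<close>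

abbreviation crep ::
  "('a, 'e) chart \<Rightarrow> ('b, 'f) chart \<Rightarrow> ('a \<Rightarrow> 'b) \<Rightarrow> 'e \<Rightarrow> 'f" where
  "crep c d F \<equiv> cmap d \<circ> F \<circ> cinv c"

abbreviation transition :: "('a, 'e) chart \<Rightarrow> ('a, 'e) chart \<Rightarrow> 'e \<Rightarrow> 'e" where
  "transition c d \<equiv> cmap d \<circ> cinv c"

lemma cinv_cmap: "smooth_atlas A \<Longrightarrow> c \<in> A \<Longrightarrow> p \<in> cdom c \<Longrightarrow> cinv c (cmap c p) = p"
  by (auto simp: smooth_atlas_def)

lemma cmap_eq_iff:
  "smooth_atlas A \<Longrightarrow> c \<in> A \<Longrightarrow> p \<in> cdom c \<Longrightarrow> q \<in> cdom c \<Longrightarrow> cmap c p = cmap c q \<longleftrightarrow> p = q"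
  by (auto simp: smooth_atlas_def inj_on_def)

lemma open_chart: "smooth_atlas A \<Longrightarrow> c \<in> A \<Longrightarrow> open (cmap c ` cdom c)"
  by (auto simp: smooth_atlas_def)

lemma chart_at:
  assumes "p \<in> points A"
  shows "chart_at A p \<in> A" "p \<in> cdom (chart_at A p)"
proof -
  have "\<exists>c. c \<in> A \<and> p \<in> cdom c" using assms by (auto simp: points_def)
  from someI_ex[OF this] show "chart_at A p \<in> A" "p \<in> cdom (chart_at A p)"
    by (auto simp: chart_at_def)
qed

lemma in_points: "c \<in> A \<Longrightarrow> p \<in> cdom c \<Longrightarrow> p \<in> points A"
  by (auto simp: points_def)

lemma smooth_map_points: "smooth_map A B F \<Longrightarrow> p \<in> points A \<Longrightarrow> F p \<in> points B"
  by (auto simp: smooth_map_def)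

lemma open_rep_domain:
  "smooth_map A B F \<Longrightarrow> c \<in> A \<Longrightarrow> d \<in> B \<Longrightarrow> open (cmap c ` {p \<in> cdom c. F p \<in> cdom d})"
  by (auto simp: smooth_map_def)

lemma smooth_on_rep:
  "smooth_map A B F \<Longrightarrow> c \<in> A \<Longrightarrow> d \<in> B \<Longrightarrow>
    smooth_on (crep c d F) (cmap c ` {p \<in> cdom c. F p \<in> cdom d})"
  by (auto simp: smooth_map_def)

lemma rep_differentiable:
  assumes "smooth_map A B F" "c \<in> A" "d \<in> B" "p \<in> cdom c" "F p \<in> cdom d"
  shows "crep c d F differentiable at (cmap c p)"
  using smooth_on_differentiable[OF smooth_on_rep[OF assms(1-3)]] assms by blast

lemma smooth_map_id:
  assumes "smooth_atlas A"
  shows "smooth_map A A id"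
proof -
  have "{p \<in> cdom c. p \<in> cdom d} = cdom c \<inter> cdom d" for c d :: "('a, 'b) chart" by auto
  then show ?thesis using assms by (auto simp: smooth_map_def smooth_atlas_def)
qed

lemma open_transition_domain:
  "smooth_atlas A \<Longrightarrow> c \<in> A \<Longrightarrow> d \<in> A \<Longrightarrow> open (cmap c ` (cdom c \<inter> cdom d))"
  by (auto simp: smooth_atlas_def)

lemma smooth_on_transition:
  "smooth_atlas A \<Longrightarrow> c \<in> A \<Longrightarrow> d \<in> A \<Longrightarrow>
    smooth_on (transition c d) (cmap c ` (cdom c \<inter> cdom d))"
  by (auto simp: smooth_atlas_def)

text \<open>\<open>smooth_map\<close> quantifies over all pairs of charts. One pair around each
  point suffices, since any other representation differs from it by transition maps on both sides;
  openness of the domains comes out of the same argument.\<close>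

lemma smooth_mapI:
  assumes A: "smooth_atlas A" and B: "smooth_atlas B"
    and loc: "\<And>p. p \<in> points A \<Longrightarrow> \<exists>c\<in>A. \<exists>d\<in>B. \<exists>U. p \<in> cdom c \<and> open U \<and> cmap c p \<in> U \<and>
      U \<subseteq> cmap c ` cdom c \<and> (\<forall>x\<in>U. F (cinv c x) \<in> cdom d) \<and> smooth_on (crep c d F) U"
  shows "smooth_map A B F"
  unfolding smooth_map_def
proof (intro conjI ballI)
  show "F ` points A \<subseteq> points B"
  proof
    fix y assume "y \<in> F ` points A"
    then obtain p where p: "p \<in> points A" "y = F p" by auto
    from loc[OF p(1)] show "y \<in> points B"
      using p(2) cinv_cmap[OF A] in_points by metis
  qed
  fix c0 d0 assume c0: "c0 \<in> A" and d0: "d0 \<in> B"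
  let ?W = "cmap c0 ` {p \<in> cdom c0. F p \<in> cdom d0}"
  have key: "\<exists>V. open V \<and> x0 \<in> V \<and> V \<subseteq> ?W \<and> smooth_on (crep c0 d0 F) V" if x0: "x0 \<in> ?W" for x0
  proof -
    obtain p0 where p0: "p0 \<in> cdom c0" "F p0 \<in> cdom d0" "x0 = cmap c0 p0" using x0 by auto
    obtain c d U where *: "c \<in> A" "d \<in> B" "p0 \<in> cdom c" "open U" "cmap c p0 \<in> U"
        "U \<subseteq> cmap c ` cdom c" "\<And>x. x \<in> U \<Longrightarrow> F (cinv c x) \<in> cdom d" "smooth_on (crep c d F) U"
      using loc[OF in_points[OF c0 p0(1)]] by blast
    let ?S = "cmap c0 ` (cdom c0 \<inter> cdom c)" and ?T = "transition c0 c"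
    let ?N = "cmap d ` (cdom d \<inter> cdom d0)" and ?h = "\<lambda>x. crep c d F (transition c0 c x)"
    \<comment> \<open>\<open>?V1\<close> consists of the points that the change from
      \<open>c0\<close> to \<open>c\<close> sends into \<open>U\<close>; \<open>?V\<close> below
      keeps those whose image lies in the overlap of \<open>d\<close> and \<open>d0\<close>. On
      \<open>?V\<close> the representation in \<open>c0\<close> and \<open>d0\<close> is a composite
      of three smooth maps.\<close>
    let ?V1 = "?S \<inter> ?T -` U"
    have S: "open ?S" "smooth_on ?T ?S"
      using open_transition_domain[OF A] smooth_on_transition[OF A] c0 *(1) by auto
    have V1: "open ?V1"
      by (rule continuous_open_preimage[OF smooth_on_continuous[OF S(2)] S(1) *(4)])
    have h: "smooth_on ?h ?V1"
      by (rule smooth_on_compose[OF V1 *(8)]) (use smooth_on_subset[OF S(2), of ?V1] in \<open>auto simp: o_def\<close>)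
    have N: "open ?N" using open_transition_domain[OF B *(2) d0] .
    let ?V = "?V1 \<inter> ?h -` ?N"
    have V: "open ?V"
      by (rule continuous_open_preimage[OF smooth_on_continuous[OF h] V1 N])
    have pt: "F (cinv c0 x) \<in> cdom d0 \<and> cinv c0 x \<in> cdom c0 \<and> cmap c0 (cinv c0 x) = x \<and>
        ?h x = cmap d (F (cinv c0 x)) \<and> F (cinv c0 x) \<in> cdom d" if "x \<in> ?V" for x
    proof -
      obtain q where q: "q \<in> cdom c0" "q \<in> cdom c" "x = cmap c0 q" using \<open>x \<in> ?V\<close> by auto
      have xq: "cinv c0 x = q" using cinv_cmap[OF A c0 q(1)] q(3) by simp
      have cq: "cinv c (cmap c q) = q" using cinv_cmap[OF A *(1) q(2)] .
      have "cmap c q \<in> U" using \<open>x \<in> ?V\<close> xq by simp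
      then have Fd: "F q \<in> cdom d" using *(7) cq by metis
      have "cmap d (F q) \<in> ?N" using \<open>x \<in> ?V\<close> xq cq by simp
      then have "F q \<in> cdom d0" using cmap_eq_iff[OF B *(2)] Fd by auto
      then show ?thesis using q xq cq Fd by simp
    qed
    have "x0 \<in> ?V"
      using p0 * cinv_cmap[OF A c0 p0(1)] cinv_cmap[OF A *(1,3)] *(7)[OF *(5)] by auto
    moreover have "?V \<subseteq> ?W" using pt by (metis (no_types, lifting) imageI mem_Collect_eq subsetI)
    moreover have "smooth_on (crep c0 d0 F) ?V"
    proof (rule smooth_on_cong[OF V])
      show "smooth_on (\<lambda>x. transition d d0 (?h x)) ?V"
        by (rule smooth_on_compose[OF V smooth_on_transition[OF B *(2) d0] smooth_on_subset[OF h]]) auto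
      show "transition d d0 (?h x) = crep c0 d0 F x" if "x \<in> ?V" for x
        using pt[OF that] cinv_cmap[OF B *(2), of "F (cinv c0 x)"] by simp
    qed
    ultimately show ?thesis using V by blast
  qed
  show "open ?W" by (subst open_subopen) (use key in meson)
  show "smooth_on (crep c0 d0 F) ?W" by (rule smooth_on_local) (use key in meson)
qed

text \<open>On the part of the chart that the representation of \<open>F\<close> sends into the
  domain of the representation of \<open>G\<close>, the two compose. Injectivity of
  \<open>cmap d\<close> turns this condition on coordinates into one on points. Smoothness of
  composites and the chain rule both rest on it.\<close>

lemma rep_comp_nbhd:
  assumes A: "smooth_atlas A" and B: "smooth_atlas B"
    and F: "smooth_map A B F" and G: "smooth_map B C G"
    and c: "c \<in> A" "p \<in> cdom c" and d: "d \<in> B" "F p \<in> cdom d" and e: "e \<in> C" "G (F p) \<in> cdom e"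
  obtains U where "open U" "cmap c p \<in> U" "U \<subseteq> cmap c ` cdom c"
    "smooth_on (crep c d F) U" "smooth_on (crep c e (G \<circ> F)) U"
    "\<And>x. x \<in> U \<Longrightarrow> G (F (cinv c x)) \<in> cdom e"
    "\<And>x. x \<in> U \<Longrightarrow> crep c e (G \<circ> F) x = crep d e G (crep c d F x)"
proof -
  let ?S = "cmap c ` {p \<in> cdom c. F p \<in> cdom d}" and ?N = "cmap d ` {q \<in> cdom d. G q \<in> cdom e}"
  let ?U = "?S \<inter> crep c d F -` ?N"
  note S = open_rep_domain[OF F c(1) d(1)] smooth_on_rep[OF F c(1) d(1)]
  note N = open_rep_domain[OF G d(1) e(1)] smooth_on_rep[OF G d(1) e(1)]
  have U: "open ?U"
    by (rule continuous_open_preimage[OF smooth_on_continuous[OF S(2)] S(1) N(1)])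
  have pt: "G (F (cinv c x)) \<in> cdom e \<and> crep c e (G \<circ> F) x = crep d e G (crep c d F x)"
    if "x \<in> ?U" for x
  proof -
    obtain q where q: "q \<in> cdom c" "F q \<in> cdom d" "x = cmap c q" using \<open>x \<in> ?U\<close> by auto
    have xq: "cinv c x = q" using cinv_cmap[OF A c(1) q(1)] q(3) by simp
    have "cmap d (F q) \<in> ?N" using \<open>x \<in> ?U\<close> xq by simp
    then show ?thesis using cmap_eq_iff[OF B d(1)] cinv_cmap[OF B d(1) q(2)] q(2) xq by auto
  qed
  have sm: "smooth_on (crep c e (G \<circ> F)) ?U"
  proof (rule smooth_on_cong[OF U])
    show "smooth_on (\<lambda>x. crep d e G (crep c d F x)) ?U"
      by (rule smooth_on_compose[OF U N(2) smooth_on_subset[OF S(2)]]) auto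
  qed (use pt in simp)
  show thesis
  proof (rule that[OF U])
    show "cmap c p \<in> ?U" using c d e cinv_cmap[OF A c] by auto
    show "smooth_on (crep c d F) ?U" by (rule smooth_on_subset[OF S(2)]) auto
  qed (use pt sm in auto)
qed

lemma smooth_map_comp:
  assumes A: "smooth_atlas A" and B: "smooth_atlas B" and C: "smooth_atlas C"
    and F: "smooth_map A B F" and G: "smooth_map B C G"
  shows "smooth_map A C (G \<circ> F)"
proof (rule smooth_mapI[OF A C])
  fix p assume p: "p \<in> points A"
  note Fp = smooth_map_points[OF F p]
  note GFp = smooth_map_points[OF G Fp]
  note ch = chart_at[OF p] chart_at[OF Fp] chart_at[OF GFp]
  obtain U where "open U" "cmap (chart_at A p) p \<in> U" "U \<subseteq> cmap (chart_at A p) ` cdom (chart_at A p)"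
      "smooth_on (crep (chart_at A p) (chart_at C (G (F p))) (G \<circ> F)) U"
      "\<And>x. x \<in> U \<Longrightarrow> G (F (cinv (chart_at A p) x)) \<in> cdom (chart_at C (G (F p)))"
    using rep_comp_nbhd[OF A B F G ch] by metis
  with ch show "\<exists>c\<in>A. \<exists>e\<in>C. \<exists>U. p \<in> cdom c \<and> open U \<and> cmap c p \<in> U \<and>
      U \<subseteq> cmap c ` cdom c \<and> (\<forall>x\<in>U. (G \<circ> F) (cinv c x) \<in> cdom e) \<and> smooth_on (crep c e (G \<circ> F)) U"
    by (intro bexI[of _ "chart_at A p"] bexI[of _ "chart_at C (G (F p))"] exI[of _ U]) auto
qed

text \<open>Chain rule in charts. Taking \<open>id\<close> for one of the maps turns it into the
  rule for a change of chart, because \<open>crep c d id\<close> is the transition map.\<close>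

lemma FD_rep_comp:
  assumes A: "smooth_atlas A" and B: "smooth_atlas B"
    and F: "smooth_map A B F" and G: "smooth_map B C G"
    and c: "c \<in> A" "p \<in> cdom c" and d: "d \<in> B" "F p \<in> cdom d" and e: "e \<in> C" "G (F p) \<in> cdom e"
  shows "FD (crep c e (G \<circ> F)) (cmap c p) v
    = FD (crep d e G) (cmap d (F p)) (FD (crep c d F) (cmap c p) v)"
proof -
  obtain U where U: "open U" "cmap c p \<in> U"
      "\<And>x. x \<in> U \<Longrightarrow> crep c e (G \<circ> F) x = crep d e G (crep c d F x)"
    using rep_comp_nbhd[OF assms] by metis
  have Fp: "crep c d F (cmap c p) = cmap d (F p)" using cinv_cmap[OF A c] by simp
  have "FD (crep c e (G \<circ> F)) (cmap c p) = FD (\<lambda>x. crep d e G (crep c d F x)) (cmap c p)"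
    by (rule FD_cong[OF U(1,2)]) (use U(3) in simp)
  then show ?thesis
    using FD_compose[OF rep_differentiable[OF F c(1) d(1) c(2) d(2)], of "crep d e G"]
      rep_differentiable[OF G d(1) e(1) d(2) e(2)] Fp by simp
qed

lemma FD_rep_cong:
  assumes A: "smooth_atlas A" and "c \<in> A" "p \<in> cdom c" "\<And>q. q \<in> points A \<Longrightarrow> F q = G q"
  shows "FD (crep c d F) (cmap c p) = FD (crep c d G) (cmap c p)"
proof (rule FD_cong[OF open_chart[OF A assms(2)]])
  show "crep c d F x = crep c d G x" if "x \<in> cmap c ` cdom c" for x
    using assms(4)[OF in_points[OF assms(2) inv_into_into[OF that]]] by simp
qed (use assms in auto)

text \<open>Composites with inverse maps or with extensional sections equal the intended maps on
  \<open>points A\<close> only.\<close>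

lemma smooth_map_cong:
  assumes A: "smooth_atlas A" and F: "smooth_map A B F" and eq: "\<And>q. q \<in> points A \<Longrightarrow> F q = G q"
  shows "smooth_map A B G"
proof -
  have pts: "F p = G p" if "c \<in> A" "p \<in> cdom c" for c p using eq in_points that by metis
  have dom: "{p \<in> cdom c. F p \<in> cdom d} = {p \<in> cdom c. G p \<in> cdom d}" if "c \<in> A" for c d
    using pts[OF that] by auto
  have "smooth_on (crep c d G) (cmap c ` {p \<in> cdom c. G p \<in> cdom d})" if "c \<in> A" "d \<in> B" for c d
  proof (rule smooth_on_cong)
    show "open (cmap c ` {p \<in> cdom c. G p \<in> cdom d})"
      using open_rep_domain[OF F that] by (simp only: dom[OF that(1)])
    show "smooth_on (crep c d F) (cmap c ` {p \<in> cdom c. G p \<in> cdom d})"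
      using smooth_on_rep[OF F that] by (simp only: dom[OF that(1)])
    fix x assume "x \<in> cmap c ` {p \<in> cdom c. G p \<in> cdom d}"
    then show "crep c d F x = crep c d G x"
      using pts[OF that(1)] cinv_cmap[OF A that(1)] by auto
  qed
  then show ?thesis
    using F dom eq by (simp add: smooth_map_def) (use eq in force)
qed

section \<open>Derivatives of transition maps\<close>

lemma transition_differentiable:
  assumes "smooth_atlas A" "c \<in> A" "d \<in> A" "p \<in> cdom c" "p \<in> cdom d"
  shows "transition c d differentiable at (cmap c p)"
  using rep_differentiable[OF smooth_map_id[OF assms(1)] assms(2-4)] assms(5) by simp

lemma FD_transition_chain:
  assumes A: "smooth_atlas A" and "c \<in> A" "p \<in> cdom c" "d \<in> A" "p \<in> cdom d" "e \<in> A" "p \<in> cdom e"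
  shows "FD (transition c e) (cmap c p) v
    = FD (transition d e) (cmap d p) (FD (transition c d) (cmap c p) v)"
  using FD_rep_comp[OF A A smooth_map_id[OF A] smooth_map_id[OF A], of c p d e v] assms by simp

lemma FD_transition_same:
  assumes A: "smooth_atlas A" and "c \<in> A" "p \<in> cdom c"
  shows "FD (transition c c) (cmap c p) v = v"
proof -
  have "FD (transition c c) (cmap c p) = FD (\<lambda>x. x) (cmap c p)"
    by (rule FD_cong[OF open_chart[OF A assms(2)]]) (use assms in \<open>auto simp: f_inv_into_f\<close>)
  then show ?thesis by simp
qed

section \<open>Tangent vectors\<close>

lemma tangent_spaceI:
  assumes "\<And>c. c \<notin> A \<or> p \<notin> cdom c \<Longrightarrow> v c = 0"
    and "\<And>c d. c \<in> A \<Longrightarrow> d \<in> A \<Longrightarrow> p \<in> cdom c \<Longrightarrow> p \<in> cdom d \<Longrightarrow>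
      v d = FD (transition c d) (cmap c p) (v c)"
  shows "v \<in> tangent_space A p"
  unfolding tangent_space_def
proof (intro CollectI conjI allI impI ballI)
  show "v d = FD (transition c d) (cmap c p) (v c)"
    if "c \<in> A" "d \<in> A" "p \<in> cdom c \<and> p \<in> cdom d" for c d
    by (rule assms(2)) (use that in auto)
qed (rule assms(1))

lemma tangent_space_zero: "v \<in> tangent_space A p \<Longrightarrow> c \<notin> A \<or> p \<notin> cdom c \<Longrightarrow> v c = 0"
  unfolding tangent_space_def by (drule CollectD, drule conjunct1) blast

lemma tangent_space_transition:
  assumes "v \<in> tangent_space A p" "c \<in> A" "p \<in> cdom c" "d \<in> A" "p \<in> cdom d"
  shows "v d = FD (transition c d) (cmap c p) (v c)"
proof -
  have "\<forall>c\<in>A. \<forall>d\<in>A. p \<in> cdom c \<and> p \<in> cdom d \<longrightarrow> v d = FD (transition c d) (cmap c p) (v c)"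
    using assms(1) unfolding tangent_space_def by - (drule CollectD, erule conjunct2)
  from this[rule_format, OF assms(2,4) conjI[OF assms(3,5)]] show ?thesis .
qed

text \<open>The cocycle identity for derivatives of transition maps is exactly the compatibility
  demanded of the components.\<close>

lemma coord_vec_in_tangent_space:
  assumes "smooth_atlas A" "c \<in> A" "p \<in> cdom c"
  shows "coord_vec A c p e \<in> tangent_space A p"
proof (rule tangent_spaceI)
  show "coord_vec A c p e d' = FD (transition d d') (cmap d p) (coord_vec A c p e d)"
    if "d \<in> A" "d' \<in> A" "p \<in> cdom d" "p \<in> cdom d'" for d d'
    using FD_transition_chain[OF assms that(1,3,2,4)] that by (simp add: coord_vec_def)
qed (auto simp: coord_vec_def)

lemma coord_vec_same:
  assumes "smooth_atlas A" "c \<in> A" "p \<in> cdom c"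
  shows "coord_vec A c p e c = e"
  using assms FD_transition_same[OF assms] by (simp add: coord_vec_def)

lemma coord_vec_eq:
  assumes "c \<in> A" "p \<in> cdom c" "v \<in> tangent_space A p"
  shows "coord_vec A c p (v c) = v"
proof
  show "coord_vec A c p (v c) d = v d" for d
  proof (cases "d \<in> A \<and> p \<in> cdom d")
    case True
    then show ?thesis
      using tangent_space_transition[OF assms(3,1,2), of d] by (simp add: coord_vec_def)
  next
    case False
    then show ?thesis
      using tangent_space_zero[OF assms(3), of d] by (auto simp: coord_vec_def)
  qed
qed

lemma tangent_space_eqI:
  "c \<in> A \<Longrightarrow> p \<in> cdom c \<Longrightarrow> v \<in> tangent_space A p \<Longrightarrow> w \<in> tangent_space A p \<Longrightarrow> v c = w c \<Longrightarrow> v = w"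
  by (metis coord_vec_eq)

lemma tangent_space_combine:
  assumes A: "smooth_atlas A" and "v \<in> tangent_space A p" "w \<in> tangent_space A p"
  shows "(\<lambda>c. a *\<^sub>R v c + b *\<^sub>R w c) \<in> tangent_space A p"
proof (rule tangent_spaceI)
  fix c d assume cd: "c \<in> A" "d \<in> A" "p \<in> cdom c" "p \<in> cdom d"
  show "a *\<^sub>R v d + b *\<^sub>R w d = FD (transition c d) (cmap c p) (a *\<^sub>R v c + b *\<^sub>R w c)"
    using linear_frechet_derivative[OF transition_differentiable[OF A cd]]
      tangent_space_transition[OF assms(2) cd(1,3,2,4)] tangent_space_transition[OF assms(3) cd(1,3,2,4)]
    by (simp add: linear_add linear_scale)
next
  show "a *\<^sub>R v c + b *\<^sub>R w c = 0" if "c \<notin> A \<or> p \<notin> cdom c" for c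
    by (simp only: tangent_space_zero[OF assms(2) that] tangent_space_zero[OF assms(3) that]
        scaleR_zero_right add_0)
qed

section \<open>Tangent maps\<close>

lemma fst_tangent_map [simp]: "fst (tangent_map A B F z) = F (fst z)"
  by (cases z) (simp add: tangent_map_def)

text \<open>The definition works in the chart \<open>chart_at A p\<close>; the transformation law of
  \<open>v\<close> absorbs the derivative of the transition from there to \<open>c\<close>.\<close>

lemma tangent_map_rep:
  assumes A: "smooth_atlas A" and F: "smooth_map A B F"
    and c: "c \<in> A" "p \<in> cdom c" and d: "d \<in> B" "F p \<in> cdom d" and v: "v \<in> tangent_space A p"
  shows "snd (tangent_map A B F (p, v)) d = FD (crep c d F) (cmap c p) (v c)"
proof -
  note c0 = chart_at[OF in_points[OF c]]
  have "snd (tangent_map A B F (p, v)) d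
      = FD (crep (chart_at A p) d (F \<circ> id)) (cmap (chart_at A p) p) (v (chart_at A p))"
    using d by (simp add: tangent_map_def Let_def)
  also have "\<dots> = FD (crep c d F) (cmap c p) (FD (transition (chart_at A p) c) (cmap (chart_at A p) p) (v (chart_at A p)))"
    using FD_rep_comp[OF A A smooth_map_id[OF A] F c0 c(1) _ d(1)] c(2) d(2) by simp
  also have "\<dots> = FD (crep c d F) (cmap c p) (v c)"
    using tangent_space_transition[OF v c0 c] by simp
  finally show ?thesis .
qed

lemma tangent_map_in:
  assumes A: "smooth_atlas A" and B: "smooth_atlas B" and F: "smooth_map A B F"
    and p: "p \<in> points A" and v: "v \<in> tangent_space A p"
  shows "snd (tangent_map A B F (p, v)) \<in> tangent_space B (F p)"
proof (rule tangent_spaceI)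
  note c = chart_at[OF p]
  show "snd (tangent_map A B F (p, v)) d'
      = FD (transition d d') (cmap d (F p)) (snd (tangent_map A B F (p, v)) d)"
    if "d \<in> B" "d' \<in> B" "F p \<in> cdom d" "F p \<in> cdom d'" for d d'
    using FD_rep_comp[OF A B F smooth_map_id[OF B] c, of d d'] that
    by (simp add: tangent_map_rep[OF A F c _ _ v])
qed (auto simp: tangent_map_def)

text \<open>Functoriality. In one chart around \<open>G (F p)\<close> it is the chain rule, and one
  chart determines a tangent vector. Relations between tangent maps are later read off from
  equations between maps, such as those stating that two maps are inverse.\<close>

lemma tangent_map_comp:
  assumes A: "smooth_atlas A" and B: "smooth_atlas B" and C: "smooth_atlas C"
    and F: "smooth_map A B F" and G: "smooth_map B C G"
    and p: "p \<in> points A" and v: "v \<in> tangent_space A p"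
  shows "tangent_map A C (G \<circ> F) (p, v) = tangent_map B C G (tangent_map A B F (p, v))"
proof (rule prod_eqI)
  note Fp = smooth_map_points[OF F p]
  note GFp = smooth_map_points[OF G Fp]
  note c = chart_at[OF p] and d = chart_at[OF Fp] and e = chart_at[OF GFp]
  note GF = smooth_map_comp[OF A B C F G]
  note TF = tangent_map_in[OF A B F p v]
  have eq: "tangent_map A B F (p, v) = (F p, snd (tangent_map A B F (p, v)))"
    by (rule prod_eqI) auto
  show "snd (tangent_map A C (G \<circ> F) (p, v)) = snd (tangent_map B C G (tangent_map A B F (p, v)))"
  proof (rule tangent_space_eqI[OF e])
    show "snd (tangent_map A C (G \<circ> F) (p, v)) \<in> tangent_space C (G (F p))"
      using tangent_map_in[OF A C GF p v] by simp
    show "snd (tangent_map B C G (tangent_map A B F (p, v))) \<in> tangent_space C (G (F p))"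
      using tangent_map_in[OF B C G Fp TF] eq by simp
    show "snd (tangent_map A C (G \<circ> F) (p, v)) (chart_at C (G (F p)))
        = snd (tangent_map B C G (tangent_map A B F (p, v))) (chart_at C (G (F p)))"
      using trans[OF arg_cong[OF eq, of "\<lambda>z. snd (tangent_map B C G z) (chart_at C (G (F p)))"]
            tangent_map_rep[OF B G d e TF]]
        tangent_map_rep[OF A F c d v] tangent_map_rep[OF A GF c e(1) _ v] e
        FD_rep_comp[OF A B F G c d e] by simp
  qed
qed simp

lemma tangent_map_cong:
  fixes B :: "('b, 'f::euclidean_space) chart set"
  assumes A: "smooth_atlas A" and p: "p \<in> points A" and eq: "\<And>q. q \<in> points A \<Longrightarrow> F q = G q"
  shows "tangent_map A B F (p, v) = tangent_map A B G (p, v)"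
proof -
  have "FD (crep (chart_at A p) d F) (cmap (chart_at A p) p)
      = FD (crep (chart_at A p) d G) (cmap (chart_at A p) p)" for d :: "('b, 'f) chart"
    by (rule FD_rep_cong[OF A chart_at[OF p] eq])
  then show ?thesis using eq[OF p] by (simp add: tangent_map_def Let_def cong: if_cong)
qed

lemma tangent_map_id:
  assumes A: "smooth_atlas A" and p: "p \<in> points A" and v: "v \<in> tangent_space A p"
    and eq: "\<And>q. q \<in> points A \<Longrightarrow> F q = q"
  shows "tangent_map A A F (p, v) = (p, v)"
proof -
  note c = chart_at[OF p]
  have "snd (tangent_map A A id (p, v)) = v"
  proof (rule tangent_space_eqI[OF c _ v])
    show "snd (tangent_map A A id (p, v)) \<in> tangent_space A p"
      using tangent_map_in[OF A A smooth_map_id[OF A] p v] by simp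
    show "snd (tangent_map A A id (p, v)) (chart_at A p) = v (chart_at A p)"
      by (subst tangent_map_rep[OF A smooth_map_id[OF A] c c(1) _ v])
         (use c FD_transition_same[OF A c] in auto)
  qed
  then have "tangent_map A A id (p, v) = (p, v)" by (intro prod_eqI) auto
  moreover have "tangent_map A A F (p, v) = tangent_map A A id (p, v)"
    by (rule tangent_map_cong[OF A p]) (simp add: eq)
  ultimately show ?thesis by simp
qed

section \<open>Functions and curves as smooth maps\<close>

lemma smooth_atlas_interval:
  assumes "open I"
  shows "smooth_atlas {(I, \<lambda>t::real. t)}"
proof -
  have "smooth_on ((\<lambda>t. t) \<circ> inv_into I (\<lambda>t. t)) I"
  proof (rule smooth_on_cong[OF assms])
    show "smooth_on (\<lambda>t. t) I" by (rule smooth_on_linear) (rule bounded_linear_ident)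
    show "t = ((\<lambda>t. t) \<circ> inv_into I (\<lambda>t. t)) t" if "t \<in> I" for t
      using f_inv_into_f[of t "\<lambda>t. t" I] that by simp
  qed
  then show ?thesis using assms by (auto simp: smooth_atlas_def)
qed

abbreviation real_chart :: "(real, real) chart" where "real_chart \<equiv> (UNIV, \<lambda>x. x)"

lemmas smooth_atlas_real = smooth_atlas_interval[OF open_UNIV]

text \<open>With the reals as a manifold of one chart, composition and chain rule for functions
  become instances of those for maps, and \<open>differential\<close> becomes the component of a
  tangent map.\<close>

lemma smooth_function_iff_smooth_map:
  assumes "smooth_atlas A"
  shows "smooth_function A f \<longleftrightarrow> smooth_map A {real_chart} f"
  using open_chart[OF assms] by (auto simp: smooth_function_def smooth_map_def points_def o_def)

lemma smooth_function_comp: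
  assumes "smooth_atlas A" "smooth_atlas B" "smooth_map A B F" "smooth_function B f"
  shows "smooth_function A (f \<circ> F)"
  using assms smooth_map_comp[OF assms(1,2) smooth_atlas_real assms(3), of f]
  by (simp add: smooth_function_iff_smooth_map)

lemma differential_eq_tangent_map:
  "differential A f p v = snd (tangent_map A {real_chart} f (p, v)) real_chart"
  by (simp add: differential_def tangent_map_def o_def)

lemma differential_rep:
  assumes "smooth_atlas A" "smooth_function A f" "c \<in> A" "p \<in> cdom c" "v \<in> tangent_space A p"
  shows "differential A f p v = FD (f \<circ> cinv c) (cmap c p) (v c)"
  using tangent_map_rep[of A "{real_chart}" f c p real_chart v] assms
  by (simp add: differential_eq_tangent_map smooth_function_iff_smooth_map o_def)

lemma differential_comp:
  assumes A: "smooth_atlas A" and B: "smooth_atlas B" and F: "smooth_map A B F"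
    and f: "smooth_function B f" and p: "p \<in> points A" and v: "v \<in> tangent_space A p"
  shows "differential B f (F p) (snd (tangent_map A B F (p, v))) = differential A (f \<circ> F) p v"
proof -
  have "tangent_map A B F (p, v) = (F p, snd (tangent_map A B F (p, v)))"
    by (rule prod_eqI) auto
  then show ?thesis
    using tangent_map_comp[OF A B smooth_atlas_real F _ p v, of f] f
    by (simp add: differential_eq_tangent_map smooth_function_iff_smooth_map[OF B])
qed

lemma differential_cong:
  assumes A: "smooth_atlas A" and p: "p \<in> points A" and eq: "\<And>q. q \<in> points A \<Longrightarrow> f q = g q"
  shows "differential A f p v = differential A g p v"
  using tangent_map_cong[OF A p, of f g "{real_chart}" v] eq by (simp add: differential_eq_tangent_map)

text \<open>The velocity is the image of the unit vector of the interval under the tangent map of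
  the curve, so the chain rule for curves reduces to functoriality of
  \<open>tangent_map\<close>.\<close>

lemma velocity_eq_tangent_map:
  assumes "open I" "t \<in> I" and A: "smooth_atlas A" and g: "smooth_map {(I, \<lambda>t. t)} A \<gamma>"
  shows "velocity A \<gamma> t = tangent_map {(I, \<lambda>t. t)} A \<gamma> (t, coord_vec {(I, \<lambda>t. t)} (I, \<lambda>t. t) t 1)"
proof -
  let ?J = "(I, \<lambda>t::real. t)"
  have inv: "inv_into I (\<lambda>t. t) s = s" if "s \<in> I" for s
    using f_inv_into_f[of s "\<lambda>t. t" I] that by simp
  have ch: "chart_at {?J} t = ?J"
    using chart_at[of t "{?J}"] assms(2) by (auto simp: points_def)
  have "vector_derivative (cmap c \<circ> \<gamma>) (at t) = FD (crep ?J c \<gamma>) t 1" if "c \<in> A" "\<gamma> t \<in> cdom c" for c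
  proof -
    \<comment> \<open>The inverse of the chart of the interval is the identity on \<open>I\<close>
      only; as \<open>I\<close> is open, this fixes the derivative at \<open>t\<close>.\<close>
    have *: "crep ?J c \<gamma> s = (cmap c \<circ> \<gamma>) s" if "s \<in> I" for s using inv[OF that] by simp
    have d: "crep ?J c \<gamma> differentiable at t"
      using rep_differentiable[OF g, of ?J c t] that assms(2) by simp
    have "FD (crep ?J c \<gamma>) t = FD (cmap c \<circ> \<gamma>) t"
      by (rule FD_cong[OF assms(1,2) *])
    moreover have "(cmap c \<circ> \<gamma>) differentiable at t"
      by (rule differentiable_cong[OF assms(1,2) * d])
    ultimately show ?thesis by (simp add: frechet_derivative_eq_vector_derivative)
  qed
  moreover have "coord_vec {?J} ?J t 1 ?J = 1"
    using coord_vec_same[OF smooth_atlas_interval[OF assms(1)], of ?J t 1] assms(2) by simp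
  ultimately show ?thesis
    by (simp add: velocity_def tangent_map_def ch Let_def cong: if_cong conj_cong)
qed

text \<open>The tangent map of \<open>F\<close> takes velocities to velocities. Only the forward
  direction is stated; for a diffeomorphism the backward one is the same lemma applied to the
  inverse map.\<close>

lemma integral_curve_push:
  assumes A: "smooth_atlas A" and B: "smooth_atlas B" and F: "smooth_map A B F"
    and rel: "\<And>p. p \<in> points A \<Longrightarrow> Y (F p) = tangent_map A B F (X p)"
    and \<gamma>: "integral_curve A X I \<gamma>"
  shows "integral_curve B Y I (F \<circ> \<gamma>)"
proof -
  have I: "open I" "is_interval I" and g: "smooth_map {(I, \<lambda>t. t)} A \<gamma>"
    and eq: "\<And>t. t \<in> I \<Longrightarrow> velocity A \<gamma> t = X (\<gamma> t)"
    using \<gamma> by (auto simp: integral_curve_def)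
  note J = smooth_atlas_interval[OF I(1)]
  note Fg = smooth_map_comp[OF J A B g F]
  have "velocity B (F \<circ> \<gamma>) t = Y (F (\<gamma> t))" if t: "t \<in> I" for t
  proof -
    let ?v = "coord_vec {(I, \<lambda>t. t)} (I, \<lambda>t. t) t (1::real)"
    have p: "t \<in> points {(I, \<lambda>t::real. t)}" using t by (simp add: points_def)
    have v: "?v \<in> tangent_space {(I, \<lambda>t. t)} t"
      by (rule coord_vec_in_tangent_space[OF J]) (use t in auto)
    have "velocity B (F \<circ> \<gamma>) t = tangent_map A B F (velocity A \<gamma> t)"
      by (simp add: velocity_eq_tangent_map[OF I(1) t A g] velocity_eq_tangent_map[OF I(1) t B Fg]
          tangent_map_comp[OF J A B g F p v])
    then show ?thesis using eq[OF t] rel[OF smooth_map_points[OF g p]] by simp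
  qed
  then show ?thesis using I Fg by (simp add: integral_curve_def)
qed

text \<open>The notion constrains the curve only on \<open>I\<close> and the field only on the
  manifold. This tolerance is needed when the inverse Legendre map is applied to
  \<open>\<alpha> \<circ> \<gamma>\<close> to recover \<open>X \<circ> \<gamma>\<close>, and when
  the base field is replaced by \<open>X\<close>.\<close>

lemma integral_curve_cong:
  assumes A: "smooth_atlas A" and \<gamma>: "integral_curve A X I \<gamma>"
    and eq: "\<And>t. t \<in> I \<Longrightarrow> \<gamma> t = \<delta> t" and eqX: "\<And>p. p \<in> points A \<Longrightarrow> X p = Y p"
  shows "integral_curve A Y I \<delta>"
proof -
  have I: "open I" "is_interval I" and g: "smooth_map {(I, \<lambda>t. t)} A \<gamma>"
    and v: "\<And>t. t \<in> I \<Longrightarrow> velocity A \<gamma> t = X (\<gamma> t)"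
    using \<gamma> by (auto simp: integral_curve_def)
  note J = smooth_atlas_interval[OF I(1)]
  have pts: "points {(I, \<lambda>t::real. t)} = I" by (simp add: points_def)
  have d: "smooth_map {(I, \<lambda>t. t)} A \<delta>"
    by (rule smooth_map_cong[OF J g]) (simp add: pts eq)
  have "velocity A \<delta> t = Y (\<delta> t)" if t: "t \<in> I" for t
  proof -
    have "velocity A \<delta> t = velocity A \<gamma> t"
      unfolding velocity_eq_tangent_map[OF I(1) t A g] velocity_eq_tangent_map[OF I(1) t A d]
      by (rule tangent_map_cong[OF J]) (simp_all add: pts eq t)
    then show ?thesis
      using v[OF t] eqX[OF smooth_map_points[OF g, of t]] eq[OF t] t pts by simp
  qed
  then show ?thesis using I d by (simp add: integral_curve_def)
qed

section \<open>Tangent and cotangent bundles\<close>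

lemma cdom_tangent_chart [simp]: "cdom (tangent_chart A c) = Sigma (cdom c) (tangent_space A)"
  by (simp add: tangent_chart_def)

lemma cmap_tangent_chart [simp]: "cmap (tangent_chart A c) z = (cmap c (fst z), snd z c)"
  by (simp add: tangent_chart_def case_prod_beta)

lemma cdom_cotangent_chart [simp]: "cdom (cotangent_chart A c) = Sigma (cdom c) (cotangent_space A)"
  by (simp add: cotangent_chart_def)

lemma cmap_cotangent_chart [simp]:
  "cmap (cotangent_chart A c) z = (cmap c (fst z), covec_coords A c (fst z) (snd z))"
  by (simp add: cotangent_chart_def case_prod_beta)

lemma points_tangent_atlas: "points (tangent_atlas A) = Sigma (points A) (tangent_space A)"
  by (auto simp: points_def tangent_atlas_def)

lemma points_cotangent_atlas: "points (cotangent_atlas A) = Sigma (points A) (cotangent_space A)"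
  by (auto simp: points_def cotangent_atlas_def)

lemma tangent_chart_in: "c \<in> A \<Longrightarrow> tangent_chart A c \<in> tangent_atlas A"
  by (simp add: tangent_atlas_def)

lemma cotangent_chart_in: "c \<in> A \<Longrightarrow> cotangent_chart A c \<in> cotangent_atlas A"
  by (simp add: cotangent_atlas_def)

section \<open>Natural charts of the tangent bundle\<close>

lemma inj_on_tangent_chart:
  assumes A: "smooth_atlas A" and c: "c \<in> A"
  shows "inj_on (cmap (tangent_chart A c)) (cdom (tangent_chart A c))"
  using cmap_eq_iff[OF A c] tangent_space_eqI[OF c] by (fastforce intro!: inj_onI)

text \<open>\<open>coord_vec\<close> supplies a tangent vector for every value of the fibre
  component. \<open>P\<close> will be the domain of a chart or the overlap of two.\<close>

lemma image_tangent_chart: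
  assumes A: "smooth_atlas A" and c: "c \<in> A" and P: "P \<subseteq> cdom c"
  shows "cmap (tangent_chart A c) ` Sigma P (tangent_space A) = cmap c ` P \<times> UNIV"
proof -
  have "(cmap c p, u) \<in> cmap (tangent_chart A c) ` Sigma P (tangent_space A)" if "p \<in> P" for p u
    by (rule image_eqI[of _ _ "(p, coord_vec A c p u)"])
       (use that P coord_vec_same[OF A c] coord_vec_in_tangent_space[OF A c] in auto)
  then show ?thesis by auto
qed

lemma cinv_tangent_chart:
  assumes A: "smooth_atlas A" and c: "c \<in> A" and x: "x \<in> cmap c ` cdom c"
  shows "cinv (tangent_chart A c) (x, u) = (cinv c x, coord_vec A c (cinv c x) u)"
proof (rule inv_into_f_eq[OF inj_on_tangent_chart[OF A c]])
  have q: "cinv c x \<in> cdom c" using x by (rule inv_into_into)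
  show "(cinv c x, coord_vec A c (cinv c x) u) \<in> cdom (tangent_chart A c)"
    using q coord_vec_in_tangent_space[OF A c q] by simp
  show "cmap (tangent_chart A c) (cinv c x, coord_vec A c (cinv c x) u) = (x, u)"
    using x coord_vec_same[OF A c q] by (simp add: f_inv_into_f)
qed

lemma transition_tangent_chart:
  assumes A: "smooth_atlas A" and c: "c \<in> A" and d: "d \<in> A"
    and x: "x \<in> cmap c ` (cdom c \<inter> cdom d)"
  shows "transition (tangent_chart A c) (tangent_chart A d) (x, u)
    = (transition c d x, FD (transition c d) x u)"
proof -
  obtain p where p: "p \<in> cdom c" "p \<in> cdom d" "x = cmap c p" using x by auto
  have xp: "cinv c x = p" using cinv_cmap[OF A c p(1)] p(3) by simp
  have "coord_vec A c p u d = FD (transition c d) x u"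
    using d p by (simp add: coord_vec_def)
  then show ?thesis using cinv_tangent_chart[OF A c, of x u] p xp by simp
qed

text \<open>Local form of a tangent map: with a transition map for \<open>f\<close> it is a chart
  change of the tangent bundle, with the representation of a map for \<open>f\<close> it represents
  the tangent map.\<close>

lemma smooth_on_derivative_pair:
  fixes f :: "'e::euclidean_space \<Rightarrow> 'f::euclidean_space"
  assumes "open S" "smooth_on f S"
  shows "smooth_on (\<lambda>x. (f (fst x), FD f (fst x) (snd x))) (S \<times> UNIV)"
proof -
  have o: "open (S \<times> (UNIV :: 'e set))" using assms by (intro open_Times) auto
  have 1: "smooth_on fst (S \<times> (UNIV :: 'e set))"
    by (rule smooth_on_linear[OF bounded_linear_fst])
  have 2: "smooth_on snd (S \<times> (UNIV :: 'e set))"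
    by (rule smooth_on_linear[OF bounded_linear_snd])
  show ?thesis
    by (intro smooth_on_Pair smooth_on_compose[OF o assms(2) 1]
        smooth_on_FD_apply[OF o assms(2) 1 2] o) auto
qed

lemma smooth_atlas_tangent:
  assumes A: "smooth_atlas A"
  shows "smooth_atlas (tangent_atlas A)"
  unfolding smooth_atlas_def
proof (intro conjI ballI)
  fix C assume "C \<in> tangent_atlas A"
  then obtain c where c: "c \<in> A" "C = tangent_chart A c" by (auto simp: tangent_atlas_def)
  show "inj_on (cmap C) (cdom C)" using inj_on_tangent_chart[OF A c(1)] c(2) by simp
  show "open (cmap C ` cdom C)"
    unfolding c(2) cdom_tangent_chart image_tangent_chart[OF A c(1) subset_refl]
    by (intro open_Times open_chart[OF A c(1)] open_UNIV)
  fix D assume "D \<in> tangent_atlas A"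
  then obtain d where d: "d \<in> A" "D = tangent_chart A d" by (auto simp: tangent_atlas_def)
  have "cdom C \<inter> cdom D = Sigma (cdom c \<inter> cdom d) (tangent_space A)" using c d by auto
  then have im: "cmap C ` (cdom C \<inter> cdom D) = cmap c ` (cdom c \<inter> cdom d) \<times> UNIV"
    using image_tangent_chart[OF A c(1), of "cdom c \<inter> cdom d"] c(2) by simp
  show op: "open (cmap C ` (cdom C \<inter> cdom D))"
    unfolding im by (intro open_Times open_transition_domain[OF A c(1) d(1)] open_UNIV)
  show "smooth_on (transition C D) (cmap C ` (cdom C \<inter> cdom D))"
  proof (rule smooth_on_cong[OF op])
    show "smooth_on (\<lambda>x. (transition c d (fst x), FD (transition c d) (fst x) (snd x)))
        (cmap C ` (cdom C \<inter> cdom D))"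
      unfolding im
      by (rule smooth_on_derivative_pair[OF open_transition_domain[OF A c(1) d(1)]
            smooth_on_transition[OF A c(1) d(1)]])
    show "(transition c d (fst x), FD (transition c d) (fst x) (snd x)) = transition C D x"
      if "x \<in> cmap C ` (cdom C \<inter> cdom D)" for x
      using transition_tangent_chart[OF A c(1) d(1), of "fst x" "snd x"] that c d
      unfolding im by auto
  qed
qed

section \<open>Covectors and the natural charts of the cotangent bundle\<close>

definition tangent_linear :: "('a, 'e::euclidean_space) chart set \<Rightarrow> 'a \<Rightarrow> (('a, 'e) tvec \<Rightarrow> real) \<Rightarrow> bool" where
  "tangent_linear A p \<alpha> \<longleftrightarrow> (\<forall>v\<in>tangent_space A p. \<forall>w\<in>tangent_space A p. \<forall>a b.
     \<alpha> (\<lambda>c. a *\<^sub>R v c + b *\<^sub>R w c) = a * \<alpha> v + b * \<alpha> w)"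

text \<open>Linearity is split off from extensionality because form values such as
  \<open>canonical_one_form A z\<close> are linear on tangent vectors without being restricted to
  them.\<close>

lemma cotangent_space_iff:
  "\<alpha> \<in> cotangent_space A p \<longleftrightarrow> \<alpha> \<in> extensional (tangent_space A p) \<and> tangent_linear A p \<alpha>"
  by (simp add: cotangent_space_def tangent_linear_def)

lemma coord_vec_combine:
  assumes A: "smooth_atlas A" and c: "c \<in> A" "p \<in> cdom c"
  shows "coord_vec A c p (a *\<^sub>R x + b *\<^sub>R y) = (\<lambda>d. a *\<^sub>R coord_vec A c p x d + b *\<^sub>R coord_vec A c p y d)"
proof (rule tangent_space_eqI[OF c])
  show "(\<lambda>d. a *\<^sub>R coord_vec A c p x d + b *\<^sub>R coord_vec A c p y d) \<in> tangent_space A p"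
    by (intro tangent_space_combine[OF A] coord_vec_in_tangent_space[OF A c])
qed (simp_all add: coord_vec_in_tangent_space[OF A c] coord_vec_same[OF A c])

text \<open>Composed with \<open>coord_vec\<close>, \<open>\<alpha>\<close> becomes a linear
  functional on the Euclidean model space, whose coefficients on the basis are by definition
  \<open>covec_coords\<close>.\<close>

lemma tangent_linear_apply:
  assumes A: "smooth_atlas A" and c: "c \<in> A" "p \<in> cdom c"
    and \<alpha>: "tangent_linear A p \<alpha>" and v: "v \<in> tangent_space A p"
  shows "\<alpha> v = covec_coords A c p \<alpha> \<bullet> v c"
proof -
  let ?f = "\<lambda>x. \<alpha> (coord_vec A c p x)"
  have comb: "?f (a *\<^sub>R x + b *\<^sub>R y) = a * ?f x + b * ?f y" for a b x y
    using \<alpha> coord_vec_in_tangent_space[OF A c] unfolding coord_vec_combine[OF A c] tangent_linear_def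
    by blast
  have "linear ?f"
  proof (rule linearI)
    show "?f (x + y) = ?f x + ?f y" for x y using comb[of 1 x 1 y] by simp
    show "?f (r *\<^sub>R x) = r *\<^sub>R ?f x" for r x using comb[of r x 0 x] by simp
  qed
  then have "?f (v c) = (\<Sum>i\<in>Basis. (v c \<bullet> i) *\<^sub>R ?f i)" by (rule linear_eq_sum_Basis)
  also have "\<dots> = covec_coords A c p \<alpha> \<bullet> v c"
    unfolding covec_coords_def inner_sum_left by (rule sum.cong) (simp_all add: inner_commute)
  finally show ?thesis by (simp add: coord_vec_eq[OF c v])
qed

lemma covec_coords_inner:
  assumes A: "smooth_atlas A" and c: "c \<in> A" "p \<in> cdom c"
    and eq: "\<And>v. v \<in> tangent_space A p \<Longrightarrow> \<alpha> v = \<pi> \<bullet> v c"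
  shows "covec_coords A c p \<alpha> = \<pi>"
proof -
  have "\<alpha> (coord_vec A c p i) = \<pi> \<bullet> i" for i
    using eq[OF coord_vec_in_tangent_space[OF A c]] by (simp add: coord_vec_same[OF A c])
  then show ?thesis by (simp add: covec_coords_def euclidean_representation)
qed

text \<open>Covectors transform by the transpose of the derivative of the opposite transition, from
  \<open>d\<close> back to \<open>c\<close>; the sum over the basis spells out that
  transpose.\<close>

lemma covec_coords_transition:
  assumes A: "smooth_atlas A" and c: "c \<in> A" "p \<in> cdom c" and d: "d \<in> A" "p \<in> cdom d"
    and \<alpha>: "tangent_linear A p \<alpha>"
  shows "covec_coords A d p \<alpha> = (\<Sum>i\<in>Basis. (covec_coords A c p \<alpha> \<bullet> FD (transition d c) (cmap d p) i) *\<^sub>R i)"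
proof -
  have "\<alpha> (coord_vec A d p i) = covec_coords A c p \<alpha> \<bullet> FD (transition d c) (cmap d p) i" for i
    using tangent_linear_apply[OF A c \<alpha> coord_vec_in_tangent_space[OF A d]] c
    by (simp add: coord_vec_def[of A d])
  then show ?thesis by (simp add: covec_coords_def[of A d])
qed

lemma cotangent_space_eqI:
  assumes A: "smooth_atlas A" and c: "c \<in> A" "p \<in> cdom c"
    and "\<alpha> \<in> cotangent_space A p" "\<beta> \<in> cotangent_space A p"
    and "covec_coords A c p \<alpha> = covec_coords A c p \<beta>"
  shows "\<alpha> = \<beta>"
proof (rule extensionalityI[of _ "tangent_space A p"])
  show "\<alpha> v = \<beta> v" if "v \<in> tangent_space A p" for v
    using assms tangent_linear_apply[OF A c, of \<alpha> v] tangent_linear_apply[OF A c, of \<beta> v] that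
    by (simp add: cotangent_space_iff)
qed (use assms in \<open>auto simp: cotangent_space_iff\<close>)

lemma inner_in_cotangent_space:
  assumes "smooth_atlas A"
  shows "(\<lambda>v\<in>tangent_space A p. \<pi> \<bullet> v c) \<in> cotangent_space A p"
  using tangent_space_combine[OF assms]
  by (simp add: cotangent_space_iff tangent_linear_def inner_add_right)

lemma covec_coords_inner_restrict:
  assumes "smooth_atlas A" "c \<in> A" "p \<in> cdom c"
  shows "covec_coords A c p (\<lambda>v\<in>tangent_space A p. \<pi> \<bullet> v c) = \<pi>"
  by (rule covec_coords_inner[OF assms]) simp

lemma inj_on_cotangent_chart:
  assumes A: "smooth_atlas A" and c: "c \<in> A"
  shows "inj_on (cmap (cotangent_chart A c)) (cdom (cotangent_chart A c))"
  using cmap_eq_iff[OF A c] cotangent_space_eqI[OF A c] by (fastforce intro!: inj_onI)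

lemma image_cotangent_chart:
  assumes A: "smooth_atlas A" and c: "c \<in> A" and P: "P \<subseteq> cdom c"
  shows "cmap (cotangent_chart A c) ` Sigma P (cotangent_space A) = cmap c ` P \<times> UNIV"
proof -
  have "(cmap c p, \<pi>) \<in> cmap (cotangent_chart A c) ` Sigma P (cotangent_space A)" if "p \<in> P" for p \<pi>
    by (rule image_eqI[of _ _ "(p, \<lambda>v\<in>tangent_space A p. \<pi> \<bullet> v c)"])
       (use that P covec_coords_inner_restrict[OF A c] inner_in_cotangent_space[OF A] in auto)
  then show ?thesis by auto
qed

lemma cinv_cotangent_chart:
  assumes A: "smooth_atlas A" and c: "c \<in> A" and x: "x \<in> cmap c ` cdom c"
  shows "cinv (cotangent_chart A c) (x, \<pi>) = (cinv c x, \<lambda>v\<in>tangent_space A (cinv c x). \<pi> \<bullet> v c)"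
proof (rule inv_into_f_eq[OF inj_on_cotangent_chart[OF A c]])
  have q: "cinv c x \<in> cdom c" using x by (rule inv_into_into)
  show "(cinv c x, \<lambda>v\<in>tangent_space A (cinv c x). \<pi> \<bullet> v c) \<in> cdom (cotangent_chart A c)"
    using q inner_in_cotangent_space[OF A] by simp
  show "cmap (cotangent_chart A c) (cinv c x, \<lambda>v\<in>tangent_space A (cinv c x). \<pi> \<bullet> v c) = (x, \<pi>)"
    using x covec_coords_inner_restrict[OF A c q] by (simp add: f_inv_into_f)
qed

lemma transition_cotangent_chart:
  assumes A: "smooth_atlas A" and c: "c \<in> A" and d: "d \<in> A"
    and x: "x \<in> cmap c ` (cdom c \<inter> cdom d)"
  shows "transition (cotangent_chart A c) (cotangent_chart A d) (x, \<pi>)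
    = (transition c d x, \<Sum>i\<in>Basis. (\<pi> \<bullet> FD (transition d c) (transition c d x) i) *\<^sub>R i)"
proof -
  obtain p where p: "p \<in> cdom c" "p \<in> cdom d" "x = cmap c p" using x by auto
  have xp: "cinv c x = p" using cinv_cmap[OF A c p(1)] p(3) by simp
  have lin: "tangent_linear A p (\<lambda>v\<in>tangent_space A p. \<pi> \<bullet> v c)"
    using inner_in_cotangent_space[OF A] by (simp add: cotangent_space_iff)
  show ?thesis
    using cinv_cotangent_chart[OF A c, of x \<pi>] p xp covec_coords_inner_restrict[OF A c p(1)]
      covec_coords_transition[OF A c p(1) d p(2) lin] by simp
qed

lemma smooth_atlas_cotangent:
  assumes A: "smooth_atlas A"
  shows "smooth_atlas (cotangent_atlas A)"
  unfolding smooth_atlas_def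
proof (intro conjI ballI)
  fix C assume "C \<in> cotangent_atlas A"
  then obtain c where c: "c \<in> A" "C = cotangent_chart A c" by (auto simp: cotangent_atlas_def)
  show "inj_on (cmap C) (cdom C)" using inj_on_cotangent_chart[OF A c(1)] c(2) by simp
  show "open (cmap C ` cdom C)"
    unfolding c(2) cdom_cotangent_chart image_cotangent_chart[OF A c(1) subset_refl]
    by (intro open_Times open_chart[OF A c(1)] open_UNIV)
  fix D assume "D \<in> cotangent_atlas A"
  then obtain d where d: "d \<in> A" "D = cotangent_chart A d" by (auto simp: cotangent_atlas_def)
  let ?S = "cmap c ` (cdom c \<inter> cdom d)" and ?T = "cmap d ` (cdom d \<inter> cdom c)"
  have "cdom C \<inter> cdom D = Sigma (cdom c \<inter> cdom d) (cotangent_space A)" using c d by auto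
  then have im: "cmap C ` (cdom C \<inter> cdom D) = ?S \<times> UNIV"
    using image_cotangent_chart[OF A c(1), of "cdom c \<inter> cdom d"] c(2) by simp
  show op: "open (cmap C ` (cdom C \<inter> cdom D))"
    unfolding im by (intro open_Times open_transition_domain[OF A c(1) d(1)] open_UNIV)
  show "smooth_on (transition C D) (cmap C ` (cdom C \<inter> cdom D))"
  proof (rule smooth_on_cong[OF op])
    have o: "open (?S \<times> (UNIV :: 'b set))" using op im by simp
    have 1: "smooth_on fst (?S \<times> (UNIV :: 'b set))"
      by (rule smooth_on_linear[OF bounded_linear_fst])
    have 2: "smooth_on snd (?S \<times> (UNIV :: 'b set))"
      by (rule smooth_on_linear[OF bounded_linear_snd])
    have cd: "smooth_on (\<lambda>x. transition c d (fst x)) (?S \<times> (UNIV :: 'b set))"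
      by (rule smooth_on_compose[OF o smooth_on_transition[OF A c(1) d(1)] 1]) auto
    \<comment> \<open>The transposed derivative is evaluated at the image point
      \<open>transition c d (fst x)\<close>, so its smoothness is that of a composition into the
      domain of \<open>transition d c\<close>.\<close>
    have sub: "(\<lambda>x. transition c d (fst x)) ` (?S \<times> (UNIV :: 'b set)) \<subseteq> ?T"
      using cinv_cmap[OF A c(1)] by auto
    show "smooth_on (\<lambda>x. (transition c d (fst x),
        \<Sum>i\<in>Basis. (snd x \<bullet> FD (transition d c) (transition c d (fst x)) i) *\<^sub>R i))
        (cmap C ` (cdom C \<inter> cdom D))"
      unfolding im
      by (intro smooth_on_Pair smooth_on_sum smooth_on_scaleR smooth_on_inner smooth_on_const cd 2 o
          smooth_on_compose[OF o smooth_on_FD[OF smooth_on_transition[OF A d(1) c(1)]] cd sub])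
    show "(transition c d (fst x),
        \<Sum>i\<in>Basis. (snd x \<bullet> FD (transition d c) (transition c d (fst x)) i) *\<^sub>R i) = transition C D x"
      if "x \<in> cmap C ` (cdom C \<inter> cdom D)" for x
      using transition_cotangent_chart[OF A c(1) d(1), of "fst x" "snd x"] that c d
      unfolding im by (auto simp del: o_apply cmap_cotangent_chart)
  qed
qed

section \<open>Bundle projections\<close>

lemma proj_rep:
  assumes C: "\<And>z. z \<in> cdom C \<Longrightarrow> fst z \<in> cdom c \<and> fst (cmap C z) = cmap c (fst z)"
    and x: "x \<in> cmap C ` cdom C"
  shows "fst (cinv C x) \<in> cdom c" "crep C c fst x = fst x"
  using C[OF inv_into_into[OF x]] f_inv_into_f[OF x] by simp_all

text \<open>Stated for both bundles at once: the hypothesis says that \<open>B\<close> has charts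
  lying over charts of \<open>A\<close> with the base coordinates as first component, so that the
  projection is locally \<open>fst\<close>.\<close>

lemma smooth_map_proj:
  assumes B: "smooth_atlas B" and A: "smooth_atlas A"
    and C: "\<And>z. z \<in> points B \<Longrightarrow> \<exists>C\<in>B. \<exists>c\<in>A. z \<in> cdom C \<and>
      (\<forall>z\<in>cdom C. fst z \<in> cdom c \<and> fst (cmap C z) = cmap c (fst z))"
  shows "smooth_map B A fst"
proof (rule smooth_mapI[OF B A])
  fix z assume "z \<in> points B"
  then obtain C c where Cc: "C \<in> B" "c \<in> A" "z \<in> cdom C"
      "\<And>z. z \<in> cdom C \<Longrightarrow> fst z \<in> cdom c \<and> fst (cmap C z) = cmap c (fst z)"
    using C by blast
  let ?U = "cmap C ` cdom C"
  have U: "open ?U" by (rule open_chart[OF B Cc(1)])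
  have "smooth_on (crep C c fst) ?U"
    by (rule smooth_on_cong[OF U _ smooth_on_linear[OF bounded_linear_fst]])
       (rule proj_rep(2)[OF Cc(4), symmetric])
  then show "\<exists>C\<in>B. \<exists>d\<in>A. \<exists>U. z \<in> cdom C \<and> open U \<and> cmap C z \<in> U \<and>
      U \<subseteq> cmap C ` cdom C \<and> (\<forall>x\<in>U. fst (cinv C x) \<in> cdom d) \<and> smooth_on (crep C d fst) U"
    using Cc(1-3) U proj_rep(1)[OF Cc(4)]
    by (intro bexI[of _ C] bexI[of _ c] exI[of _ ?U] conjI ballI) auto
qed

lemma tangent_map_proj_rep:
  assumes B: "smooth_atlas B" and proj: "smooth_map B A fst"
    and C: "C \<in> B" "z \<in> cdom C" and c: "c \<in> A"
    and Cc: "\<And>z. z \<in> cdom C \<Longrightarrow> fst z \<in> cdom c \<and> fst (cmap C z) = cmap c (fst z)"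
    and \<xi>: "\<xi> \<in> tangent_space B z"
  shows "snd (tangent_map B A fst (z, \<xi>)) c = fst (\<xi> C)"
proof -
  have "FD (crep C c fst) (cmap C z) = FD fst (cmap C z)"
    by (rule FD_cong[OF open_chart[OF B C(1)] imageI[OF C(2)]]) (rule proj_rep(2)[OF Cc])
  also have "\<dots> = fst"
    by (rule FD_eqI) (rule bounded_linear_imp_has_derivative[OF bounded_linear_fst])
  finally show ?thesis
    using tangent_map_rep[OF B proj C c _ \<xi>] Cc[OF C(2)] by simp
qed

lemma smooth_map_tangent_proj:
  assumes A: "smooth_atlas A"
  shows "smooth_map (tangent_atlas A) A fst"
proof (rule smooth_map_proj[OF smooth_atlas_tangent[OF A] A])
  fix z assume "z \<in> points (tangent_atlas A)"
  then obtain c where "c \<in> A" "z \<in> cdom (tangent_chart A c)"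
    by (auto simp: points_def tangent_atlas_def)
  then show "\<exists>C\<in>tangent_atlas A. \<exists>c\<in>A. z \<in> cdom C \<and>
      (\<forall>z\<in>cdom C. fst z \<in> cdom c \<and> fst (cmap C z) = cmap c (fst z))"
    by (intro bexI[of _ "tangent_chart A c"] bexI[of _ c]) (auto simp: tangent_chart_in)
qed

lemma smooth_map_cotangent_proj:
  assumes A: "smooth_atlas A"
  shows "smooth_map (cotangent_atlas A) A fst"
proof (rule smooth_map_proj[OF smooth_atlas_cotangent[OF A] A])
  fix z assume "z \<in> points (cotangent_atlas A)"
  then obtain c where "c \<in> A" "z \<in> cdom (cotangent_chart A c)"
    by (auto simp: points_def cotangent_atlas_def)
  then show "\<exists>C\<in>cotangent_atlas A. \<exists>c\<in>A. z \<in> cdom C \<and>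
      (\<forall>z\<in>cdom C. fst z \<in> cdom c \<and> fst (cmap C z) = cmap c (fst z))"
    by (intro bexI[of _ "cotangent_chart A c"] bexI[of _ c]) (auto simp: cotangent_chart_in)
qed

lemma tangent_proj_rep:
  assumes A: "smooth_atlas A" and "c \<in> A" "w \<in> cdom (tangent_chart A c)"
    "\<xi> \<in> tangent_space (tangent_atlas A) w"
  shows "snd (tangent_map (tangent_atlas A) A fst (w, \<xi>)) c = fst (\<xi> (tangent_chart A c))"
  using assms
  by (intro tangent_map_proj_rep[OF smooth_atlas_tangent[OF A] smooth_map_tangent_proj[OF A]])
     (auto simp: tangent_chart_in)

lemma cotangent_proj_rep:
  assumes A: "smooth_atlas A" and "c \<in> A" "z \<in> cdom (cotangent_chart A c)"
    "\<xi> \<in> tangent_space (cotangent_atlas A) z"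
  shows "snd (tangent_map (cotangent_atlas A) A fst (z, \<xi>)) c = fst (\<xi> (cotangent_chart A c))"
  using assms
  by (intro tangent_map_proj_rep[OF smooth_atlas_cotangent[OF A] smooth_map_cotangent_proj[OF A]])
     (auto simp: cotangent_chart_in)

text \<open>Needed for the smoothness of a pushed-forward vector field, which is a composite of the
  field with a tangent map and an inverse map.\<close>

lemma smooth_map_tangent_map:
  assumes A: "smooth_atlas A" and B: "smooth_atlas B" and F: "smooth_map A B F"
  shows "smooth_map (tangent_atlas A) (tangent_atlas B) (tangent_map A B F)"
proof (rule smooth_mapI[OF smooth_atlas_tangent[OF A] smooth_atlas_tangent[OF B]])
  fix z assume "z \<in> points (tangent_atlas A)"
  then obtain p v where z: "z = (p, v)" and p: "p \<in> points A" and v: "v \<in> tangent_space A p"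
    by (auto simp: points_tangent_atlas)
  let ?c = "chart_at A p" and ?d = "chart_at B (F p)"
  let ?S = "cmap ?c ` {q \<in> cdom ?c. F q \<in> cdom ?d}"
  note c = chart_at[OF p] and d = chart_at[OF smooth_map_points[OF F p]]
  have U: "open (?S \<times> UNIV)"
    by (intro open_Times open_rep_domain[OF F c(1) d(1)] open_UNIV)
  have pt: "tangent_map A B F (cinv (tangent_chart A ?c) x) \<in> cdom (tangent_chart B ?d) \<and>
      crep (tangent_chart A ?c) (tangent_chart B ?d) (tangent_map A B F) x
        = (crep ?c ?d F (fst x), FD (crep ?c ?d F) (fst x) (snd x))"
    if x: "x \<in> ?S \<times> UNIV" for x
  proof -
    obtain q u where q: "q \<in> cdom ?c" "F q \<in> cdom ?d" "x = (cmap ?c q, u)"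
      using x by (cases x) auto
    let ?u = "coord_vec A ?c q u"
    have inv: "cinv (tangent_chart A ?c) x = (q, ?u)"
      using cinv_tangent_chart[OF A c(1), of "cmap ?c q" u] cinv_cmap[OF A c(1) q(1)] q by simp
    have u: "?u \<in> tangent_space A q" by (rule coord_vec_in_tangent_space[OF A c(1) q(1)])
    have "tangent_map A B F (q, ?u) = (F q, snd (tangent_map A B F (q, ?u)))"
      by (rule prod_eqI) auto
    then have "tangent_map A B F (q, ?u) \<in> cdom (tangent_chart B ?d)"
      using tangent_map_in[OF A B F in_points[OF c(1) q(1)] u] q(2)
      by (simp add: mem_Times_iff Sigma_def) (metis prod.collapse)
    moreover have "snd (tangent_map A B F (q, ?u)) ?d = FD (crep ?c ?d F) (cmap ?c q) u"
      using tangent_map_rep[OF A F c(1) q(1) d(1) q(2) u] coord_vec_same[OF A c(1) q(1)] by simp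
    ultimately show ?thesis using inv q cinv_cmap[OF A c(1) q(1)] by simp
  qed
  have sm: "smooth_on (crep (tangent_chart A ?c) (tangent_chart B ?d) (tangent_map A B F)) (?S \<times> UNIV)"
    by (rule smooth_on_cong[OF U _ smooth_on_derivative_pair[OF open_rep_domain[OF F c(1) d(1)]
          smooth_on_rep[OF F c(1) d(1)]]]) (use pt in simp)
  have sub: "?S \<times> UNIV \<subseteq> cmap (tangent_chart A ?c) ` cdom (tangent_chart A ?c)"
    unfolding cdom_tangent_chart image_tangent_chart[OF A c(1) subset_refl] by auto
  show "\<exists>C\<in>tangent_atlas A. \<exists>D\<in>tangent_atlas B. \<exists>U. z \<in> cdom C \<and> open U \<and> cmap C z \<in> U \<and>
      U \<subseteq> cmap C ` cdom C \<and> (\<forall>x\<in>U. tangent_map A B F (cinv C x) \<in> cdom D) \<and>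
      smooth_on (crep C D (tangent_map A B F)) U"
    using tangent_chart_in[OF c(1)] tangent_chart_in[OF d(1)] U sm sub pt
    by (intro bexI[of _ "tangent_chart A ?c"] bexI[of _ "tangent_chart B ?d"] exI[of _ "?S \<times> UNIV"] conjI)
       (use z c d v in auto)
qed

section \<open>Vector fields as sections\<close>

lemma vector_fieldD:
  assumes "vector_field A X" "p \<in> points A"
  shows "X p = (p, snd (X p))" "snd (X p) \<in> tangent_space A p" "X p \<in> points (tangent_atlas A)"
proof -
  show "X p = (p, snd (X p))" using assms unfolding vector_field_def by (metis prod.collapse)
  show "X p \<in> points (tangent_atlas A)"
    using assms smooth_map_points[of A "tangent_atlas A" X p] by (simp add: vector_field_def)
  with \<open>X p = (p, snd (X p))\<close> show "snd (X p) \<in> tangent_space A p"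
    by (metis points_tangent_atlas mem_Sigma_iff)
qed

text \<open>In a chart and the natural chart above it, a section has the identity as first
  component, so only the fibre component matters. This serves the construction of Hamiltonian vector
  fields, which are given by components.\<close>

lemma vector_fieldI:
  assumes A: "smooth_atlas A" and ext: "X \<in> extensional (points A)"
    and X: "\<And>p. p \<in> points A \<Longrightarrow> fst (X p) = p \<and> snd (X p) \<in> tangent_space A p"
    and sm: "\<And>c. c \<in> A \<Longrightarrow> smooth_on (\<lambda>x. snd (X (cinv c x)) c) (cmap c ` cdom c)"
  shows "vector_field A X"
proof -
  have "smooth_map A (tangent_atlas A) X"
  proof (rule smooth_mapI[OF A smooth_atlas_tangent[OF A]])
    fix p assume p: "p \<in> points A"
    let ?c = "chart_at A p" let ?U = "cmap ?c ` cdom ?c"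
    note c = chart_at[OF p]
    have U: "open ?U" by (rule open_chart[OF A c(1)])
    have pt: "X (cinv ?c x) \<in> cdom (tangent_chart A ?c) \<and>
        crep ?c (tangent_chart A ?c) X x = (x, snd (X (cinv ?c x)) ?c)" if x: "x \<in> ?U" for x
    proof -
      have q: "cinv ?c x \<in> cdom ?c" using x by (rule inv_into_into)
      have Xq: "fst (X (cinv ?c x)) = cinv ?c x" "snd (X (cinv ?c x)) \<in> tangent_space A (cinv ?c x)"
        using X[OF in_points[OF c(1) q]] by auto
      then have "X (cinv ?c x) \<in> Sigma (cdom ?c) (tangent_space A)"
        using q by (metis SigmaI prod.collapse)
      then show ?thesis using Xq(1) x by (simp add: f_inv_into_f)
    qed
    have "smooth_on (crep ?c (tangent_chart A ?c) X) ?U"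
      by (rule smooth_on_cong[OF U _ smooth_on_Pair[OF U smooth_on_linear[OF bounded_linear_ident] sm[OF c(1)]]])
         (use pt in simp)
    then show "\<exists>c\<in>A. \<exists>D\<in>tangent_atlas A. \<exists>U. p \<in> cdom c \<and> open U \<and> cmap c p \<in> U \<and>
        U \<subseteq> cmap c ` cdom c \<and> (\<forall>x\<in>U. X (cinv c x) \<in> cdom D) \<and> smooth_on (crep c D X) U"
      using c pt U tangent_chart_in[OF c(1)]
      by (intro bexI[of _ ?c] bexI[of _ "tangent_chart A ?c"] exI[of _ ?U] conjI ballI) auto
  qed
  then show ?thesis using ext X by (simp add: vector_field_def)
qed

section \<open>The exterior derivative\<close>

text \<open>The terms with second derivatives of \<open>f\<close> are symmetric in \<open>v, w\<close> and cancel.\<close>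

lemma FD_pullback_antisymmetric:
  fixes f :: "'e::euclidean_space \<Rightarrow> 'f::euclidean_space" and b :: "'f \<Rightarrow> 'f"
  assumes S: "open S" and f: "smooth_on f S" and x: "x \<in> S" and b: "b differentiable at (f x)"
  defines "g \<equiv> \<lambda>x. \<Sum>i\<in>Basis. (b (f x) \<bullet> FD f x i) *\<^sub>R i"
  shows "FD g x v \<bullet> w - FD g x w \<bullet> v
    = FD b (f x) (FD f x v) \<bullet> FD f x w - FD b (f x) (FD f x w) \<bullet> FD f x v"
proof -
  have df: "(f has_derivative FD f x) (at x)"
    by (rule FD_has_derivative[OF smooth_on_differentiable[OF f x]])
  have db: "((\<lambda>x. b (f x)) has_derivative (\<lambda>v. FD b (f x) (FD f x v))) (at x)"
    by (rule has_derivative_compose[OF df FD_has_derivative[OF b]])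
  have d2: "((\<lambda>y. FD f y u) has_derivative FD (\<lambda>y. FD f y u) x) (at x)" for u
    by (rule FD_has_derivative[OF smooth_on_differentiable[OF smooth_on_FD[OF f] x]])
  have "(g has_derivative (\<lambda>v. \<Sum>i\<in>Basis. (b (f x) \<bullet> FD (\<lambda>y. FD f y i) x v
      + FD b (f x) (FD f x v) \<bullet> FD f x i) *\<^sub>R i)) (at x)"
    unfolding g_def
    by (intro has_derivative_sum has_derivative_scaleR_left has_derivative_inner db d2)
  note dg = FD_eqI[OF this]
  have "FD g x v \<bullet> w = b (f x) \<bullet> FD (\<lambda>y. FD f y v) x w + FD b (f x) (FD f x v) \<bullet> FD f x w" for v w
  proof -
    \<comment> \<open>Exchanging the directions \<open>i\<close> and \<open>v\<close> in the second
      derivative makes the sum over \<open>i\<close> the expansion of a linear map evaluated at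
      \<open>w\<close>.\<close>
    have "FD g x v \<bullet> w = (\<Sum>i\<in>Basis. b (f x) \<bullet> ((w \<bullet> i) *\<^sub>R FD (\<lambda>y. FD f y v) x i)
        + FD b (f x) (FD f x v) \<bullet> ((w \<bullet> i) *\<^sub>R FD f x i))"
      unfolding dg inner_sum_left
      by (rule sum.cong) (simp_all add: FD_FD_symmetric[OF S f x, of _ v] inner_commute[of _ w] algebra_simps)
    also have "\<dots> = b (f x) \<bullet> (\<Sum>i\<in>Basis. (w \<bullet> i) *\<^sub>R FD (\<lambda>y. FD f y v) x i)
        + FD b (f x) (FD f x v) \<bullet> (\<Sum>i\<in>Basis. (w \<bullet> i) *\<^sub>R FD f x i)"
      by (simp only: inner_sum_right sum.distrib)
    also have "(\<Sum>i\<in>Basis. (w \<bullet> i) *\<^sub>R FD (\<lambda>y. FD f y v) x i) = FD (\<lambda>y. FD f y v) x w"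
      by (rule linear_eq_sum_Basis[symmetric])
         (rule linear_frechet_derivative[OF smooth_on_differentiable[OF smooth_on_FD[OF f] x]])
    also have "(\<Sum>i\<in>Basis. (w \<bullet> i) *\<^sub>R FD f x i) = FD f x w"
      by (rule linear_eq_sum_Basis[symmetric])
         (rule linear_frechet_derivative[OF smooth_on_differentiable[OF f x]])
    finally show ?thesis .
  qed
  then show ?thesis using FD_FD_symmetric[OF S f x, of v w] by simp
qed

abbreviation form_rep ::
  "('a, 'e::euclidean_space) chart set \<Rightarrow> ('a, 'e) chart \<Rightarrow> ('a \<Rightarrow> ('a, 'e) tvec \<Rightarrow> real) \<Rightarrow> 'e \<Rightarrow> 'e" where
  "form_rep A c \<beta> \<equiv> \<lambda>x. covec_coords A c (cinv c x) (\<beta> (cinv c x))"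

text \<open>Pulling back applies the transposed derivative to the components. The right-hand side
  has the shape of the map \<open>g\<close> in \<open>FD_pullback_antisymmetric\<close>.\<close>

lemma form_rep_pullback:
  assumes A: "smooth_atlas A" and B: "smooth_atlas B" and F: "smooth_map A B F"
    and lin: "\<And>q. q \<in> points B \<Longrightarrow> tangent_linear B q (\<beta> q)"
    and eq: "\<And>q v. q \<in> points A \<Longrightarrow> v \<in> tangent_space A q \<Longrightarrow> \<beta>' q v = \<beta> (F q) (snd (tangent_map A B F (q, v)))"
    and c: "c \<in> A" and d: "d \<in> B" and x: "x \<in> cmap c ` {q \<in> cdom c. F q \<in> cdom d}"
  shows "form_rep A c \<beta>' x = (\<Sum>i\<in>Basis. (form_rep B d \<beta> (crep c d F x) \<bullet> FD (crep c d F) x i) *\<^sub>R i)"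
proof -
  obtain q where q: "q \<in> cdom c" "F q \<in> cdom d" "x = cmap c q" using x by auto
  have inv: "cinv c x = q" "cinv d (crep c d F x) = F q"
    using cinv_cmap[OF A c q(1)] cinv_cmap[OF B d q(2)] q(3) by simp_all
  have qp: "q \<in> points A" by (rule in_points[OF c q(1)])
  have "\<beta>' q (coord_vec A c q i) = covec_coords B d (F q) (\<beta> (F q)) \<bullet> FD (crep c d F) x i" for i
  proof -
    have u: "coord_vec A c q i \<in> tangent_space A q" by (rule coord_vec_in_tangent_space[OF A c q(1)])
    show ?thesis
      using eq[OF qp u] tangent_linear_apply[OF B d q(2) lin[OF in_points[OF d q(2)]] tangent_map_in[OF A B F qp u]]
        tangent_map_rep[OF A F c q(1) d q(2) u] coord_vec_same[OF A c q(1)] q(3) by simp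
  qed
  then show ?thesis using inv by (simp add: covec_coords_def[of A])
qed

text \<open>The left-hand side uses the chart chosen at \<open>p\<close>, the right-hand side any
  chart \<open>d\<close> around \<open>F p\<close>. This asymmetry lets the formula serve twice:
  with the identity for \<open>F\<close> it yields independence of the chart, and with a general
  \<open>F\<close> it then yields naturality.\<close>

lemma exterior_derivative_pullback_rep:
  assumes A: "smooth_atlas A" and B: "smooth_atlas B" and F: "smooth_map A B F"
    and lin: "\<And>q. q \<in> points B \<Longrightarrow> tangent_linear B q (\<beta> q)"
    and eq: "\<And>q v. q \<in> points A \<Longrightarrow> v \<in> tangent_space A q \<Longrightarrow> \<beta>' q v = \<beta> (F q) (snd (tangent_map A B F (q, v)))"
    and p: "p \<in> points A" and v: "v \<in> tangent_space A p" and w: "w \<in> tangent_space A p"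
    and d: "d \<in> B" "F p \<in> cdom d" and diff: "form_rep B d \<beta> differentiable at (cmap d (F p))"
  shows "exterior_derivative A \<beta>' p v w
    = FD (form_rep B d \<beta>) (cmap d (F p)) (snd (tangent_map A B F (p, v)) d) \<bullet> snd (tangent_map A B F (p, w)) d
    - FD (form_rep B d \<beta>) (cmap d (F p)) (snd (tangent_map A B F (p, w)) d) \<bullet> snd (tangent_map A B F (p, v)) d"
proof -
  let ?c = "chart_at A p" let ?f = "crep ?c d F" and ?b = "form_rep B d \<beta>"
  let ?S = "cmap ?c ` {q \<in> cdom ?c. F q \<in> cdom d}"
  note c = chart_at[OF p]
  have x: "cmap ?c p \<in> ?S" using c d by auto
  have fx: "?f (cmap ?c p) = cmap d (F p)" using cinv_cmap[OF A c] by simp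
  have "FD (form_rep A ?c \<beta>') (cmap ?c p)
      = FD (\<lambda>x. \<Sum>i\<in>Basis. (?b (?f x) \<bullet> FD ?f x i) *\<^sub>R i) (cmap ?c p)"
    by (rule FD_cong[OF open_rep_domain[OF F c(1) d(1)] x])
       (rule form_rep_pullback[OF A B F lin eq c(1) d(1)])
  then show ?thesis
    using FD_pullback_antisymmetric[OF open_rep_domain[OF F c(1) d(1)] smooth_on_rep[OF F c(1) d(1)] x,
        of ?b "v ?c" "w ?c"] diff
    unfolding fx tangent_map_rep[OF A F c d v] tangent_map_rep[OF A F c d w]
    by (simp add: exterior_derivative_def Let_def)
qed

lemma exterior_derivative_rep:
  assumes A: "smooth_atlas A" and lin: "\<And>q. q \<in> points A \<Longrightarrow> tangent_linear A q (\<beta> q)"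
    and c: "c \<in> A" "p \<in> cdom c" and v: "v \<in> tangent_space A p" and w: "w \<in> tangent_space A p"
    and diff: "form_rep A c \<beta> differentiable at (cmap c p)"
  shows "exterior_derivative A \<beta> p v w
    = FD (form_rep A c \<beta>) (cmap c p) (v c) \<bullet> w c - FD (form_rep A c \<beta>) (cmap c p) (w c) \<bullet> v c"
proof -
  note p = in_points[OF c]
  have id: "tangent_map A A id (q, u) = (q, u)" if "q \<in> points A" "u \<in> tangent_space A q" for q u
    by (rule tangent_map_id[OF A that]) simp
  show ?thesis
    using exterior_derivative_pullback_rep[OF A A smooth_map_id[OF A] lin _ p v w c(1), where \<beta>' = \<beta>]
      c(2) diff by (simp add: id p v w)
qed

lemma exterior_derivative_pullback:
  assumes A: "smooth_atlas A" and B: "smooth_atlas B" and F: "smooth_map A B F"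
    and lin: "\<And>q. q \<in> points B \<Longrightarrow> tangent_linear B q (\<beta> q)"
    and eq: "\<And>q v. q \<in> points A \<Longrightarrow> v \<in> tangent_space A q \<Longrightarrow> \<beta>' q v = \<beta> (F q) (snd (tangent_map A B F (q, v)))"
    and p: "p \<in> points A" and v: "v \<in> tangent_space A p" and w: "w \<in> tangent_space A p"
    and d: "d \<in> B" "F p \<in> cdom d" and diff: "form_rep B d \<beta> differentiable at (cmap d (F p))"
  shows "exterior_derivative A \<beta>' p v w = exterior_derivative B \<beta> (F p)
    (snd (tangent_map A B F (p, v))) (snd (tangent_map A B F (p, w)))"
  using exterior_derivative_pullback_rep[OF assms]
    exterior_derivative_rep[OF B lin d tangent_map_in[OF A B F p v] tangent_map_in[OF A B F p w] diff]
  by simp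

section \<open>The canonical symplectic form\<close>

lemma points_cotangent_chart:
  assumes "z \<in> points (cotangent_atlas A)"
  obtains c where "c \<in> A" "fst z \<in> cdom c" "z \<in> cdom (cotangent_chart A c)"
    "c = chart_at A (fst z)"
proof (rule that[of "chart_at A (fst z)"])
  show "chart_at A (fst z) \<in> A" "fst z \<in> cdom (chart_at A (fst z))"
    "z \<in> cdom (cotangent_chart A (chart_at A (fst z)))"
    using assms chart_at[of "fst z" A] by (auto simp: points_cotangent_atlas)
qed simp

text \<open>Intrinsic description of the tautological form: the covector acts on the projected
  vector. It removes the chart chosen in the definition and is the form in which sections are shown
  to pull it back to themselves.\<close>

lemma canonical_one_form_eq:
  assumes A: "smooth_atlas A" and z: "z \<in> points (cotangent_atlas A)"
    and \<xi>: "\<xi> \<in> tangent_space (cotangent_atlas A) z"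
  shows "canonical_one_form A z \<xi> = snd z (snd (tangent_map (cotangent_atlas A) A fst (z, \<xi>)))"
proof -
  obtain c where c: "c \<in> A" "fst z \<in> cdom c" "z \<in> cdom (cotangent_chart A c)" "c = chart_at A (fst z)"
    using points_cotangent_chart[OF z] .
  have lin: "tangent_linear A (fst z) (snd z)"
    using c(3) by (auto simp: cotangent_space_iff)
  have "canonical_one_form A z \<xi> = covec_coords A c (fst z) (snd z) \<bullet> fst (\<xi> (cotangent_chart A c))"
    by (simp add: canonical_one_form_def Let_def c(4)[symmetric] euclidean_inner[symmetric])
  then show ?thesis
    using tangent_linear_apply[OF A c(1,2) lin tangent_map_in[OF smooth_atlas_cotangent[OF A] A
          smooth_map_cotangent_proj[OF A] z \<xi>]] cotangent_proj_rep[OF A c(1,3) \<xi>] by simp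
qed

lemma canonical_one_form_rep:
  assumes A: "smooth_atlas A" and c: "c \<in> A" and z: "z \<in> cdom (cotangent_chart A c)"
    and \<xi>: "\<xi> \<in> tangent_space (cotangent_atlas A) z"
  shows "canonical_one_form A z \<xi> = (covec_coords A c (fst z) (snd z), 0) \<bullet> \<xi> (cotangent_chart A c)"
proof -
  have zp: "z \<in> points (cotangent_atlas A)" by (rule in_points[OF cotangent_chart_in[OF c] z])
  have lin: "tangent_linear A (fst z) (snd z)" and fz: "fst z \<in> cdom c"
    using z by (auto simp: cotangent_space_iff)
  show ?thesis
    using canonical_one_form_eq[OF A zp \<xi>] cotangent_proj_rep[OF A c z \<xi>]
      tangent_linear_apply[OF A c fz lin tangent_map_in[OF smooth_atlas_cotangent[OF A] A
          smooth_map_cotangent_proj[OF A] zp \<xi>]]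
    by (simp add: inner_prod_def)
qed

lemma tangent_linear_canonical_one_form:
  assumes A: "smooth_atlas A" and z: "z \<in> points (cotangent_atlas A)"
  shows "tangent_linear (cotangent_atlas A) z (canonical_one_form A z)"
proof -
  obtain c where c: "c \<in> A" "z \<in> cdom (cotangent_chart A c)"
    using points_cotangent_chart[OF z] .
  show ?thesis
    unfolding tangent_linear_def
    using tangent_space_combine[OF smooth_atlas_cotangent[OF A]] canonical_one_form_rep[OF A c]
    by (simp add: inner_add_right)
qed

text \<open>In natural coordinates the components of the form at \<open>(q, p)\<close> are
  \<open>(p, 0)\<close>. They depend linearly on the point, so the derivative is the same linear
  function.\<close>

lemma canonical_form_rep:
  assumes A: "smooth_atlas A" and c: "c \<in> A" and z: "z \<in> cdom (cotangent_chart A c)"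
  shows "form_rep (cotangent_atlas A) (cotangent_chart A c) (canonical_one_form A)
      differentiable at (cmap (cotangent_chart A c) z)"
    and "FD (form_rep (cotangent_atlas A) (cotangent_chart A c) (canonical_one_form A))
      (cmap (cotangent_chart A c) z) u = (snd u, 0)"
proof -
  let ?C = "cotangent_chart A c" let ?U = "cmap ?C ` cdom ?C"
  note B = smooth_atlas_cotangent[OF A] and C = cotangent_chart_in[OF c]
  have U: "open ?U" by (rule open_chart[OF B C])
  have x: "cmap ?C z \<in> ?U" using z by (rule imageI)
  have eq: "(snd x, 0) = form_rep (cotangent_atlas A) ?C (canonical_one_form A) x" if "x \<in> ?U" for x
  proof -
    have z': "cinv ?C x \<in> cdom ?C" using that by (rule inv_into_into)
    have "covec_coords A c (fst (cinv ?C x)) (snd (cinv ?C x)) = snd x"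
      using arg_cong[OF f_inv_into_f[OF that], of snd] by simp
    then show ?thesis
      by (intro covec_coords_inner[OF B C z', symmetric]) (simp only: canonical_one_form_rep[OF A c z'])
  qed
  have d: "((\<lambda>x. (snd x, 0)) has_derivative (\<lambda>x. (snd x, 0))) (at (cmap ?C z))"
    by (intro bounded_linear_imp_has_derivative bounded_linear_Pair bounded_linear_snd bounded_linear_zero)
  show "form_rep (cotangent_atlas A) ?C (canonical_one_form A) differentiable at (cmap ?C z)"
    by (rule differentiable_cong[OF U x eq differentiableI[OF d]])
  show "FD (form_rep (cotangent_atlas A) ?C (canonical_one_form A)) (cmap ?C z) u = (snd u, 0)"
    using fun_cong[OF trans[OF FD_cong[OF U x eq, symmetric] FD_eqI[OF d]], of u] .
qed

text \<open>Natural coordinates are Darboux coordinates: the minus sign in \<omega> = -d\<theta>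
  puts the base component of \<open>\<xi>\<close> into the positive term.\<close>

lemma canonical_two_form_rep:
  assumes A: "smooth_atlas A" and c: "c \<in> A" and z: "z \<in> cdom (cotangent_chart A c)"
    and \<xi>: "\<xi> \<in> tangent_space (cotangent_atlas A) z" and \<eta>: "\<eta> \<in> tangent_space (cotangent_atlas A) z"
  shows "canonical_two_form A z \<xi> \<eta>
    = fst (\<xi> (cotangent_chart A c)) \<bullet> snd (\<eta> (cotangent_chart A c))
    - snd (\<xi> (cotangent_chart A c)) \<bullet> fst (\<eta> (cotangent_chart A c))"
  using exterior_derivative_rep[where \<beta> = "canonical_one_form A", OF smooth_atlas_cotangent[OF A]
      tangent_linear_canonical_one_form[OF A] cotangent_chart_in[OF c] z \<xi> \<eta> canonical_form_rep(1)[OF A c z]]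
  unfolding canonical_form_rep(2)[OF A c z]
  by (simp add: canonical_two_form_def inner_prod_def inner_commute[of _ "snd (\<eta> (cotangent_chart A c))"]
      inner_commute[of _ "fst (\<eta> (cotangent_chart A c))"])

text \<open>Right-hand side of Hamilton's equations: for the derivative of H as \<open>f\<close> it
  is the vector (dH/dp, -dH/dq).\<close>

definition hamilton_vector :: "('e::euclidean_space \<times> 'e \<Rightarrow> real) \<Rightarrow> 'e \<times> 'e" where
  "hamilton_vector f = ((\<Sum>i\<in>Basis. f (0, i) *\<^sub>R i), - (\<Sum>i\<in>Basis. f (i, 0) *\<^sub>R i))"

text \<open>Nondegeneracy of the standard form: the test vectors \<open>(0, i)\<close> and
  \<open>(i, 0)\<close> isolate the components of \<open>x\<close>.\<close>

lemma hamilton_vector_unique: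
  assumes f: "linear f"
  shows "(\<forall>y. fst x \<bullet> snd y - snd x \<bullet> fst y = f y) \<longleftrightarrow> x = hamilton_vector f"
proof
  assume *: "\<forall>y. fst x \<bullet> snd y - snd x \<bullet> fst y = f y"
  have "f (0, i) = fst x \<bullet> i" "f (i, 0) = - (snd x \<bullet> i)" for i
    using *[rule_format, of "(0, i)"] *[rule_format, of "(i, 0)"] by simp_all
  then show "x = hamilton_vector f"
    by (simp add: hamilton_vector_def prod_eq_iff euclidean_representation sum_negf)
next
  assume x: "x = hamilton_vector f"
  show "\<forall>y. fst x \<bullet> snd y - snd x \<bullet> fst y = f y"
  proof
    fix y
    have l: "linear (\<lambda>v. f (0, v))" "linear (\<lambda>v. f (v, 0))"
      using linear_compose[OF _ f, of "\<lambda>v. (0, v)"] linear_compose[OF _ f, of "\<lambda>v. (v, 0)"]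
      by (auto simp: o_def linear_iff)
    have "fst x \<bullet> snd y = f (0, snd y)" "snd x \<bullet> fst y = - f (fst y, 0)"
      unfolding x hamilton_vector_def linear_eq_sum_Basis[OF l(1), of "snd y"]
        linear_eq_sum_Basis[OF l(2), of "fst y"]
      by (simp_all add: inner_sum_left inner_commute[of "snd y"] inner_commute[of "fst y"] mult.commute)
    moreover have "f y = f (0, snd y) + f (fst y, 0)"
      using linear_add[OF f, of "(0, snd y)" "(fst y, 0)"] by simp
    ultimately show "fst x \<bullet> snd y - snd x \<bullet> fst y = f y" by simp
  qed
qed

text \<open>An equivalence at a single point and in an arbitrary chart, so that it yields existence,
  uniqueness and the components of the solution in every chart.\<close>

lemma hamilton_equation_rep:
  assumes A: "smooth_atlas A" and H: "smooth_function (cotangent_atlas A) H"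
    and c: "c \<in> A" and z: "z \<in> cdom (cotangent_chart A c)"
    and \<xi>: "\<xi> \<in> tangent_space (cotangent_atlas A) z"
  shows "(\<forall>\<eta>\<in>tangent_space (cotangent_atlas A) z.
      canonical_two_form A z \<xi> \<eta> = differential (cotangent_atlas A) H z \<eta>) \<longleftrightarrow>
    \<xi> (cotangent_chart A c)
      = hamilton_vector (FD (H \<circ> cinv (cotangent_chart A c)) (cmap (cotangent_chart A c) z))"
proof -
  let ?C = "cotangent_chart A c" and ?B = "cotangent_atlas A"
  let ?f = "FD (H \<circ> cinv ?C) (cmap ?C z)"
  note B = smooth_atlas_cotangent[OF A] and C = cotangent_chart_in[OF c]
  have "smooth_on (H \<circ> cinv ?C) (cmap ?C ` cdom ?C)" using H C unfolding smooth_function_def by blast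
  then have f: "linear ?f"
    by (intro linear_frechet_derivative) (rule smooth_on_differentiable[OF _ imageI[OF z]])
  have "(\<forall>\<eta>\<in>tangent_space ?B z. canonical_two_form A z \<xi> \<eta> = differential ?B H z \<eta>)
      \<longleftrightarrow> (\<forall>\<eta>\<in>tangent_space ?B z. fst (\<xi> ?C) \<bullet> snd (\<eta> ?C) - snd (\<xi> ?C) \<bullet> fst (\<eta> ?C) = ?f (\<eta> ?C))"
    by (intro ball_cong refl) (simp only: canonical_two_form_rep[OF A c z \<xi>] differential_rep[OF B H C z])
  \<comment> \<open>Every pair \<open>y\<close> represents some tangent vector, namely its
    \<open>coord_vec\<close>.\<close>
  also have "\<dots> \<longleftrightarrow> (\<forall>y. fst (\<xi> ?C) \<bullet> snd y - snd (\<xi> ?C) \<bullet> fst y = ?f y)"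
    using coord_vec_in_tangent_space[OF B C z] coord_vec_same[OF B C z] by metis
  finally show ?thesis using hamilton_vector_unique[OF f] by simp
qed

lemma smooth_on_hamilton_vector:
  assumes "open S" "smooth_on f S"
  shows "smooth_on (\<lambda>x. hamilton_vector (FD f x)) S"
proof -
  have 2: "smooth_on (\<lambda>x. - (\<Sum>i\<in>Basis. FD f x (i, 0) *\<^sub>R i)) S"
    by (intro smooth_on_linear_compose[OF bounded_linear_minus[OF bounded_linear_ident]]
        smooth_on_sum smooth_on_scaleR smooth_on_const smooth_on_FD assms)
  show ?thesis
    unfolding hamilton_vector_def
    by (intro smooth_on_Pair 2 smooth_on_sum smooth_on_scaleR smooth_on_const smooth_on_FD assms)
qed

text \<open>This gives the definite description \<open>hamiltonian_vector_field\<close> its meaning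
  on the cotangent bundle; the tangent bundle inherits it by transport.\<close>

lemma canonical_vector_field_ex1:
  assumes A: "smooth_atlas A" and H: "smooth_function (cotangent_atlas A) H"
  shows "\<exists>!Z. vector_field (cotangent_atlas A) Z \<and>
    (\<forall>z\<in>points (cotangent_atlas A). \<forall>\<eta>\<in>tangent_space (cotangent_atlas A) z.
      canonical_two_form A z (snd (Z z)) \<eta> = differential (cotangent_atlas A) H z \<eta>)"
    (is "\<exists>!Z. ?P Z")
proof (rule ex_ex1I)
  let ?B = "cotangent_atlas A"
  note B = smooth_atlas_cotangent[OF A]
  define C where "C z = cotangent_chart A (chart_at A (fst z))" for z :: "'a \<times> ('a, 'b) covec"
  define \<zeta> where "\<zeta> z = coord_vec ?B (C z) z (hamilton_vector (FD (H \<circ> cinv (C z)) (cmap (C z) z)))" for z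
  define Z where "Z = (\<lambda>z\<in>points ?B. (z, \<zeta> z))"
  have \<zeta>: "\<zeta> z \<in> tangent_space ?B z" "\<forall>\<eta>\<in>tangent_space ?B z. canonical_two_form A z (\<zeta> z) \<eta> = differential ?B H z \<eta>"
    if z: "z \<in> points ?B" for z
  proof -
    have c: "chart_at A (fst z) \<in> A" "z \<in> cdom (C z)" "C z \<in> ?B"
      using points_cotangent_chart[OF z] cotangent_chart_in unfolding C_def by metis+
    show T: "\<zeta> z \<in> tangent_space ?B z"
      unfolding \<zeta>_def by (rule coord_vec_in_tangent_space[OF B c(3,2)])
    have "\<zeta> z (C z) = hamilton_vector (FD (H \<circ> cinv (C z)) (cmap (C z) z))"
      unfolding \<zeta>_def by (rule coord_vec_same[OF B c(3,2)])
    then show "\<forall>\<eta>\<in>tangent_space ?B z. canonical_two_form A z (\<zeta> z) \<eta> = differential ?B H z \<eta>"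
      using hamilton_equation_rep[OF A H c(1) _ T] c(2) unfolding C_def by blast
  qed
  have "vector_field ?B Z"
  proof (rule vector_fieldI[OF B])
    fix K assume K: "K \<in> ?B"
    then obtain c where c: "c \<in> A" "K = cotangent_chart A c" by (auto simp: cotangent_atlas_def)
    let ?U = "cmap K ` cdom K"
    have U: "open ?U" by (rule open_chart[OF B K])
    have f: "smooth_on (H \<circ> cinv K) ?U" using H K by (simp add: smooth_function_def)
    show "smooth_on (\<lambda>x. snd (Z (cinv K x)) K) ?U"
    proof (rule smooth_on_cong[OF U _ smooth_on_hamilton_vector[OF U f]])
      fix x assume x: "x \<in> ?U"
      have z: "cinv K x \<in> cdom K" using x by (rule inv_into_into)
      have zp: "cinv K x \<in> points ?B" by (rule in_points[OF K z])
      \<comment> \<open>\<open>\<zeta>\<close> was built in the chart chosen at each point, which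
        can jump from point to point. Since it solves an equation free of charts, its components in
        the fixed chart \<open>K\<close> are given throughout by one smooth expression.\<close>
      have "\<zeta> (cinv K x) K = hamilton_vector (FD (H \<circ> cinv K) (cmap K (cinv K x)))"
        using hamilton_equation_rep[OF A H c(1) _ \<zeta>(1)[OF zp]] z \<zeta>(2)[OF zp] unfolding c(2) by blast
      then show "hamilton_vector (FD (H \<circ> cinv K) x) = snd (Z (cinv K x)) K"
        using zp by (simp add: Z_def f_inv_into_f[OF x])
    qed
  qed (simp_all add: Z_def \<zeta>(1))
  then show "\<exists>Z. ?P Z" using \<zeta>(2) by (intro exI[of _ Z]) (auto simp: Z_def)
next
  let ?B = "cotangent_atlas A"
  note B = smooth_atlas_cotangent[OF A]
  fix Y Z assume Y: "?P Y" and Z: "?P Z"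
  show "Y = Z"
  proof (rule extensionalityI[of _ "points ?B"])
    fix z assume z: "z \<in> points ?B"
    obtain c where c: "c \<in> A" "z \<in> cdom (cotangent_chart A c)"
      using points_cotangent_chart[OF z] .
    note YZ = vector_fieldD[OF conjunct1[OF Y] z] vector_fieldD[OF conjunct1[OF Z] z]
    have "snd (Y z) = snd (Z z)"
    proof (rule tangent_space_eqI[OF cotangent_chart_in[OF c(1)] c(2) YZ(2,5)])
      show "snd (Y z) (cotangent_chart A c) = snd (Z z) (cotangent_chart A c)"
        using hamilton_equation_rep[OF A H c YZ(2)] hamilton_equation_rep[OF A H c YZ(5)] Y Z z
        by metis
    qed
    then show "Y z = Z z" using YZ(1,4) by metis
  qed (use Y Z in \<open>auto simp: vector_field_def\<close>)
qed

lemma canonical_vector_field: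
  assumes "smooth_atlas A" "smooth_function (cotangent_atlas A) H"
  shows "vector_field (cotangent_atlas A) (canonical_vector_field A H)"
    and "\<And>z \<eta>. z \<in> points (cotangent_atlas A) \<Longrightarrow> \<eta> \<in> tangent_space (cotangent_atlas A) z \<Longrightarrow>
      canonical_two_form A z (snd (canonical_vector_field A H z)) \<eta> = differential (cotangent_atlas A) H z \<eta>"
  using theI'[OF canonical_vector_field_ex1[OF assms]]
  unfolding canonical_vector_field_def hamiltonian_vector_field_def by blast+

section \<open>Transport of Hamiltonian vector fields\<close>

lemma tangent_map_fst_snd: "tangent_map A B F (p, v) = (F p, snd (tangent_map A B F (p, v)))"
  by (rule prod_eqI) auto

lemma tangent_map_inverse:
  assumes A: "smooth_atlas A" and B: "smooth_atlas B"
    and F: "smooth_map A B F" and G: "smooth_map B A G" and GF: "\<And>p. p \<in> points A \<Longrightarrow> G (F p) = p"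
    and p: "p \<in> points A" and v: "v \<in> tangent_space A p"
  shows "tangent_map B A G (tangent_map A B F (p, v)) = (p, v)"
  using tangent_map_comp[OF A B A F G p v] tangent_map_id[OF A p v, of "G \<circ> F"] GF by simp

lemma vector_field_push:
  assumes A: "smooth_atlas A" and B: "smooth_atlas B"
    and F: "smooth_map A B F" and G: "smooth_map B A G" and FG: "\<And>q. q \<in> points B \<Longrightarrow> F (G q) = q"
    and X: "vector_field A X"
  shows "vector_field B (\<lambda>q\<in>points B. tangent_map A B F (X (G q)))"
proof -
  note TA = smooth_atlas_tangent[OF A] and TB = smooth_atlas_tangent[OF B]
  have X': "smooth_map A (tangent_atlas A) X" using X by (simp add: vector_field_def)
  have sm: "smooth_map B (tangent_atlas B) (tangent_map A B F \<circ> (X \<circ> G))"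
    by (rule smooth_map_comp[OF B TA TB smooth_map_comp[OF B A TA G X'] smooth_map_tangent_map[OF A B F]])
  have "fst (X (G q)) = G q" if "q \<in> points B" for q
    using X smooth_map_points[OF G that] by (simp add: vector_field_def)
  then show ?thesis
    unfolding vector_field_def using smooth_map_cong[OF B sm] FG by simp
qed

text \<open>Existence on \<open>A\<close> comes from carrying the solution on \<open>B\<close> back
  along \<open>G\<close>; uniqueness on \<open>A\<close> from pushing any solution forward along
  \<open>F\<close> and using uniqueness on \<open>B\<close>.\<close>

lemma hamiltonian_vector_field_pullback:
  assumes A: "smooth_atlas A" and B: "smooth_atlas B"
    and F: "smooth_map A B F" and G: "smooth_map B A G"
    and GF: "\<And>p. p \<in> points A \<Longrightarrow> G (F p) = p" and FG: "\<And>q. q \<in> points B \<Longrightarrow> F (G q) = q"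
    and f: "smooth_function B f" and f': "\<And>p. p \<in> points A \<Longrightarrow> f' p = f (F p)"
    and \<omega>': "\<And>p v w. p \<in> points A \<Longrightarrow> v \<in> tangent_space A p \<Longrightarrow> w \<in> tangent_space A p \<Longrightarrow>
      \<omega>' p v w = \<omega> (F p) (snd (tangent_map A B F (p, v))) (snd (tangent_map A B F (p, w)))"
    and ex1: "\<exists>!Z. vector_field B Z \<and> (\<forall>q\<in>points B. \<forall>w\<in>tangent_space B q. \<omega> q (snd (Z q)) w = differential B f q w)"
  shows "vector_field A (hamiltonian_vector_field A \<omega>' f')"
    and "\<And>p. p \<in> points A \<Longrightarrow>
      hamiltonian_vector_field B \<omega> f (F p) = tangent_map A B F (hamiltonian_vector_field A \<omega>' f' p)"
proof -
  define PA where "PA X \<longleftrightarrow> vector_field A X \<and> (\<forall>p\<in>points A. \<forall>w\<in>tangent_space A p.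
    \<omega>' p (snd (X p)) w = differential A f' p w)" for X
  define PB where "PB Z \<longleftrightarrow> vector_field B Z \<and> (\<forall>q\<in>points B. \<forall>w\<in>tangent_space B q.
    \<omega> q (snd (Z q)) w = differential B f q w)" for Z
  define Z where "Z = hamiltonian_vector_field B \<omega> f"
  have Z: "PB Z" and Zuniq: "\<And>Y. PB Y \<Longrightarrow> Y = Z"
    using theI'[OF ex1] ex1 unfolding Z_def hamiltonian_vector_field_def PB_def by blast+
  have df: "differential A f' p w = differential B f (F p) (snd (tangent_map A B F (p, w)))"
    if p: "p \<in> points A" and w: "w \<in> tangent_space A p" for p w
    using differential_comp[OF A B F f p w] differential_cong[OF A p, of f' "f \<circ> F" w] f' by simp
  define \<Gamma> where "\<Gamma> = (\<lambda>p\<in>points A. tangent_map B A G (Z (F p)))"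
  have ZF: "Z (F p) = (F p, snd (Z (F p)))" "snd (Z (F p)) \<in> tangent_space B (F p)" if "p \<in> points A" for p
    using Z vector_fieldD[OF _ smooth_map_points[OF F that]] unfolding PB_def by blast+
  have \<Gamma>rel: "tangent_map A B F (\<Gamma> p) = Z (F p)" if p: "p \<in> points A" for p
  proof -
    have "tangent_map A B F (tangent_map B A G (F p, snd (Z (F p)))) = (F p, snd (Z (F p)))"
      by (rule tangent_map_inverse[OF B A G F FG smooth_map_points[OF F p] ZF(2)[OF p]])
    then show ?thesis using ZF(1)[OF p] p by (simp add: \<Gamma>_def)
  qed
  have \<Gamma>field: "vector_field A \<Gamma>"
    unfolding \<Gamma>_def using Z by (intro vector_field_push[OF B A G F GF]) (auto simp: PB_def)
  have "PA \<Gamma>"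
    unfolding PA_def
  proof (intro conjI ballI \<Gamma>field)
    fix p w assume p: "p \<in> points A" and w: "w \<in> tangent_space A p"
    have "\<omega>' p (snd (\<Gamma> p)) w = \<omega> (F p) (snd (Z (F p))) (snd (tangent_map A B F (p, w)))"
      using \<omega>'[OF p vector_fieldD(2)[OF \<Gamma>field p] w] \<Gamma>rel[OF p] vector_fieldD(1)[OF \<Gamma>field p] by simp
    also have "\<dots> = differential B f (F p) (snd (tangent_map A B F (p, w)))"
      using Z smooth_map_points[OF F p] tangent_map_in[OF A B F p w] unfolding PB_def by blast
    finally show "\<omega>' p (snd (\<Gamma> p)) w = differential A f' p w" by (simp add: df[OF p w])
  qed
  moreover have "Y = \<Gamma>" if Y: "PA Y" for Y
  proof -
    have Yfield: "vector_field A Y" using Y by (simp add: PA_def)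
    define Y' where "Y' = (\<lambda>q\<in>points B. tangent_map A B F (Y (G q)))"
    have "PB Y'"
      unfolding PB_def
    proof (intro conjI ballI)
      show "vector_field B Y'" unfolding Y'_def by (rule vector_field_push[OF A B F G FG Yfield])
      fix q w assume q: "q \<in> points B" and w: "w \<in> tangent_space B q"
      note Gq = smooth_map_points[OF G q]
      \<comment> \<open>The tangent map of \<open>F\<close> sends \<open>?u\<close> to
        \<open>w\<close>, so the equation for \<open>Y'\<close> tested on an arbitrary
        \<open>w\<close> is the equation for \<open>Y\<close> tested on \<open>?u\<close>.\<close>
      let ?u = "snd (tangent_map B A G (q, w))"
      have u: "?u \<in> tangent_space A (G q)" by (rule tangent_map_in[OF B A G q w])
      have Fu: "snd (tangent_map A B F (G q, ?u)) = w"
        using tangent_map_inverse[OF B A G F FG q w] tangent_map_fst_snd[of B A G q w] by simp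
      have "\<omega> q (snd (Y' q)) w
          = \<omega> (F (G q)) (snd (tangent_map A B F (G q, snd (Y (G q))))) (snd (tangent_map A B F (G q, ?u)))"
        using vector_fieldD(1)[OF Yfield Gq] Fu FG[OF q] q by (simp add: Y'_def)
      also have "\<dots> = differential A f' (G q) ?u"
        using \<omega>'[OF Gq vector_fieldD(2)[OF Yfield Gq] u] Y Gq u unfolding PA_def by metis
      also have "\<dots> = differential B f q w" using df[OF Gq u] Fu FG[OF q] by simp
      finally show "\<omega> q (snd (Y' q)) w = differential B f q w" .
    qed
    then have Y'Z: "Y' = Z" by (rule Zuniq)
    show "Y = \<Gamma>"
    proof (rule extensionalityI[of _ "points A"])
      fix p assume p: "p \<in> points A"
      have "Z (F p) = tangent_map A B F (p, snd (Y p))"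
        using Y'Z smooth_map_points[OF F p] GF[OF p] vector_fieldD(1)[OF Yfield p] by (auto simp: Y'_def)
      then show "Y p = \<Gamma> p"
        using tangent_map_inverse[OF A B F G GF p vector_fieldD(2)[OF Yfield p]]
          vector_fieldD(1)[OF Yfield p] p by (simp add: \<Gamma>_def)
    qed (use Yfield in \<open>auto simp: vector_field_def \<Gamma>_def\<close>)
  qed
  ultimately have "hamiltonian_vector_field A \<omega>' f' = \<Gamma>"
    unfolding hamiltonian_vector_field_def PA_def[symmetric] by (rule the_equality)
  then show "vector_field A (hamiltonian_vector_field A \<omega>' f')"
    "\<And>p. p \<in> points A \<Longrightarrow>
      hamiltonian_vector_field B \<omega> f (F p) = tangent_map A B F (hamiltonian_vector_field A \<omega>' f' p)"
    using \<Gamma>field \<Gamma>rel by (simp_all add: Z_def)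
qed

section \<open>The Legendre map\<close>

locale hyper_regular_lagrangian =
  fixes A :: "('a, 'e::euclidean_space) chart set" and L :: "'a \<times> ('a, 'e) tvec \<Rightarrow> real"
  assumes atlas: "smooth_atlas A"
    and smooth_L: "smooth_function (tangent_atlas A) L"
    and regular: "hyper_regular A L"
begin

abbreviation "TA \<equiv> tangent_atlas A"
abbreviation "CA \<equiv> cotangent_atlas A"
abbreviation "FL \<equiv> legendre_map A L"
abbreviation "GL \<equiv> inv_into (points TA) FL"
abbreviation "H \<equiv> hamiltonian A L"
abbreviation "Z \<equiv> canonical_vector_field A H"
abbreviation "\<Gamma> \<equiv> lagrangian_vector_field A L"

lemmas TA = smooth_atlas_tangent[OF atlas]
lemmas CA = smooth_atlas_cotangent[OF atlas]

lemma smooth_FL: "smooth_map TA CA FL" and smooth_GL: "smooth_map CA TA GL"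
  and bij_FL: "bij_betw FL (points TA) (points CA)"
  using regular by (simp_all add: hyper_regular_def diffeomorphism_def)

lemma GL_FL: "w \<in> points TA \<Longrightarrow> GL (FL w) = w"
  by (rule bij_betw_inv_into_left[OF bij_FL])

lemma FL_GL: "z \<in> points CA \<Longrightarrow> FL (GL z) = z"
  by (rule bij_betw_inv_into_right[OF bij_FL])

lemma fst_FL [simp]: "fst (FL w) = fst w"
  by (simp add: legendre_map_def case_prod_beta)

text \<open>\<open>FL\<close> keeps the base point, so a single chart \<open>c\<close> of the base
  provides natural charts on both sides, and the representation of \<open>FL\<close> in them is
  defined on the whole chart.\<close>

lemma FL_in_chart:
  assumes "c \<in> A" "w \<in> cdom (tangent_chart A c)"
  shows "FL w \<in> cdom (cotangent_chart A c)"
  using smooth_map_points[OF smooth_FL in_points[OF tangent_chart_in[OF assms(1)] assms(2)]] assms(2)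
    fst_FL[of w]
  by (cases "FL w") (auto simp: points_cotangent_atlas simp del: fst_FL)

lemma tangent_linear_FL:
  assumes "w \<in> points TA"
  shows "tangent_linear A (fst w) (snd (FL w))"
  using smooth_map_points[OF smooth_FL assms]
  by (cases "FL w") (use fst_FL[of w] in \<open>auto simp: points_cotangent_atlas cotangent_space_iff\<close>)

lemma points_tangent_chart:
  assumes "w \<in> points TA"
  obtains c where "c \<in> A" "fst w \<in> cdom c" "w \<in> cdom (tangent_chart A c)" "c = chart_at A (fst w)"
proof (rule that[of "chart_at A (fst w)"])
  show "chart_at A (fst w) \<in> A" "fst w \<in> cdom (chart_at A (fst w))"
    "w \<in> cdom (tangent_chart A (chart_at A (fst w)))"
    using assms chart_at[of "fst w" A] by (auto simp: points_tangent_atlas)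
qed simp

section \<open>Fibre derivative and energy in natural coordinates\<close>

lemma L_rep_differentiable:
  assumes "c \<in> A" "w \<in> cdom (tangent_chart A c)"
  shows "(L \<circ> cinv (tangent_chart A c)) differentiable at (cmap (tangent_chart A c) w)"
proof (rule smooth_on_differentiable)
  show "smooth_on (L \<circ> cinv (tangent_chart A c))
      (cmap (tangent_chart A c) ` cdom (tangent_chart A c))"
    using smooth_L tangent_chart_in[OF assms(1)] unfolding smooth_function_def by blast
qed (rule imageI[OF assms(2)])

text \<open>Tangent vectors are added by components, so the line in the fibre used by
  \<open>legendre_map\<close> is a straight line with direction \<open>(0, u c)\<close> in the
  natural chart, and its derivative is a directional derivative.\<close>

lemma FL_apply:
  assumes c: "c \<in> A" and w: "w \<in> cdom (tangent_chart A c)" and u: "u \<in> tangent_space A (fst w)"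
  shows "snd (FL w) u = FD (L \<circ> cinv (tangent_chart A c)) (cmap (tangent_chart A c) w) (0, u c)"
proof -
  let ?C = "tangent_chart A c"
  obtain p v where pv: "w = (p, v)" by (cases w)
  have p: "p \<in> cdom c" and v: "v \<in> tangent_space A p" and u': "u \<in> tangent_space A p"
    using w u pv by auto
  have eq: "L (p, \<lambda>c. v c + t *\<^sub>R u c) = (L \<circ> cinv ?C) (cmap ?C w + t *\<^sub>R (0, u c))" for t
  proof -
    have "(p, \<lambda>c. v c + t *\<^sub>R u c) \<in> cdom ?C"
      using p tangent_space_combine[OF atlas v u', of 1 t] by simp
    from cinv_cmap[OF TA tangent_chart_in[OF c] this] show ?thesis by (simp add: pv)
  qed
  have "DERIV (\<lambda>t. (L \<circ> cinv ?C) (cmap ?C w + t *\<^sub>R (0, u c))) 0 :>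
      FD (L \<circ> cinv ?C) (cmap ?C w + 0 *\<^sub>R (0, u c)) (0, u c)"
    by (rule FD_line[where f = "L \<circ> cinv ?C"]) (use L_rep_differentiable[OF c w] in simp)
  then have "DERIV (\<lambda>t. L (p, \<lambda>c. v c + t *\<^sub>R u c)) 0 :> FD (L \<circ> cinv ?C) (cmap ?C w) (0, u c)"
    by (simp only: eq) simp
  then show ?thesis using u' by (simp add: legendre_map_def pv DERIV_imp_deriv)
qed

lemma covec_coords_FL:
  assumes c: "c \<in> A" and w: "w \<in> cdom (tangent_chart A c)"
  shows "covec_coords A c (fst w) (snd (FL w)) \<bullet> x
    = FD (L \<circ> cinv (tangent_chart A c)) (cmap (tangent_chart A c) w) (0, x)"
proof -
  have p: "fst w \<in> cdom c" using w by auto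
  have u: "coord_vec A c (fst w) x \<in> tangent_space A (fst w)"
    by (rule coord_vec_in_tangent_space[OF atlas c p])
  show ?thesis
    using FL_apply[OF c w u] coord_vec_same[OF atlas c p, of x]
      tangent_linear_apply[OF atlas c p tangent_linear_FL[OF in_points[OF tangent_chart_in[OF c] w]] u]
    by simp
qed

text \<open>The Liouville derivative of \<open>L\<close> at \<open>w\<close> is the pairing of
  \<open>FL w\<close> with \<open>w\<close> itself, which involves no chart. The formula p . v - L
  therefore holds in every chart, not just in the one chosen by the definition.\<close>

lemma energy_rep:
  assumes c: "c \<in> A" and w: "w \<in> cdom (tangent_chart A c)"
  shows "energy A L w = covec_coords A c (fst w) (snd (FL w)) \<bullet> snd w c - L w"
proof -
  have wp: "w \<in> points TA" by (rule in_points[OF tangent_chart_in[OF c] w])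
  obtain d where d: "d \<in> A" "fst w \<in> cdom d" "w \<in> cdom (tangent_chart A d)" "d = chart_at A (fst w)"
    using points_tangent_chart[OF wp] .
  have v: "snd w \<in> tangent_space A (fst w)" and p: "fst w \<in> cdom c" using w by auto
  let ?D = "tangent_chart A d"
  let ?\<Delta> = "coord_vec TA ?D w (0, snd w d)"
  note D = tangent_chart_in[OF d(1)]
  have "energy A L w = differential TA L w ?\<Delta> - L w"
    by (simp add: energy_def liouville_field_def Let_def d(4)[symmetric])
  also have "differential TA L w ?\<Delta> = FD (L \<circ> cinv ?D) (cmap ?D w) (0, snd w d)"
    using differential_rep[OF TA smooth_L D d(3) coord_vec_in_tangent_space[OF TA D d(3)]]
    by (simp only: coord_vec_same[OF TA D d(3)])
  also have "\<dots> = snd (FL w) (snd w)" using FL_apply[OF d(1,3) v] by simp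
  also have "\<dots> = covec_coords A c (fst w) (snd (FL w)) \<bullet> snd w c"
    by (rule tangent_linear_apply[OF atlas c p tangent_linear_FL[OF wp] v])
  finally show ?thesis .
qed

lemma smooth_on_FL_rep:
  assumes c: "c \<in> A"
  shows "smooth_on (crep (tangent_chart A c) (cotangent_chart A c) FL)
    (cmap (tangent_chart A c) ` cdom (tangent_chart A c))"
proof -
  have "{w \<in> cdom (tangent_chart A c). FL w \<in> cdom (cotangent_chart A c)} = cdom (tangent_chart A c)"
    using FL_in_chart[OF c] by blast
  then show ?thesis
    using smooth_on_rep[OF smooth_FL tangent_chart_in[OF c] cotangent_chart_in[OF c]] by simp
qed

lemma energy_local:
  assumes c: "c \<in> A" and x: "x \<in> cmap (tangent_chart A c) ` cdom (tangent_chart A c)"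
  shows "(energy A L \<circ> cinv (tangent_chart A c)) x
    = snd (crep (tangent_chart A c) (cotangent_chart A c) FL x) \<bullet> snd x - (L \<circ> cinv (tangent_chart A c)) x"
proof -
  have "snd x = snd (cinv (tangent_chart A c) x) c"
    using arg_cong[OF f_inv_into_f[OF x], of snd] by simp
  then show ?thesis using energy_rep[OF c inv_into_into[OF x]] by simp
qed

text \<open>The momentum in the local formula is a component of the representation of
  \<open>FL\<close>, so its smoothness comes from that of \<open>FL\<close>.\<close>

lemma smooth_energy: "smooth_function TA (energy A L)"
  unfolding smooth_function_def
proof
  fix C assume C: "C \<in> TA"
  then obtain c where c: "c \<in> A" "C = tangent_chart A c" by (auto simp: tangent_atlas_def)
  let ?U = "cmap C ` cdom C" and ?g = "crep C (cotangent_chart A c) FL"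
  have U: "open ?U" by (rule open_chart[OF TA C])
  have g: "smooth_on ?g ?U" using smooth_on_FL_rep[OF c(1)] c(2) by simp
  have l: "smooth_on (L \<circ> cinv C) ?U" using smooth_L C unfolding smooth_function_def by blast
  have "smooth_on (\<lambda>x. snd (?g x) \<bullet> snd x + - (L \<circ> cinv C) x) ?U"
    by (intro smooth_on_add[OF U] smooth_on_inner[OF U] smooth_on_snd[OF U g]
        smooth_on_linear[OF bounded_linear_snd]
        smooth_on_linear_compose[OF bounded_linear_minus[OF bounded_linear_ident] U l])
  then show "smooth_on (energy A L \<circ> cinv C) ?U"
    by (rule smooth_on_cong[OF U, rotated]) (simp only: c(2) energy_local[OF c(1)] diff_conv_add_uminus)
qed

lemma smooth_H: "smooth_function CA H"
  unfolding hamiltonian_def by (rule smooth_function_comp[OF CA TA smooth_GL smooth_energy])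

lemma H_FL: "w \<in> points TA \<Longrightarrow> H (FL w) = energy A L w"
  by (simp add: hamiltonian_def GL_FL)

section \<open>Pullback of the canonical forms and relatedness of the two fields\<close>

lemma proj_FL:
  assumes w: "w \<in> points TA" and \<xi>: "\<xi> \<in> tangent_space TA w"
  shows "tangent_map CA A fst (tangent_map TA CA FL (w, \<xi>)) = tangent_map TA A fst (w, \<xi>)"
  using tangent_map_comp[OF TA CA atlas smooth_FL smooth_map_cotangent_proj[OF atlas] w \<xi>]
    tangent_map_cong[OF TA w, of "fst \<circ> FL" fst A \<xi>] by simp

lemma fst_tangent_map_FL:
  assumes c: "c \<in> A" and w: "w \<in> cdom (tangent_chart A c)" and \<xi>: "\<xi> \<in> tangent_space TA w"
  shows "fst (snd (tangent_map TA CA FL (w, \<xi>)) (cotangent_chart A c)) = fst (\<xi> (tangent_chart A c))"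
proof -
  have wp: "w \<in> points TA" by (rule in_points[OF tangent_chart_in[OF c] w])
  show ?thesis
    using proj_FL[OF wp \<xi>] tangent_proj_rep[OF atlas c w \<xi>]
      cotangent_proj_rep[OF atlas c FL_in_chart[OF c w] tangent_map_in[OF TA CA smooth_FL wp \<xi>]]
      tangent_map_fst_snd[of TA CA FL w \<xi>] by simp
qed

text \<open>Both forms see only the base component of a vector, which the tangent map of
  \<open>FL\<close> leaves unchanged; their coefficients agree because those of \<theta>_L are the
  momentum of \<open>FL w\<close>.\<close>

lemma lagrange_one_form_pullback:
  assumes w: "w \<in> points TA" and \<xi>: "\<xi> \<in> tangent_space TA w"
  shows "lagrange_one_form A L w \<xi> = canonical_one_form A (FL w) (snd (tangent_map TA CA FL (w, \<xi>)))"
proof -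
  obtain c where c: "c \<in> A" "fst w \<in> cdom c" "w \<in> cdom (tangent_chart A c)" "c = chart_at A (fst w)"
    using points_tangent_chart[OF w] .
  let ?C = "tangent_chart A c" and ?q = "cmap c (fst w)" and ?v = "snd w c"
  let ?\<pi> = "covec_coords A c (fst w) (snd (FL w))"
  \<comment> \<open>The definition of \<theta>_L freezes the base coordinates and differentiates in
    \<open>u\<close>. Composition with the inclusion of the fibre turns this into a derivative of
    the chart representation in the direction \<open>(0, i)\<close>.\<close>
  have "FD (\<lambda>u. L (cinv ?C (?q, u))) ?v i = ?\<pi> \<bullet> i" for i
  proof -
    have d: "((\<lambda>u. (?q, u)) has_derivative (\<lambda>u. (0, u))) (at ?v)"
      by (intro derivative_eq_intros) auto
    have "((\<lambda>u. (L \<circ> cinv ?C) (?q, u)) has_derivative (\<lambda>u. FD (L \<circ> cinv ?C) (?q, ?v) (0, u))) (at ?v)"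
      by (rule has_derivative_compose[where g = "L \<circ> cinv ?C", OF d FD_has_derivative])
         (use L_rep_differentiable[OF c(1,3)] in \<open>simp add: o_def\<close>)
    from FD_eqI[OF this] show ?thesis using covec_coords_FL[OF c(1,3), of i] by simp
  qed
  then have "lagrange_one_form A L w \<xi> = (\<Sum>i\<in>Basis. (?\<pi> \<bullet> i) * (fst (\<xi> ?C) \<bullet> i))"
    by (simp add: lagrange_one_form_def Let_def c(4)[symmetric])
  also have "\<dots> = ?\<pi> \<bullet> fst (\<xi> ?C)" by (simp add: euclidean_inner[symmetric])
  finally show ?thesis
    using canonical_one_form_rep[OF atlas c(1) FL_in_chart[OF c(1,3)] tangent_map_in[OF TA CA smooth_FL w \<xi>]]
      fst_tangent_map_FL[OF c(1,3) \<xi>] by (simp add: inner_prod_def)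
qed

lemma lagrange_two_form_pullback:
  assumes w: "w \<in> points TA" and "\<xi> \<in> tangent_space TA w" "\<eta> \<in> tangent_space TA w"
  shows "lagrange_two_form A L w \<xi> \<eta> = canonical_two_form A (FL w)
    (snd (tangent_map TA CA FL (w, \<xi>))) (snd (tangent_map TA CA FL (w, \<eta>)))"
proof -
  obtain c where c: "c \<in> A" "w \<in> cdom (tangent_chart A c)"
    using points_tangent_chart[OF w] .
  note d = cotangent_chart_in[OF c(1)] FL_in_chart[OF c]
  show ?thesis
    unfolding lagrange_two_form_def canonical_two_form_def
    by (subst exterior_derivative_pullback[where \<beta> = "canonical_one_form A", OF TA CA smooth_FL
          tangent_linear_canonical_one_form[OF atlas] lagrange_one_form_pullback assms d
          canonical_form_rep(1)[OF atlas c(1) d(2)]]) auto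
qed

lemma \<Gamma>_vector_field: "vector_field TA \<Gamma>"
  and Z_FL: "w \<in> points TA \<Longrightarrow> Z (FL w) = tangent_map TA CA FL (\<Gamma> w)"
  using hamiltonian_vector_field_pullback[OF TA CA smooth_FL smooth_GL GL_FL FL_GL smooth_H H_FL[symmetric]
      lagrange_two_form_pullback canonical_vector_field_ex1[OF atlas smooth_H]]
  unfolding lagrangian_vector_field_def canonical_vector_field_def by blast+

lemmas Z_vector_field = canonical_vector_field(1)[OF atlas smooth_H]
lemmas Z_equation = canonical_vector_field(2)[OF atlas smooth_H]

lemma \<Gamma>_GL:
  assumes z: "z \<in> points CA"
  shows "\<Gamma> (GL z) = tangent_map CA TA GL (Z z)"
proof -
  note w = smooth_map_points[OF smooth_GL z]
  show ?thesis
    using tangent_map_inverse[OF TA CA smooth_FL smooth_GL GL_FL w vector_fieldD(2)[OF \<Gamma>_vector_field w]]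
      Z_FL[OF w] FL_GL[OF z] vector_fieldD(1)[OF \<Gamma>_vector_field w] by simp
qed

text \<open>The velocity \<open>\<partial>H/\<partial>p\<close> of the base point recovers \<open>v\<close> from \<open>p = \<partial>L/\<partial>v\<close>: differentiating
  \<open>H(q, \<partial>L/\<partial>v) = v \<cdot> \<partial>L/\<partial>v - L\<close> along the fibre in a direction that changes \<open>p\<close> by \<open>\<pi>\<close>
  gives \<open>v \<cdot> \<pi>\<close>.\<close>

lemma proj_Z_FL:
  assumes w: "w \<in> points TA"
  shows "tangent_map CA A fst (Z (FL w)) = w"
proof -
  obtain c where c: "c \<in> A" "fst w \<in> cdom c" "w \<in> cdom (tangent_chart A c)"
    using points_tangent_chart[OF w] .
  let ?C = "tangent_chart A c" and ?K = "cotangent_chart A c"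
  let ?x = "cmap ?C w" and ?g = "crep ?C ?K FL" and ?l = "L \<circ> cinv ?C" and ?\<zeta> = "snd (Z (FL w))"
  note C = tangent_chart_in[OF c(1)] and K = cotangent_chart_in[OF c(1)]
  note z = FL_in_chart[OF c(1,3)]
  note zp = smooth_map_points[OF smooth_FL w]
  note \<zeta> = vector_fieldD[OF Z_vector_field zp]
  have inv: "cinv ?C ?x = w" by (rule cinv_cmap[OF TA C c(3)])
  have "fst (?\<zeta> ?K) \<bullet> \<pi> = snd w c \<bullet> \<pi>" for \<pi>
  proof -
    \<comment> \<open>\<open>?\<eta>\<close> is the vertical vector at \<open>FL w\<close> that
      changes the momentum by \<open>\<pi>\<close>, so its pairing with \<open>?\<zeta>\<close> sees
      only the base component of \<open>?\<zeta>\<close>. \<open>?\<xi>\<close> is its preimage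
      under the tangent map of \<open>FL\<close>.\<close>
    let ?\<eta> = "coord_vec CA ?K (FL w) (0, \<pi>)" let ?\<xi> = "snd (tangent_map CA TA GL (FL w, ?\<eta>))"
    have \<eta>: "?\<eta> \<in> tangent_space CA (FL w)" by (rule coord_vec_in_tangent_space[OF CA K z])
    have \<eta>K: "?\<eta> ?K = (0, \<pi>)" by (rule coord_vec_same[OF CA K z])
    have \<xi>: "?\<xi> \<in> tangent_space TA w"
      using tangent_map_in[OF CA TA smooth_GL zp \<eta>] GL_FL[OF w] by simp
    have FL\<xi>: "snd (tangent_map TA CA FL (w, ?\<xi>)) = ?\<eta>"
      using tangent_map_inverse[OF CA TA smooth_GL smooth_FL FL_GL zp \<eta>]
        tangent_map_fst_snd[of CA TA GL "FL w" ?\<eta>] GL_FL[OF w] by simp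
    have \<xi>C: "?\<xi> ?C = (0, snd (?\<xi> ?C))"
      using fst_tangent_map_FL[OF c(1,3) \<xi>] \<eta>K FL\<xi> by (simp add: prod_eq_iff)
    have Dg: "FD ?g ?x (?\<xi> ?C) = (0, \<pi>)"
      using tangent_map_rep[OF TA smooth_FL C c(3) K z \<xi>] FL\<xi> \<eta>K by simp
    have g: "(?g has_derivative FD ?g ?x) (at ?x)"
      by (rule FD_has_derivative[OF smooth_on_differentiable[OF smooth_on_FL_rep[OF c(1)] imageI[OF c(3)]]])
    have dE_rep: "((\<lambda>x. snd (?g x) \<bullet> snd x - ?l x) has_derivative
        (\<lambda>h. snd (?g ?x) \<bullet> snd h + snd (FD ?g ?x h) \<bullet> snd ?x - FD ?l ?x h)) (at ?x)"
      by (intro has_derivative_diff has_derivative_inner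
          bounded_linear.has_derivative[OF bounded_linear_snd] has_derivative_ident g
          FD_has_derivative L_rep_differentiable c)
    have FD_E: "FD (energy A L \<circ> cinv ?C) ?x
        = (\<lambda>h. snd (?g ?x) \<bullet> snd h + snd (FD ?g ?x h) \<bullet> snd ?x - FD ?l ?x h)"
      by (rule trans[OF FD_cong[OF open_chart[OF TA C] imageI[OF c(3)] energy_local[OF c(1)]]
            FD_eqI[OF dE_rep]])
    have gx: "snd (?g ?x) = covec_coords A c (fst w) (snd (FL w))"
      by (simp only: o_apply inv cmap_cotangent_chart snd_conv fst_FL)
    \<comment> \<open>As \<open>?\<xi>\<close> is vertical, the variation of \<open>L\<close> is the
      momentum paired with the variation of the velocity, which cancels the first term in the
      derivative of the energy.\<close>
    have "FD ?l ?x (?\<xi> ?C) = FD ?l ?x (0, snd (?\<xi> ?C))" using \<xi>C by (rule arg_cong)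
    then have "FD ?l ?x (?\<xi> ?C) = snd (?g ?x) \<bullet> snd (?\<xi> ?C)"
      unfolding gx covec_coords_FL[OF c(1,3)] .
    moreover have "snd (FD ?g ?x (?\<xi> ?C)) \<bullet> snd ?x = \<pi> \<bullet> snd w c"
      unfolding Dg by simp
    moreover have "differential TA (energy A L) w ?\<xi>
        = snd (?g ?x) \<bullet> snd (?\<xi> ?C) + snd (FD ?g ?x (?\<xi> ?C)) \<bullet> snd ?x - FD ?l ?x (?\<xi> ?C)"
      unfolding differential_rep[OF TA smooth_energy C c(3) \<xi>] FD_E ..
    ultimately have dE: "differential TA (energy A L) w ?\<xi> = \<pi> \<bullet> snd w c"
      by linarith
    have "fst (?\<zeta> ?K) \<bullet> \<pi> = canonical_two_form A (FL w) ?\<zeta> ?\<eta>"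
      using canonical_two_form_rep[OF atlas c(1) z \<zeta>(2) \<eta>] \<eta>K by simp
    also have "\<dots> = differential CA H (FL w) ?\<eta>" by (rule Z_equation[OF zp \<eta>])
    also have "\<dots> = differential TA (H \<circ> FL) w ?\<xi>"
      using differential_comp[OF TA CA smooth_FL smooth_H w \<xi>] FL\<xi> by simp
    also have "\<dots> = differential TA (energy A L) w ?\<xi>"
      by (rule differential_cong[OF TA w]) (simp add: H_FL)
    finally show ?thesis using dE by (simp add: inner_commute)
  qed
  then have "fst (?\<zeta> ?K) = snd w c" by (metis vector_eq_rdot)
  then have "snd (tangent_map CA A fst (FL w, ?\<zeta>)) c = snd w c"
    using cotangent_proj_rep[OF atlas c(1) z \<zeta>(2)] by simp
  moreover have "snd (tangent_map CA A fst (FL w, ?\<zeta>)) \<in> tangent_space A (fst w)"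
    using tangent_map_in[OF CA atlas smooth_map_cotangent_proj[OF atlas] zp \<zeta>(2)] by simp
  moreover have "snd w \<in> tangent_space A (fst w)" using c(3) by auto
  ultimately have "snd (tangent_map CA A fst (FL w, ?\<zeta>)) = snd w"
    by (intro tangent_space_eqI[OF c(1,2)])
  then show ?thesis
    using \<zeta>(1) tangent_map_fst_snd[of CA A fst "FL w" ?\<zeta>] by (metis fst_FL prod.collapse)
qed

section \<open>Hamilton--Jacobi problems\<close>

text \<open>\<open>FL\<close> is a diffeomorphism over the base, so smoothness and the section
  property pass both ways. \<open>X\<close> is assumed only to be extensional with values in the
  tangent bundle, so that the equivalence can be applied to
  \<open>compose (points A) GL \<alpha>\<close> before that is known to be a vector field.\<close>

lemma one_form_iff_vector_field:
  assumes X: "X \<in> extensional (points A)" "X ` points A \<subseteq> points TA"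
  shows "one_form A (compose (points A) FL X) \<longleftrightarrow> vector_field A X"
proof
  assume X': "vector_field A X"
  have "smooth_map A CA (compose (points A) FL X)"
    by (rule smooth_map_cong[OF atlas smooth_map_comp[OF atlas TA CA _ smooth_FL]])
       (use X' in \<open>auto simp: vector_field_def compose_eq\<close>)
  then show "one_form A (compose (points A) FL X)"
    using X' by (simp add: one_form_def vector_field_def compose_eq)
next
  assume \<alpha>: "one_form A (compose (points A) FL X)"
  have "smooth_map A TA X"
    by (rule smooth_map_cong[OF atlas smooth_map_comp[OF atlas CA TA _ smooth_GL]])
       (use \<alpha> X in \<open>auto simp: one_form_def compose_eq GL_FL\<close>)
  moreover have "fst (X p) = p" if "p \<in> points A" for p
    using \<alpha> that fst_FL[of "X p"] by (simp add: one_form_def compose_eq)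
  ultimately show "vector_field A X" using X by (simp add: vector_field_def)
qed

lemma generalized_HJ_iff:
  assumes X: "vector_field A X"
  shows "generalized_lagrangian_HJ A L X \<longleftrightarrow> generalized_hamiltonian_HJ A H (compose (points A) FL X)"
proof -
  let ?\<alpha> = "compose (points A) FL X" let ?Y = "tangent_map CA A fst \<circ> Z \<circ> ?\<alpha>"
  have ext: "X \<in> extensional (points A)" using X by (simp add: vector_field_def)
  have Xp: "X p \<in> points TA" if "p \<in> points A" for p using vector_fieldD(3)[OF X that] .
  then have \<alpha>: "one_form A ?\<alpha>" using one_form_iff_vector_field[OF ext] X by auto
  have Y: "?Y p = X p" if "p \<in> points A" for p
    using proj_Z_FL[OF Xp[OF that]] that by (simp add: compose_eq)
  have base: "integral_curve A ?Y I \<gamma> \<longleftrightarrow> integral_curve A X I \<gamma>" for I \<gamma>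
    by (rule iffI; erule integral_curve_cong[OF atlas _ refl]) (simp_all only: Y)
  have lift: "integral_curve TA \<Gamma> I (X \<circ> \<gamma>) \<longleftrightarrow> integral_curve CA Z I (?\<alpha> \<circ> \<gamma>)"
    if \<gamma>: "integral_curve A X I \<gamma>" for I \<gamma>
  proof -
    have pts: "\<gamma> t \<in> points A" if "t \<in> I" for t
      using \<gamma> that smooth_map_points[of "{(I, \<lambda>t. t)}" A \<gamma> t] by (simp add: integral_curve_def points_def)
    show ?thesis
    proof
      assume "integral_curve TA \<Gamma> I (X \<circ> \<gamma>)"
      from integral_curve_push[OF TA CA smooth_FL Z_FL this]
      show "integral_curve CA Z I (?\<alpha> \<circ> \<gamma>)"
        by (rule integral_curve_cong[OF CA]) (simp_all add: compose_eq pts)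
    next
      assume "integral_curve CA Z I (?\<alpha> \<circ> \<gamma>)"
      from integral_curve_push[OF CA TA smooth_GL \<Gamma>_GL this]
      show "integral_curve TA \<Gamma> I (X \<circ> \<gamma>)"
        by (rule integral_curve_cong[OF TA]) (simp_all add: compose_eq pts GL_FL Xp)
    qed
  qed
  show ?thesis
    unfolding generalized_lagrangian_HJ_def generalized_hamiltonian_HJ_def
    using X \<alpha> base lift by blast
qed

lemma pullback_lagrange_two_form:
  assumes X: "vector_field A X" and p: "p \<in> points A"
    and v: "v \<in> tangent_space A p" and w: "w \<in> tangent_space A p"
  shows "pullback2 A TA X (lagrange_two_form A L) p v w
    = - exterior_derivative A (\<lambda>q. snd (compose (points A) FL X q)) p v w"
proof -
  let ?\<alpha> = "compose (points A) FL X"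
  have ext: "X \<in> extensional (points A)" and sX: "smooth_map A TA X"
    using X by (simp_all add: vector_field_def)
  have Xp: "X p \<in> points TA" if "p \<in> points A" for p using vector_fieldD(3)[OF X that] .
  then have \<alpha>: "one_form A ?\<alpha>" using one_form_iff_vector_field[OF ext] X by auto
  then have s\<alpha>: "smooth_map A CA ?\<alpha>" by (simp add: one_form_def)
  have T\<alpha>: "snd (tangent_map TA CA FL (X p, snd (tangent_map A TA X (p, u)))) = snd (tangent_map A CA ?\<alpha> (p, u))"
    if u: "u \<in> tangent_space A p" for u
    using tangent_map_comp[OF atlas TA CA sX smooth_FL p u] tangent_map_fst_snd[of A TA X p u]
      tangent_map_cong[OF atlas p, of ?\<alpha> "FL \<circ> X" CA u] by (simp add: compose_eq)
  \<comment> \<open>The projection undoes the section, hence its tangent map undoes that of the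
    section; the tautological form then evaluates the covector on the original vector.\<close>
  have taut: "snd (?\<alpha> q) u = canonical_one_form A (?\<alpha> q) (snd (tangent_map A CA ?\<alpha> (q, u)))"
    if q: "q \<in> points A" and u: "u \<in> tangent_space A q" for q u
  proof -
    have "tangent_map CA A fst (tangent_map A CA ?\<alpha> (q, u)) = (q, u)"
      using tangent_map_inverse[OF atlas CA s\<alpha> smooth_map_cotangent_proj[OF atlas] _ q u] \<alpha>
      by (simp add: one_form_def)
    then show ?thesis
      using canonical_one_form_eq[OF atlas smooth_map_points[OF s\<alpha> q] tangent_map_in[OF atlas CA s\<alpha> q u]]
        tangent_map_fst_snd[of A CA ?\<alpha> q u] by simp
  qed
  obtain c where c: "c \<in> A" "X p \<in> cdom (tangent_chart A c)"
    using points_tangent_chart[OF Xp[OF p]] .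
  have K: "?\<alpha> p \<in> cdom (cotangent_chart A c)"
    using FL_in_chart[OF c] p by (simp add: compose_eq)
  have "pullback2 A TA X (lagrange_two_form A L) p v w
      = canonical_two_form A (?\<alpha> p) (snd (tangent_map A CA ?\<alpha> (p, v))) (snd (tangent_map A CA ?\<alpha> (p, w)))"
    using lagrange_two_form_pullback[OF Xp[OF p] tangent_map_in[OF atlas TA sX p v] tangent_map_in[OF atlas TA sX p w]]
      T\<alpha>[OF v] T\<alpha>[OF w] p by (simp add: pullback2_def compose_eq)
  also have "\<dots> = - exterior_derivative A (\<lambda>q. snd (?\<alpha> q)) p v w"
    unfolding canonical_two_form_def
    by (subst exterior_derivative_pullback[where \<beta> = "canonical_one_form A", OF atlas CA s\<alpha>
          tangent_linear_canonical_one_form[OF atlas] taut p v w cotangent_chart_in[OF c(1)] K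
          canonical_form_rep(1)[OF atlas c(1) K]]) auto
  finally show ?thesis .
qed

lemma HJ_iff:
  assumes X: "vector_field A X"
  shows "lagrangian_HJ A L X \<longleftrightarrow> hamiltonian_HJ A H (compose (points A) FL X)"
  using generalized_HJ_iff[OF X] pullback_lagrange_two_form[OF X]
  by (simp add: lagrangian_HJ_def hamiltonian_HJ_def closed_one_form_def)

text \<open>Correspondence of all sections; the solution sets are cut out of the two sides by
  predicates that match under it.\<close>

lemma bij_betw_vector_fields_one_forms:
  "bij_betw (compose (points A) FL) {X. vector_field A X} {\<alpha>. one_form A \<alpha>}"
proof (rule bij_betw_byWitness[where f' = "compose (points A) GL"])
  have "compose (points A) GL (compose (points A) FL X) = X" if "vector_field A X" for X
    using that vector_fieldD(3)[OF that] GL_FL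
    by (intro extensionalityI[of _ "points A"]) (auto simp: vector_field_def compose_eq)
  then show "\<forall>X\<in>{X. vector_field A X}. compose (points A) GL (compose (points A) FL X) = X" by simp
  have pts: "\<alpha> p \<in> points CA" if "one_form A \<alpha>" "p \<in> points A" for \<alpha> p
    using smooth_map_points[of A CA \<alpha> p] that by (simp add: one_form_def)
  have inv: "compose (points A) FL (compose (points A) GL \<alpha>) = \<alpha>" if "one_form A \<alpha>" for \<alpha>
    using that pts[OF that] FL_GL
    by (intro extensionalityI[of _ "points A"]) (auto simp: one_form_def compose_eq)
  then show "\<forall>\<alpha>\<in>{\<alpha>. one_form A \<alpha>}. compose (points A) FL (compose (points A) GL \<alpha>) = \<alpha>" by simp
  show "compose (points A) FL ` {X. vector_field A X} \<subseteq> {\<alpha>. one_form A \<alpha>}"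
  proof clarify
    fix X assume X: "vector_field A X"
    then have "X \<in> extensional (points A)" "X ` points A \<subseteq> points TA"
      using vector_fieldD(3)[OF X] by (auto simp: vector_field_def)
    with X show "one_form A (compose (points A) FL X)" by (simp only: one_form_iff_vector_field)
  qed
  have "vector_field A (compose (points A) GL \<alpha>)" if \<alpha>: "one_form A \<alpha>" for \<alpha>
    using one_form_iff_vector_field[of "compose (points A) GL \<alpha>"] inv[OF \<alpha>] \<alpha>
      smooth_map_points[OF smooth_GL pts[OF \<alpha>]] by (auto simp: compose_eq)
  then show "compose (points A) GL ` {\<alpha>. one_form A \<alpha>} \<subseteq> {X. vector_field A X}" by auto
qed

end

lemma bij_betw_restrict_iff:
  assumes "bij_betw f A B" "S \<subseteq> A" "T \<subseteq> B" "\<And>x. x \<in> A \<Longrightarrow> x \<in> S \<longleftrightarrow> f x \<in> T"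
  shows "bij_betw f S T"
  using assms unfolding bij_betw_def by (auto intro: inj_on_subset)

theorem theorem3:
  fixes A :: "('a, 'e::euclidean_space) chart set"
    and L :: "'a \<times> ('a, 'e) tvec \<Rightarrow> real"
  assumes "smooth_manifold A"
    and "smooth_function (tangent_atlas A) L"
    and "hyper_regular A L"
  shows "bij_betw (\<lambda>X. compose (points A) (legendre_map A L) X)
           {X. generalized_lagrangian_HJ A L X}
           {\<alpha>. generalized_hamiltonian_HJ A (hamiltonian A L) \<alpha>}
       \<and> bij_betw (\<lambda>X. compose (points A) (legendre_map A L) X)
           {X. lagrangian_HJ A L X}
           {\<alpha>. hamiltonian_HJ A (hamiltonian A L) \<alpha>}"
proof -
  interpret hyper_regular_lagrangian A L
    using assms by unfold_locales (auto simp: smooth_manifold_def)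
  have gen: "\<And>X. generalized_lagrangian_HJ A L X \<Longrightarrow> vector_field A X"
    "\<And>\<alpha>. generalized_hamiltonian_HJ A H \<alpha> \<Longrightarrow> one_form A \<alpha>"
    by (simp_all add: generalized_lagrangian_HJ_def generalized_hamiltonian_HJ_def)
  have closed: "\<And>X. lagrangian_HJ A L X \<Longrightarrow> vector_field A X"
    "\<And>\<alpha>. hamiltonian_HJ A H \<alpha> \<Longrightarrow> one_form A \<alpha>"
    using gen by (simp_all add: lagrangian_HJ_def hamiltonian_HJ_def)
  \<comment> \<open>Both claims have this pattern: predicates on the two sides that imply being a
    section and correspond under the map.\<close>
  have "bij_betw (compose (points A) FL) {X. P X} {\<alpha>. Q \<alpha>}"
    if "\<And>X. P X \<Longrightarrow> vector_field A X" "\<And>\<alpha>. Q \<alpha> \<Longrightarrow> one_form A \<alpha>"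
      "\<And>X. vector_field A X \<Longrightarrow> P X \<longleftrightarrow> Q (compose (points A) FL X)" for P Q
    by (rule bij_betw_restrict_iff[OF bij_betw_vector_fields_one_forms]) (use that in auto)
  from this[where P = "generalized_lagrangian_HJ A L" and Q = "generalized_hamiltonian_HJ A H",
      OF gen generalized_HJ_iff]
    this[where P = "lagrangian_HJ A L" and Q = "hamiltonian_HJ A H", OF closed HJ_iff]
  show ?thesis by (rule conjI)
qed

end
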